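(* Let $M$ be a connected manifold of dimension at least $2$, and let $F(x,\xi)=\sqrt{g(\xi,\xi)}+\omega(\xi)$ and $\bar F(x,\xi)=\sqrt{\bar g(\xi,\xi)}+\bar\omega(\xi)$ be two Randers metrics on $M$, where $g,\bar g$ are Riemannian metrics and $\omega,\bar\omega$ are $1$-forms on $M$. Suppose that $F$ and $\bar F$ are projectively equivalent, and that at least one of the forms $\omega$ and $\bar\omega$ is not closed. Then there exists a constant $c\in\mathbb{R}_{>0}$ such that $g=c^2\cdot\bar g$ on $M$ and the $1$-form $\omega-c\cdot\bar\omega$ is closed.
   Context: All objects considered (metrics, forms) are assumed to be at least $C^2$-smooth. A Randers metric on a manifold $M$ is a Finsler metric of the form $F(x,\xi)=\sqrt{g(x)_{ij}\xi^i\xi^j}+\omega(x)_i\xi^i=\sqrt{g(\xi,\xi)}+\omega(\xi)$, where $g$ is a Riemannian metric and $\omega$ is a $1$-form on $M$; that $F$ is a Finsler metric is equivalent to the $g$-norm of $\omega$ being less than one at every point. A forward geodesic of a Finsler metric $F$ is a regular curve $x:I\to M$ ($I$ an interval) such that for any sufficiently close $a,b\in I$, $a\le b$, the restriction of $x$ to $[a,b]$ is an extremal of the forward-length functional $L^+_F(c)=\int_a^b F(c(t),\dot c(t))\,dt$ in the set of all smooth curves $c:[a,b]\to M$ connecting $x(a)$ and $x(b)$. No preferred parameter is assumed: an orientation-preserving reparameterization of a forward geodesic is again a forward geodesic. Two Finsler metrics $F,\bar F$ on the same manifold are projectively equivalent if every forward geodesic of $F$ is a forward geodesic of $\bar F$.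 *)

theory Defs
  imports "HOL-Analysis.Analysis"
begin

section \<open>Functions of class \<open>C\<^sup>k\<close>\<close>

primrec Ck_open ::
  "nat \<Rightarrow> ('a::euclidean_space \<Rightarrow> 'b::euclidean_space) \<Rightarrow> 'a set \<Rightarrow> bool" where
  "Ck_open 0 f S \<longleftrightarrow> continuous_on S f"
| "Ck_open (Suc k) f S \<longleftrightarrow> (\<forall>x\<in>S. f differentiable (at x)) \<and>
     (\<forall>v. Ck_open k (\<lambda>x. frechet_derivative f (at x) v) S)"

text \<open>
  On an arbitrary set (for instance a compact interval), a function is of class \<open>C\<^sup>k\<close> if it
  locally extends to a \<open>C\<^sup>k\<close> function on an open set.
\<close>

definition Ck_on ::
  "nat \<Rightarrow> ('a::euclidean_space \<Rightarrow> 'b::euclidean_space) \<Rightarrow> 'a set \<Rightarrow> bool" where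
  "Ck_on k f S \<longleftrightarrow> (\<forall>x\<in>S. \<exists>V h. open V \<and> x \<in> V \<and> Ck_open k h V \<and> (\<forall>y\<in>S \<inter> V. f y = h y))"


section \<open>Smooth manifolds\<close>

text \<open>
  A chart is a domain together with a coordinate map. Only the values of the map on the domain
  are meaningful.
\<close>

type_synonym ('m, 'a) chart = "'m set \<times> ('m \<Rightarrow> 'a)"

abbreviation chart_dom :: "('m, 'a) chart \<Rightarrow> 'm set" where
  "chart_dom \<kappa> \<equiv> fst \<kappa>"

abbreviation chart_map :: "('m, 'a) chart \<Rightarrow> 'm \<Rightarrow> 'a" where
  "chart_map \<kappa> \<equiv> snd \<kappa>"

abbreviation chart_img :: "('m, 'a) chart \<Rightarrow> 'a set" where
  "chart_img \<kappa> \<equiv> chart_map \<kappa> ` chart_dom \<kappa>"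

abbreviation chart_inv :: "('m, 'a) chart \<Rightarrow> 'a \<Rightarrow> 'm" where
  "chart_inv \<kappa> \<equiv> inv_into (chart_dom \<kappa>) (chart_map \<kappa>)"

definition is_chart :: "'m topology \<Rightarrow> ('m, 'a::euclidean_space) chart \<Rightarrow> bool" where
  "is_chart X \<kappa> \<longleftrightarrow> openin X (chart_dom \<kappa>) \<and> open (chart_img \<kappa>) \<and>
     homeomorphic_map (subtopology X (chart_dom \<kappa>)) (top_of_set (chart_img \<kappa>)) (chart_map \<kappa>)"

definition transition :: "('m, 'a) chart \<Rightarrow> ('m, 'a) chart \<Rightarrow> 'a \<Rightarrow> 'a" where
  "transition \<kappa> \<mu> = chart_map \<mu> \<circ> chart_inv \<kappa>"

text \<open>
  A smooth manifold (without boundary) of dimension \<open>DIM('a)\<close>: a second countable Hausdorff space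
  with a \<open>C\<^sup>\<infinity>\<close> atlas, which need not be maximal.
\<close>

definition smooth_manifold ::
  "'m topology \<Rightarrow> ('m, 'a::euclidean_space) chart set \<Rightarrow> bool" where
  "smooth_manifold X A \<longleftrightarrow>
     Hausdorff_space X \<and>
     second_countable X \<and>
     (\<forall>\<kappa>\<in>A. is_chart X \<kappa>) \<and>
     (\<Union>\<kappa>\<in>A. chart_dom \<kappa>) = topspace X \<and>
     (\<forall>\<kappa>\<in>A. \<forall>\<mu>\<in>A. \<forall>k.
        Ck_open k (transition \<kappa> \<mu>) (chart_map \<kappa> ` (chart_dom \<kappa> \<inter> chart_dom \<mu>)))"

definition Ck_map ::
  "nat \<Rightarrow> 'm topology \<Rightarrow> ('m, 'a::euclidean_space) chart set \<Rightarrow> 'e::euclidean_space set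
    \<Rightarrow> ('e \<Rightarrow> 'm) \<Rightarrow> bool" where
  "Ck_map k X A S f \<longleftrightarrow> continuous_map (top_of_set S) X f \<and>
     (\<forall>\<kappa>\<in>A. Ck_on k (chart_map \<kappa> \<circ> f) (S \<inter> f -` chart_dom \<kappa>))"


section \<open>Tangent vectors and tensor fields\<close>

text \<open>
  A tangent vector at \<open>p\<close> is the family of its coordinate vectors in all charts around \<open>p\<close>,
  subject to the usual transformation rule; charts of the atlas not containing \<open>p\<close> and pairs
  outside the atlas are assigned 0, so that a tangent vector is determined by its coordinates in
  any one chart around \<open>p\<close>.
\<close>

type_synonym ('m, 'a) tangent = "('m, 'a) chart \<Rightarrow> 'a"

definition tangent_space ::
  "('m, 'a::euclidean_space) chart set \<Rightarrow> 'm \<Rightarrow> ('m, 'a) tangent set" where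
  "tangent_space A p = {\<xi>.
     (\<forall>\<kappa>\<in>A. \<forall>\<mu>\<in>A. p \<in> chart_dom \<kappa> \<inter> chart_dom \<mu> \<longrightarrow>
        \<xi> \<mu> = frechet_derivative (transition \<kappa> \<mu>) (at (chart_map \<kappa> p)) (\<xi> \<kappa>)) \<and>
     (\<forall>\<kappa>. \<not> (\<kappa> \<in> A \<and> p \<in> chart_dom \<kappa>) \<longrightarrow> \<xi> \<kappa> = 0)}"

text \<open>The tangent vector at \<open>p\<close> with coordinate vector \<open>u\<close> in the chart \<open>\<kappa>\<close>.\<close>

definition coord_vec ::
  "('m, 'a::euclidean_space) chart set \<Rightarrow> ('m, 'a) chart \<Rightarrow> 'm \<Rightarrow> 'a \<Rightarrow> ('m, 'a) tangent" where
  "coord_vec A \<kappa> p u = (\<lambda>\<mu>.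
     if \<mu> \<in> A \<and> p \<in> chart_dom \<mu>
     then frechet_derivative (transition \<kappa> \<mu>) (at (chart_map \<kappa> p)) u else 0)"

text \<open>
  Fields on the manifold are functions of a point and of tangent vectors at that point.
  Linearity and regularity are expressed through the local representations below, whose
  arguments are the coordinates \<open>y\<close> of the point and \<open>u\<close>, \<open>v\<close> of the tangent vectors.
\<close>

definition local_rep ::
  "('m, 'a::euclidean_space) chart set \<Rightarrow> ('m, 'a) chart
    \<Rightarrow> ('m \<Rightarrow> ('m, 'a) tangent \<Rightarrow> real) \<Rightarrow> 'a \<Rightarrow> 'a \<Rightarrow> real" where
  "local_rep A \<kappa> F y u = F (chart_inv \<kappa> y) (coord_vec A \<kappa> (chart_inv \<kappa> y) u)"

definition local_rep2 ::
  "('m, 'a::euclidean_space) chart set \<Rightarrow> ('m, 'a) chart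
    \<Rightarrow> ('m \<Rightarrow> ('m, 'a) tangent \<Rightarrow> ('m, 'a) tangent \<Rightarrow> real) \<Rightarrow> 'a \<Rightarrow> 'a \<Rightarrow> 'a \<Rightarrow> real" where
  "local_rep2 A \<kappa> g y u v =
     g (chart_inv \<kappa> y) (coord_vec A \<kappa> (chart_inv \<kappa> y) u) (coord_vec A \<kappa> (chart_inv \<kappa> y) v)"

definition one_form ::
  "('m, 'a::euclidean_space) chart set \<Rightarrow> ('m \<Rightarrow> ('m, 'a) tangent \<Rightarrow> real) \<Rightarrow> bool" where
  "one_form A \<omega> \<longleftrightarrow> (\<forall>\<kappa>\<in>A.
     (\<forall>y\<in>chart_img \<kappa>. linear (local_rep A \<kappa> \<omega> y)) \<and>
     (\<forall>u. Ck_open 2 (\<lambda>y. local_rep A \<kappa> \<omega> y u) (chart_img \<kappa>)))"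

definition ext_deriv ::
  "('m, 'a::euclidean_space) chart set \<Rightarrow> ('m, 'a) chart
    \<Rightarrow> ('m \<Rightarrow> ('m, 'a) tangent \<Rightarrow> real) \<Rightarrow> 'a \<Rightarrow> 'a \<Rightarrow> 'a \<Rightarrow> real" where
  "ext_deriv A \<kappa> \<omega> y u v =
     frechet_derivative (\<lambda>z. local_rep A \<kappa> \<omega> z v) (at y) u -
     frechet_derivative (\<lambda>z. local_rep A \<kappa> \<omega> z u) (at y) v"

definition closed_form ::
  "('m, 'a::euclidean_space) chart set \<Rightarrow> ('m \<Rightarrow> ('m, 'a) tangent \<Rightarrow> real) \<Rightarrow> bool" where
  "closed_form A \<omega> \<longleftrightarrow> (\<forall>\<kappa>\<in>A. \<forall>y\<in>chart_img \<kappa>. \<forall>u v. ext_deriv A \<kappa> \<omega> y u v = 0)"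

definition riemannian_metric ::
  "('m, 'a::euclidean_space) chart set
    \<Rightarrow> ('m \<Rightarrow> ('m, 'a) tangent \<Rightarrow> ('m, 'a) tangent \<Rightarrow> real) \<Rightarrow> bool" where
  "riemannian_metric A g \<longleftrightarrow> (\<forall>\<kappa>\<in>A.
     (\<forall>y\<in>chart_img \<kappa>.
        bilinear (local_rep2 A \<kappa> g y) \<and>
        (\<forall>u v. local_rep2 A \<kappa> g y u v = local_rep2 A \<kappa> g y v u) \<and>
        (\<forall>u. u \<noteq> 0 \<longrightarrow> local_rep2 A \<kappa> g y u u > 0)) \<and>
     (\<forall>u v. Ck_open 2 (\<lambda>y. local_rep2 A \<kappa> g y u v) (chart_img \<kappa>)))"


section \<open>Finsler and Randers metrics\<close>

text \<open>
  The last condition says that the fundamental tensor, the Hessian of \<open>F\<^sup>2 / 2\<close> in the direction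
  variable, is positive definite away from the zero section.
\<close>

definition finsler_metric ::
  "('m, 'a::euclidean_space) chart set \<Rightarrow> ('m \<Rightarrow> ('m, 'a) tangent \<Rightarrow> real) \<Rightarrow> bool" where
  "finsler_metric A F \<longleftrightarrow> (\<forall>\<kappa>\<in>A.
     Ck_open 2 (\<lambda>(y, u). local_rep A \<kappa> F y u) (chart_img \<kappa> \<times> (- {0})) \<and>
     (\<forall>y\<in>chart_img \<kappa>.
        (\<forall>u. \<forall>t\<ge>0. local_rep A \<kappa> F y (t *\<^sub>R u) = t * local_rep A \<kappa> F y u) \<and>
        (\<forall>u. u \<noteq> 0 \<longrightarrow> local_rep A \<kappa> F y u > 0) \<and>
        (\<forall>u v. u \<noteq> 0 \<longrightarrow> v \<noteq> 0 \<longrightarrow>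
           frechet_derivative
             (\<lambda>w. frechet_derivative (\<lambda>w. (local_rep A \<kappa> F y w)\<^sup>2 / 2) (at w) v) (at u) v > 0)))"

definition randers ::
  "('m \<Rightarrow> ('m, 'a) tangent \<Rightarrow> ('m, 'a) tangent \<Rightarrow> real)
    \<Rightarrow> ('m \<Rightarrow> ('m, 'a) tangent \<Rightarrow> real) \<Rightarrow> 'm \<Rightarrow> ('m, 'a) tangent \<Rightarrow> real" where
  "randers g \<omega> p \<xi> = sqrt (g p \<xi> \<xi>) + \<omega> p \<xi>"

definition randers_metric ::
  "('m, 'a::euclidean_space) chart set
    \<Rightarrow> ('m \<Rightarrow> ('m, 'a) tangent \<Rightarrow> ('m, 'a) tangent \<Rightarrow> real)
    \<Rightarrow> ('m \<Rightarrow> ('m, 'a) tangent \<Rightarrow> real) \<Rightarrow> bool" where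
  "randers_metric A g \<omega> \<longleftrightarrow>
     riemannian_metric A g \<and> one_form A \<omega> \<and> finsler_metric A (randers g \<omega>)"


section \<open>Forward geodesics\<close>

text \<open>Curves are functions on \<open>\<real>\<close> of which only the values on the parameter interval \<open>I\<close> matter.\<close>

definition velocity ::
  "('m, 'a::euclidean_space) chart set \<Rightarrow> real set \<Rightarrow> (real \<Rightarrow> 'm) \<Rightarrow> real \<Rightarrow> ('m, 'a) tangent" where
  "velocity A I x t = (\<lambda>\<kappa>.
     if \<kappa> \<in> A \<and> x t \<in> chart_dom \<kappa>
     then vector_derivative (chart_map \<kappa> \<circ> x) (at t within I) else 0)"

definition forward_length ::
  "('m, 'a::euclidean_space) chart set \<Rightarrow> ('m \<Rightarrow> ('m, 'a) tangent \<Rightarrow> real)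
    \<Rightarrow> real \<Rightarrow> real \<Rightarrow> (real \<Rightarrow> 'm) \<Rightarrow> real" where
  "forward_length A F a b c = integral {a..b} (\<lambda>t. F (c t) (velocity A {a..b} c t))"

definition regular_curve ::
  "'m topology \<Rightarrow> ('m, 'a::euclidean_space) chart set \<Rightarrow> real set \<Rightarrow> (real \<Rightarrow> 'm) \<Rightarrow> bool" where
  "regular_curve X A I x \<longleftrightarrow> Ck_map 2 X A I x \<and>
     (\<forall>t\<in>I. \<forall>\<kappa>\<in>A. x t \<in> chart_dom \<kappa> \<longrightarrow> velocity A I x t \<kappa> \<noteq> 0)"

definition variation ::
  "'m topology \<Rightarrow> ('m, 'a::euclidean_space) chart set \<Rightarrow> real \<Rightarrow> real \<Rightarrow> (real \<Rightarrow> 'm)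
    \<Rightarrow> real \<Rightarrow> (real \<Rightarrow> real \<Rightarrow> 'm) \<Rightarrow> bool" where
  "variation X A a b x \<epsilon> H \<longleftrightarrow>
     Ck_map 2 X A ({-\<epsilon><..<\<epsilon>} \<times> {a..b}) (\<lambda>(s, t). H s t) \<and>
     (\<forall>t\<in>{a..b}. H 0 t = x t) \<and>
     (\<forall>s\<in>{-\<epsilon><..<\<epsilon>}. H s a = x a \<and> H s b = x b)"

text \<open>
  An extremal of the forward length is a critical point: the first variation vanishes for every
  variation with fixed endpoints.
\<close>

definition extremal ::
  "'m topology \<Rightarrow> ('m, 'a::euclidean_space) chart set \<Rightarrow> ('m \<Rightarrow> ('m, 'a) tangent \<Rightarrow> real)
    \<Rightarrow> real \<Rightarrow> real \<Rightarrow> (real \<Rightarrow> 'm) \<Rightarrow> bool" where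
  "extremal X A F a b x \<longleftrightarrow> (\<forall>\<epsilon>>0. \<forall>H. variation X A a b x \<epsilon> H \<longrightarrow>
     ((\<lambda>s. forward_length A F a b (H s)) has_real_derivative 0) (at 0))"

definition forward_geodesic ::
  "'m topology \<Rightarrow> ('m, 'a::euclidean_space) chart set \<Rightarrow> ('m \<Rightarrow> ('m, 'a) tangent \<Rightarrow> real)
    \<Rightarrow> real set \<Rightarrow> (real \<Rightarrow> 'm) \<Rightarrow> bool" where
  "forward_geodesic X A F I x \<longleftrightarrow>
     is_interval I \<and> interior I \<noteq> {} \<and> regular_curve X A I x \<and>
     (\<forall>t\<in>I. \<exists>\<delta>>0. \<forall>a\<in>I. \<forall>b\<in>I.
        \<bar>a - t\<bar> < \<delta> \<longrightarrow> \<bar>b - t\<bar> < \<delta> \<longrightarrow> a \<le> b \<longrightarrow> extremal X A F a b x)"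

definition projectively_equivalent ::
  "'m topology \<Rightarrow> ('m, 'a::euclidean_space) chart set \<Rightarrow> ('m \<Rightarrow> ('m, 'a) tangent \<Rightarrow> real)
    \<Rightarrow> ('m \<Rightarrow> ('m, 'a) tangent \<Rightarrow> real) \<Rightarrow> bool" where
  "projectively_equivalent X A F F' \<longleftrightarrow>
     (\<forall>I x. forward_geodesic X A F I x \<longrightarrow> forward_geodesic X A F' I x)"

end

theory Submission
  imports Defs "HOL-Complex_Analysis.Great_Picard" "HOL-Computational_Algebra.Field_as_Ring"
    "HOL-Computational_Algebra.Polynomial_Factorial"
begin

text \<open>
  Let \<open>\<Gamma>\<close> be the Christoffel symbols of \<open>g\<close>, and let \<open>J\<close> be \<open>d\<omega>\<close> with an index raised by \<open>g\<close>.
  Parametrized by constant \<open>g\<close>-speed, the forward geodesics of \<open>F = \<surd>g + \<omega>\<close> are the solutions of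
  \<open>x'' = |x'| J x' - \<Gamma>(x', x')\<close>, and the reparametrizations of these curves are the solutions up to
  multiples of \<open>x'\<close>. Such a geodesic starts in every direction at every point (\<open>peano_existence\<close>),
  so projective equivalence says that the right-hand sides belonging to \<open>F\<close> and to \<open>F'\<close> differ at
  \<open>(x, \<xi>)\<close> by a multiple of \<open>\<xi>\<close> (\<open>projectively_equivalent_sprays\<close>). The term with \<open>J\<close> is odd in \<open>\<xi>\<close>
  and the term with \<open>\<Gamma>\<close> is even; comparing \<open>\<xi>\<close> with \<open>-\<xi>\<close> separates the condition into two
  (\<open>spray_parity\<close>):
  \<^item> \<open>\<Gamma>'(\<xi>, \<xi>) - \<Gamma>(\<xi>, \<xi>)\<close> is a multiple of \<open>\<xi>\<close>, so the Riemannian metrics \<open>g\<close> and \<open>g'\<close> have the same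
    geodesics up to parametrization;
  \<^item> \<open>|\<xi>| J \<xi> - |\<xi>|' J' \<xi>\<close> is a multiple of \<open>\<xi>\<close>.

  The second condition is algebraic. Eliminating the multiple and squaring gives \<open>g P\<^sup>2 = g' P'\<^sup>2\<close> with
  polynomials \<open>P\<close>, \<open>P'\<close> in \<open>\<xi>\<close>; a definite quadratic form in two variables is irreducible, and it
  divides the two sides to powers of the same parity only if \<open>g\<close> and \<open>g'\<close> are proportional. So
  where \<open>d\<omega>\<close> or \<open>d\<omega>'\<close> is nonzero, \<open>g = c\<^sup>2 g'\<close> and \<open>d\<omega> = c d\<omega>'\<close> with some \<open>c > 0\<close>
  (\<open>conformal_of_sqrt_multiples\<close>, \<open>conformal_where_not_closed\<close>). Conformal metrics with the same
  geodesics are homothetic (\<open>conformal_factor_constant\<close>, where the dimension enters), so \<open>c\<close> is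
  constant near such a point.

  It remains to spread the homothety over \<open>M\<close>, also where both forms are closed. Along a
  geodesic of \<open>g\<close>, the quantity \<open>g'(x', x')\<^sup>n\<^sup>+\<^sup>1 (det g / det g')\<^sup>2\<close> is constant
  (\<open>geodesic_integral\<close>). Let a coordinate ball on which \<open>g = k g'\<close> touch a point \<open>p\<close> with its boundary.
  From every point close to \<open>p\<close>, the geodesics of \<open>g\<close> in an open set of directions enter the ball; the
  conserved quantities then make \<open>g'\<close> proportional to \<open>g\<close> on an open set of vectors, hence on all
  vectors, so the metrics are conformal and therefore homothetic near \<open>p\<close>
  (\<open>homothetic_touching_ball\<close>). Thus the set of points near which \<open>g = k g'\<close> is open and
  closed, and it is all of the connected manifold \<open>M\<close> (\<open>homothetic_everywhere\<close>).
\<close>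

section \<open>Calculus of class \<open>C\<^sup>k\<close>\<close>

text \<open>
  Several constructions below replace a function by a formula that agrees with it only on the open
  set in question; openness makes the derivatives agree as well, to every order.
\<close>

lemma Ck_open_cong:
  assumes "open S" "\<And>x. x \<in> S \<Longrightarrow> f x = g x" "Ck_open k f S"
  shows "Ck_open k g S"
  using assms(2,3)
proof (induction k arbitrary: f g)
  case 0
  then show ?case using continuous_on_eq by auto
next
  case (Suc k)
  have d: "frechet_derivative f (at x) = frechet_derivative g (at x)" if "x \<in> S" for x
    using frechet_derivative_transform_within_open[of f x S g] Suc.prems that assms(1) by auto
  have "g differentiable (at x)" if "x \<in> S" for x
  proof -
    have "(f has_derivative frechet_derivative f (at x)) (at x)"
      using Suc.prems that frechet_derivative_works by auto
    then have "(g has_derivative frechet_derivative f (at x)) (at x)"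
      using has_derivative_transform_within_open[OF _ assms(1) that] Suc.prems by blast
    then show ?thesis by (auto simp: differentiable_def)
  qed
  moreover have "Ck_open k (\<lambda>x. frechet_derivative g (at x) v) S" for v
    by (rule Suc.IH[of "\<lambda>x. frechet_derivative f (at x) v"]) (use Suc.prems d in auto)
  ultimately show ?case by auto
qed

lemma Ck_open_subset: "Ck_open k f S \<Longrightarrow> T \<subseteq> S \<Longrightarrow> Ck_open k f T"
  by (induction k arbitrary: f) (auto intro: continuous_on_subset)

lemma Ck_open_Suc_imp: "Ck_open (Suc k) f S \<Longrightarrow> Ck_open k f S"
proof (induction k arbitrary: f)
  case 0
  then show ?case
    by (auto intro!: continuous_at_imp_continuous_on differentiable_imp_continuous_within)
next
  case (Suc k)
  then show ?case by (metis Ck_open.simps(2))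
qed

lemma Ck_open_imp_continuous_on: "Ck_open k f S \<Longrightarrow> continuous_on S f"
  by (induction k) (auto dest: Ck_open_Suc_imp simp del: Ck_open.simps(2))

lemma Ck_open_SucI:
  assumes "open S" "\<And>x. x \<in> S \<Longrightarrow> (f has_derivative f' x) (at x)"
    and "\<And>v. Ck_open k (\<lambda>x. f' x v) S"
  shows "Ck_open (Suc k) f S"
proof -
  have "frechet_derivative f (at x) = f' x" if "x \<in> S" for x
    using assms(2)[OF that] frechet_derivative_at by metis
  then have "Ck_open k (\<lambda>x. frechet_derivative f (at x) v) S" for v
    by (intro Ck_open_cong[OF assms(1) _ assms(3)[of v]]) auto
  then show ?thesis using assms(2) by (auto simp: differentiable_def)
qed

lemma Ck_open_SucD:
  assumes "Ck_open (Suc k) f S" "x \<in> S"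
  shows "(f has_derivative frechet_derivative f (at x)) (at x)"
  using assms frechet_derivative_works by auto

lemma Ck_open_const: "open S \<Longrightarrow> Ck_open k (\<lambda>x. c) S"
  by (induction k arbitrary: c) auto

lemma Ck_open_bounded_linear:
  assumes "open S" "bounded_linear L"
  shows "Ck_open k L S"
proof (cases k)
  case 0
  then show ?thesis using assms linear_continuous_on by auto
next
  case (Suc k)
  show ?thesis unfolding Suc
    by (rule Ck_open_SucI[OF assms(1), of _ "\<lambda>x. L"])
      (use assms in \<open>auto intro: bounded_linear_imp_has_derivative Ck_open_const\<close>)
qed

lemma Ck_open_add:
  assumes "open S" "Ck_open k f S" "Ck_open k g S"
  shows "Ck_open k (\<lambda>x. f x + g x) S"
  using assms(2,3)
proof (induction k arbitrary: f g)
  case 0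
  then show ?case by (auto intro: continuous_intros)
next
  case (Suc k)
  show ?case
    by (rule Ck_open_SucI[OF assms(1) has_derivative_add[OF Ck_open_SucD[OF Suc.prems(1)] Ck_open_SucD[OF Suc.prems(2)]]])
      (use Suc in auto)
qed

lemma Ck_open_sum:
  assumes "open S" "finite I" "\<And>i. i \<in> I \<Longrightarrow> Ck_open k (f i) S"
  shows "Ck_open k (\<lambda>x. \<Sum>i\<in>I. f i x) S"
  using assms(2,3)
  by (induction I rule: finite_induct) (auto intro!: Ck_open_add Ck_open_const assms(1))

lemma Ck_open_scaleR:
  assumes "open S" "Ck_open k f S" "Ck_open k g S"
  shows "Ck_open k (\<lambda>x. f x *\<^sub>R g x) S"
  using assms(2,3)
proof (induction k arbitrary: f g)
  case 0
  then show ?case by (auto intro: continuous_intros)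
next
  case (Suc k)
  have "Ck_open k f S" "Ck_open k g S"
    using Suc.prems Ck_open_Suc_imp by blast+
  then show ?case
    by (intro Ck_open_SucI[OF assms(1) has_derivative_scaleR[OF Ck_open_SucD[OF Suc.prems(1)] Ck_open_SucD[OF Suc.prems(2)]]]
        Ck_open_add assms(1) Suc.IH)
      (use Suc.prems in auto)
qed

lemma Ck_open_linear_compose:
  assumes "open S" "bounded_linear L" "Ck_open k f S"
  shows "Ck_open k (\<lambda>x. L (f x)) S"
  using assms(3)
proof (induction k arbitrary: f)
  case 0
  then show ?case using bounded_linear.continuous_on[OF assms(2)] by auto
next
  case (Suc k)
  show ?case
    by (rule Ck_open_SucI[OF assms(1) bounded_linear.has_derivative[OF assms(2) Ck_open_SucD[OF Suc.prems(1)]]])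
      (use Suc in auto)
qed

text \<open>
  The derivative of \<open>f \<circ> g\<close> in direction \<open>v\<close> is expanded over the standard basis into products of
  partial derivatives of \<open>f\<close> along \<open>g\<close> with components of \<open>Dg v\<close>, so that the induction hypothesis applies to
  each factor.
\<close>

lemma Ck_open_compose:
  fixes f :: "'b::euclidean_space \<Rightarrow> 'c::euclidean_space" and g :: "'a::euclidean_space \<Rightarrow> 'b"
  assumes "open S" "open T" "g ` S \<subseteq> T" "Ck_open k f T" "Ck_open k g S"
  shows "Ck_open k (\<lambda>x. f (g x)) S"
  using assms(4,5)
proof (induction k arbitrary: f)
  case 0
  then show ?case using assms(3) by (auto intro: continuous_on_compose2)
next
  case (Suc k)
  have gk: "Ck_open k g S" using Suc.prems Ck_open_Suc_imp by blast
  have sum: "frechet_derivative f (at (g x)) (frechet_derivative g (at x) v)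
      = (\<Sum>b\<in>Basis. (frechet_derivative g (at x) v \<bullet> b) *\<^sub>R frechet_derivative f (at (g x)) b)"
    if "x \<in> S" for x v
  proof -
    have "linear (frechet_derivative f (at (g x)))"
      using Suc.prems(1) that assms(3) by (auto intro: linear_frechet_derivative)
    then show ?thesis
      by (subst (1) euclidean_representation[symmetric]) (simp add: linear_sum linear_scale)
  qed
  have "Ck_open k (\<lambda>x. \<Sum>b\<in>Basis. (frechet_derivative g (at x) v \<bullet> b) *\<^sub>R frechet_derivative f (at (g x)) b) S" for v
    using Suc.prems gk
    by (intro Ck_open_sum Ck_open_scaleR assms(1) Suc.IH finite_Basis
        Ck_open_linear_compose[OF assms(1) bounded_linear_inner_left]) auto
  then have "Ck_open k (\<lambda>x. frechet_derivative f (at (g x)) (frechet_derivative g (at x) v)) S" for v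
    by (rule Ck_open_cong[OF assms(1), rotated]) (use sum in auto)
  moreover have "((\<lambda>x. f (g x)) has_derivative (\<lambda>v. frechet_derivative f (at (g x)) (frechet_derivative g (at x) v))) (at x)"
    if "x \<in> S" for x
    using diff_chain_at[OF Ck_open_SucD[OF Suc.prems(2) that] Ck_open_SucD[OF Suc.prems(1)]] that assms(3)
    by (auto simp: o_def)
  ultimately show ?case by (intro Ck_open_SucI[OF assms(1)]) auto
qed

lemma Ck_open_real_SucI:
  fixes c :: "real \<Rightarrow> 'a::euclidean_space"
  assumes "open S" "\<And>t. t \<in> S \<Longrightarrow> (c has_vector_derivative c' t) (at t)" "Ck_open k c' S"
  shows "Ck_open (Suc k) c S"
  by (rule Ck_open_SucI[OF assms(1), of _ "\<lambda>t h. h *\<^sub>R c' t"])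
    (use assms in \<open>auto simp: has_vector_derivative_def intro!: Ck_open_scaleR Ck_open_const\<close>)

section \<open>Existence of solutions of continuous ordinary differential equations\<close>

text \<open>
  Tonelli's approximation: the right-hand side is evaluated at a time delayed by \<open>h\<close>, so that a solution can be
  continued by explicit integration from each interval of length \<open>h\<close> to the next. For \<open>t \<le> 0\<close> the
  integral is 0, and the curve stays at \<open>z\<close>.
\<close>

definition delayed_step :: "('a::euclidean_space \<Rightarrow> 'a) \<Rightarrow> 'a \<Rightarrow> real \<Rightarrow> (real \<Rightarrow> 'a) \<Rightarrow> real \<Rightarrow> 'a" where
  "delayed_step f z h x t = z + integral {0..t} (\<lambda>s. f (x (s - h)))"

lemma delayed_step_lipschitz:
  fixes f :: "'a::euclidean_space \<Rightarrow> 'a"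
  assumes f: "continuous_on UNIV f" "\<And>y. norm (f y) \<le> M" and x: "continuous_on UNIV x"
  shows "norm (delayed_step f z h x t - delayed_step f z h x s) \<le> M * \<bar>t - s\<bar>"
proof -
  have cont: "continuous_on S (\<lambda>s. f (x (s - h)))" for S
    by (rule continuous_on_compose2[OF f(1)], rule continuous_on_compose2[OF x]) (auto intro: continuous_intros)
  have M: "0 \<le> M" using f(2) norm_ge_zero order_trans by blast
  have *: "norm (delayed_step f z h x t - delayed_step f z h x s) \<le> M * (t - s)" if "s \<le> t" for s t
  proof (cases "0 \<le> s")
    case True
    have "integral {0..s} (\<lambda>s. f (x (s - h))) + integral {s..t} (\<lambda>s. f (x (s - h))) = integral {0..t} (\<lambda>s. f (x (s - h)))"
      by (rule Henstock_Kurzweil_Integration.integral_combine) (use True that in \<open>auto intro: integrable_continuous_real cont\<close>)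
    then have "delayed_step f z h x t - delayed_step f z h x s = integral {s..t} (\<lambda>s. f (x (s - h)))"
      by (simp add: delayed_step_def algebra_simps)
    also have "norm \<dots> \<le> M * (t - s)"
      by (rule integral_bound) (use that cont f in auto)
    finally show ?thesis .
  next
    case False
    then have s: "delayed_step f z h x s = z" by (simp add: delayed_step_def)
    show ?thesis
    proof (cases "0 \<le> t")
      case True
      have "norm (integral {0..t} (\<lambda>s. f (x (s - h)))) \<le> M * (t - 0)"
        by (rule integral_bound) (use True cont f in auto)
      also have "\<dots> \<le> M * (t - s)" using False M by (simp add: mult_left_mono)
      finally show ?thesis unfolding s by (simp add: delayed_step_def)
    next
      case False
      then have "delayed_step f z h x t = z" by (simp add: delayed_step_def)
      then show ?thesis using s M that by simp
    qed
  qed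
  show ?thesis
    using *[of s t] *[of t s] by (cases "s \<le> t") (auto simp: norm_minus_commute)
qed

lemma lipschitz_imp_continuous_on:
  fixes x :: "real \<Rightarrow> 'a::real_normed_vector"
  assumes "\<And>s t. norm (x t - x s) \<le> M * \<bar>t - s\<bar>"
  shows "continuous_on S x"
proof -
  have M: "0 \<le> M" using order_trans[OF norm_ge_zero assms[of 0 1]] by simp
  have "M-lipschitz_on S x"
    using assms M by (auto simp: lipschitz_on_def dist_norm)
  then show ?thesis by (rule lipschitz_on_continuous_on)
qed

text \<open>
  Iterating the delayed integral operator is already stationary after \<open>n\<close> steps on \<open>(-\<infinity>, n h]\<close>, and all iterates
  inherit the Lipschitz constant \<open>M\<close>.
\<close>

lemma delayed_solution:
  fixes f :: "'a::euclidean_space \<Rightarrow> 'a"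
  assumes f: "continuous_on UNIV f" "\<And>y. norm (f y) \<le> M" and h: "h > 0"
  obtains x :: "real \<Rightarrow> 'a" where "\<And>s t. norm (x t - x s) \<le> M * \<bar>t - s\<bar>"
    and "\<And>t. t \<le> T \<Longrightarrow> x t = z + integral {0..t} (\<lambda>s. f (x (s - h)))"
proof -
  define X where "X n = (delayed_step f z h ^^ n) (\<lambda>_. z)" for n
  have XS: "X (Suc n) = delayed_step f z h (X n)" for n by (simp add: X_def)
  have M: "0 \<le> M" using f(2) norm_ge_zero order_trans by blast
  have lip: "norm (X n t - X n s) \<le> M * \<bar>t - s\<bar>" for n s t
  proof (induction n arbitrary: s t)
    case 0
    then show ?case using M by (simp add: X_def)
  next
    case (Suc n)
    show ?case unfolding XS
      by (rule delayed_step_lipschitz[OF f lipschitz_imp_continuous_on]) (rule Suc)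
  qed
  have eq: "X (Suc n) t = X n t" if "t \<le> real n * h" for n t
    using that
  proof (induction n arbitrary: t)
    case 0
    then have "integral {0..t} (\<lambda>s. f (X 0 (s - h))) = 0"
      by (cases "t = 0") auto
    then show ?case by (simp add: XS delayed_step_def) (simp add: X_def)
  next
    case (Suc n)
    have "integral {0..t} (\<lambda>s. f (X (Suc n) (s - h))) = integral {0..t} (\<lambda>s. f (X n (s - h)))"
      by (rule integral_cong) (use Suc in \<open>auto simp: algebra_simps\<close>)
    then show ?case by (simp add: XS[of "Suc n"] XS[of n] delayed_step_def)
  qed
  obtain n where n: "T \<le> real n * h"
    using h reals_Archimedean3 by (metis less_imp_le)
  show thesis
  proof (rule that[of "X n"])
    show "X n t = z + integral {0..t} (\<lambda>s. f (X n (s - h)))" if "t \<le> T" for t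
      using eq[of t n] n that by (simp add: XS delayed_step_def)
  qed (rule lip)
qed

text \<open>
  The delayed solutions for \<open>h = 1, 1/2, 1/3, \<dots>\<close> are equi-Lipschitz, so a subsequence converges uniformly by
  Arzela-Ascoli, and the delay disappears in the limit.
\<close>

lemma peano_integral_equation:
  fixes f :: "'a::euclidean_space \<Rightarrow> 'a"
  assumes f: "continuous_on UNIV f" "\<And>y. norm (f y) \<le> M" and T: "0 \<le> T"
  obtains x :: "real \<Rightarrow> 'a" where "continuous_on {0..T} x"
    and "\<And>t. t \<in> {0..T} \<Longrightarrow> x t = z + integral {0..t} (\<lambda>s. f (x s))"
proof -
  have M: "0 \<le> M" using f(2) norm_ge_zero order_trans by blast
  have "\<exists>x::real \<Rightarrow> 'a. (\<forall>s t. norm (x t - x s) \<le> M * \<bar>t - s\<bar>) \<and>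
      (\<forall>t\<le>T. x t = z + integral {0..t} (\<lambda>s. f (x (s - inverse (real (Suc n))))))" for n
  proof -
    obtain x :: "real \<Rightarrow> 'a" where "\<And>s t. norm (x t - x s) \<le> M * \<bar>t - s\<bar>"
        "\<And>t. t \<le> T \<Longrightarrow> x t = z + integral {0..t} (\<lambda>s. f (x (s - inverse (real (Suc n)))))"
      by (rule delayed_solution[OF f, of "inverse (real (Suc n))" T z]) (auto simp del: of_nat_Suc)
    then show ?thesis by blast
  qed
  then obtain X where lip: "\<And>n s t. norm (X n t - X n s) \<le> M * \<bar>t - s\<bar>"
    and X: "\<And>n t. t \<le> T \<Longrightarrow> X n t = z + integral {0..t} (\<lambda>s. f (X n (s - inverse (real (Suc n)))))"
    by metis
  have Xcont: "continuous_on S (X n)" for S n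
    by (rule lipschitz_imp_continuous_on) (rule lip)
  have X0: "X n 0 = z" for n using X[of 0 n] T by simp
  obtain x k where xc: "continuous_on {0..T} x" and k: "strict_mono (k :: nat \<Rightarrow> nat)"
    and lim: "\<And>e. 0 < e \<Longrightarrow> \<exists>N. \<forall>n t. n \<ge> N \<and> t \<in> {0..T} \<longrightarrow> norm (X (k n) t - x t) < e"
  proof (rule Arzela_Ascoli[of "{0..T}" X "norm z + M * T"])
    show "norm (X n t) \<le> norm z + M * T" if "t \<in> {0..T}" for n t
    proof -
      have "norm (X n t) \<le> norm z + norm (X n t - X n 0)"
        by (metis X0 add.commute diff_add_cancel norm_triangle_ineq)
      also have "\<dots> \<le> norm z + M * T"
        using lip[of n t 0] that M mult_left_mono[of t T M] by auto
      finally show ?thesis .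
    qed
    show "\<exists>d>0. \<forall>n y. y \<in> {0..T} \<and> norm (s - y) < d \<longrightarrow> norm (X n s - X n y) < e" if "0 < e" for s e
    proof (intro exI conjI allI impI)
      show "0 < e / (M + 1)" using that M by simp
      fix n y assume y: "y \<in> {0..T} \<and> norm (s - y) < e / (M + 1)"
      have "norm (X n s - X n y) \<le> M * \<bar>s - y\<bar>" by (rule lip)
      also have "\<dots> \<le> (M + 1) * \<bar>s - y\<bar>" by (simp add: mult_right_mono)
      also have "\<dots> < e" using y M by (simp add: field_simps)
      finally show "norm (X n s - X n y) < e" .
    qed
  qed auto
  define D where "D n s = X (k n) (s - inverse (real (Suc (k n))))" for n s
  have Dcont: "continuous_on S (D n)" for S n
    unfolding D_def by (rule continuous_on_compose2[OF Xcont[of UNIV]]) (auto intro: continuous_intros)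
  have Dlim: "uniform_limit {0..T} D x sequentially"
  proof (rule uniform_limitI)
    fix e :: real assume e: "e > 0"
    obtain N where N: "\<forall>n t. n \<ge> N \<and> t \<in> {0..T} \<longrightarrow> norm (X (k n) t - x t) < e / 2"
      using lim[of "e / 2"] e by auto
    have "(\<lambda>n. M * inverse (real (Suc (k n)))) \<longlonglongrightarrow> M * 0"
      by (intro tendsto_intros LIMSEQ_subseq_LIMSEQ[OF LIMSEQ_inverse_real_of_nat k, unfolded o_def])
    then have "\<forall>\<^sub>F n in sequentially. M * inverse (real (Suc (k n))) < e / 2"
      using e by (intro order_tendstoD(2)[of _ 0]) auto
    then show "\<forall>\<^sub>F n in sequentially. \<forall>t\<in>{0..T}. dist (D n t) (x t) < e"
      using eventually_ge_at_top[of N]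
    proof eventually_elim
      case (elim n)
      show ?case
      proof
        fix t assume t: "t \<in> {0..T}"
        have "dist (D n t) (x t) \<le> dist (D n t) (X (k n) t) + dist (X (k n) t) (x t)"
          by (rule dist_triangle)
        moreover have "dist (D n t) (X (k n) t) \<le> M * inverse (real (Suc (k n)))"
          using lip[of "k n" "t - inverse (real (Suc (k n)))" t] by (simp add: D_def dist_norm)
        moreover have "dist (X (k n) t) (x t) < e / 2" using N t elim by (auto simp: dist_norm)
        ultimately show "dist (D n t) (x t) < e" using elim by simp
      qed
    qed
  qed
  show thesis
  proof (rule that[OF xc])
    fix t assume t: "t \<in> {0..T}"
    have sub: "{0..t} \<subseteq> {0..T}" using t by auto
    have Xk: "(\<lambda>n. X (k n) t) \<longlonglongrightarrow> x t"
      unfolding lim_sequentially dist_norm using lim t by (meson order_refl)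
    have "compact (cball z (M * T + M) )" by simp
    have rng: "D n s \<in> cball z (M * T + M)" if "s \<in> {0..t}" for n s
    proof -
      have "norm (D n s - z) \<le> M * \<bar>(s - inverse (real (Suc (k n)))) - 0\<bar>"
        using lip[of "k n" _ 0] by (simp add: D_def X0)
      also have "\<dots> \<le> M * (T + 1)"
      proof (rule mult_left_mono)
        have i: "0 < inverse (real (Suc (k n)))" "inverse (real (Suc (k n))) \<le> 1"
          by (auto simp: inverse_le_1_iff)
        show "\<bar>(s - inverse (real (Suc (k n)))) - 0\<bar> \<le> T + 1"
          using that t i by (simp only: atLeastAtMost_iff abs_le_iff) linarith
      qed (rule M)
      finally show ?thesis by (simp add: dist_norm norm_minus_commute algebra_simps)
    qed
    have uc: "uniformly_continuous_on (cball z (M * T + M)) f"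
      by (intro compact_uniformly_continuous continuous_on_subset[OF f(1)]) auto
    have ul: "uniform_limit (cbox 0 t) (\<lambda>n s. f (D n s)) (\<lambda>s. f (x s)) sequentially"
    proof (rule uniform_limit_compose_uniformly_continuous_on[OF _ uc])
      show "uniform_limit (cbox 0 t) D x sequentially"
        using uniform_limit_on_subset[OF Dlim sub] by simp
      show "\<forall>\<^sub>F n in sequentially. \<forall>s\<in>cbox 0 t. D n s \<in> cball z (M * T + M)"
        using rng by auto
    qed auto
    obtain I J where IJ: "\<And>n. ((\<lambda>s. f (D n s)) has_integral I n) (cbox 0 t)"
        "((\<lambda>s. f (x s)) has_integral J) (cbox 0 t)" "I \<longlonglongrightarrow> J"
      by (rule uniform_limit_integral_cbox[OF ul])
        (auto intro!: continuous_on_compose2[OF f(1) Dcont])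
    have "X (k n) t = z + I n" for n
      using X[of t "k n"] t IJ(1)[of n] by (simp add: D_def integral_unique)
    then have "(\<lambda>n. X (k n) t) \<longlonglongrightarrow> z + J"
      using tendsto_add[OF tendsto_const IJ(3)] by simp
    then have "x t = z + J" using Xk LIMSEQ_unique by blast
    then show "x t = z + integral {0..t} (\<lambda>s. f (x s))"
      using IJ(2) by (simp add: integral_unique)
  qed
qed

text \<open>
  Composing \<open>f\<close> with the nearest-point projection onto the ball extends it continuously to the whole space with the
  same bound; the solution does not leave the ball before time \<open>r / M\<close>, where the extension agrees with \<open>f\<close>.
\<close>

theorem peano_existence:
  fixes f :: "'a::euclidean_space \<Rightarrow> 'a"
  assumes f: "continuous_on (cball z r) f" "\<And>y. y \<in> cball z r \<Longrightarrow> norm (f y) \<le> M"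
    and T: "0 \<le> T" "T * M \<le> r" and r: "0 \<le> r"
  obtains x :: "real \<Rightarrow> 'a" where "x 0 = z" "x ` {0..T} \<subseteq> cball z r"
    and "\<And>t. t \<in> {0..T} \<Longrightarrow> (x has_vector_derivative f (x t)) (at t within {0..T})"
    and "\<And>t. t \<in> {0..T} \<Longrightarrow> norm (x t - z) \<le> M * t"
proof -
  have ne: "cball z r \<noteq> {}" using r by auto
  define F where "F = f \<circ> closest_point (cball z r)"
  have cp: "closest_point (cball z r) y \<in> cball z r" for y
    using closest_point_in_set[of "cball z r" y] ne by blast
  have Fc: "continuous_on UNIV F"
    unfolding F_def by (rule continuous_on_compose, rule continuous_on_closest_point)
      (use ne cp in \<open>auto intro: continuous_on_subset[OF f(1)]\<close>)
  have Fb: "norm (F y) \<le> M" for y using f(2) cp by (auto simp: F_def)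
  obtain x where xc: "continuous_on {0..T} x"
    and x: "\<And>t. t \<in> {0..T} \<Longrightarrow> x t = z + integral {0..t} (\<lambda>s. F (x s))"
    by (rule peano_integral_equation[OF Fc Fb T(1)]) auto
  have Fx: "continuous_on {0..T} (\<lambda>s. F (x s))"
    by (rule continuous_on_compose2[OF Fc xc]) auto
  have near: "norm (x t - z) \<le> M * t" if "t \<in> {0..T}" for t
  proof -
    have "norm (integral {0..t} (\<lambda>s. F (x s))) \<le> M * (t - 0)"
      by (rule integral_bound) (use that Fb in \<open>auto intro: continuous_on_subset[OF Fx]\<close>)
    then show ?thesis using x[OF that] by simp
  qed
  have M: "0 \<le> M" using Fb norm_ge_zero order_trans by blast
  have in_ball: "x t \<in> cball z r" if "t \<in> {0..T}" for t
  proof -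
    have "norm (x t - z) \<le> M * T" using near[OF that] that M
      by (meson atLeastAtMost_iff mult_left_mono order_trans)
    then show ?thesis using T by (simp add: dist_norm norm_minus_commute mult.commute)
  qed
  show ?thesis
  proof (rule that)
    show "x 0 = z" using x[of 0] T by simp
    show "x ` {0..T} \<subseteq> cball z r" using in_ball by auto
    fix t assume t: "t \<in> {0..T}"
    have "((\<lambda>t. z + integral {0..t} (\<lambda>s. F (x s))) has_vector_derivative 0 + F (x t)) (at t within {0..T})"
      by (rule has_vector_derivative_add[OF has_vector_derivative_const integral_has_vector_derivative[OF Fx t]])
    from has_vector_derivative_transform[OF t x this]
    have "(x has_vector_derivative F (x t)) (at t within {0..T})" by simp
    then show "(x has_vector_derivative f (x t)) (at t within {0..T})"
      using in_ball[OF t] by (simp add: F_def closest_point_self)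
    show "norm (x t - z) \<le> M * t" by (rule near[OF t])
  qed
qed

section \<open>Linear algebra of two scalar products\<close>

definition scalar_product :: "('a::euclidean_space \<Rightarrow> 'a \<Rightarrow> real) \<Rightarrow> bool" where
  "scalar_product G \<longleftrightarrow> bilinear G \<and> (\<forall>u v. G u v = G v u) \<and> (\<forall>u. u \<noteq> 0 \<longrightarrow> G u u > 0)"

lemma scalar_productD:
  assumes "scalar_product G"
  shows "bilinear G" "G u v = G v u" "u \<noteq> 0 \<Longrightarrow> G u u > 0" "G u u \<ge> 0" "G u u = 0 \<longleftrightarrow> u = 0"
proof -
  show b: "bilinear G" and "G u v = G v u" and p: "u \<noteq> 0 \<Longrightarrow> G u u > 0"
    using assms by (auto simp: scalar_product_def)
  show "G u u \<ge> 0" "G u u = 0 \<longleftrightarrow> u = 0"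
    using p bilinear_lzero[OF b] by (cases "u = 0"; force)+
qed

lemmas bilinear_simps = bilinear_ladd bilinear_radd bilinear_lmul bilinear_rmul bilinear_lneg bilinear_rneg
  bilinear_lzero bilinear_rzero bilinear_lsub bilinear_rsub

lemma bilinear_linear_left: "bilinear G \<Longrightarrow> linear (\<lambda>u. G u v)"
  and bilinear_linear_right: "bilinear G \<Longrightarrow> linear (G u)"
  by (auto simp: bilinear_def)

lemma bilinear_basis_expansion:
  fixes G :: "'a::euclidean_space \<Rightarrow> 'b::euclidean_space \<Rightarrow> real"
  assumes "bilinear G"
  shows "G u v = (\<Sum>i\<in>Basis. \<Sum>j\<in>Basis. (u \<bullet> i) * (v \<bullet> j) * G i j)"
proof -
  have "G u v = (\<Sum>i\<in>Basis. (u \<bullet> i) * G i v)"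
    by (subst (1) euclidean_representation[of u, symmetric])
      (simp add: linear_sum[OF bilinear_linear_left[OF assms]] bilinear_lmul[OF assms])
  also have "\<dots> = (\<Sum>i\<in>Basis. (u \<bullet> i) * (\<Sum>j\<in>Basis. (v \<bullet> j) * G i j))"
    by (subst (1) euclidean_representation[of v, symmetric])
      (simp add: linear_sum[OF bilinear_linear_right[OF assms]] bilinear_rmul[OF assms])
  finally show ?thesis by (simp add: sum_distrib_left mult.assoc)
qed

text \<open>
  Finite-dimensional Riesz representation: \<open>z \<mapsto> G z _\<close> is injective because \<open>G z z = 0\<close> only for \<open>z = 0\<close>,
  hence surjective.
\<close>

lemma scalar_product_representer:
  assumes G: "scalar_product G" and b: "linear b"
  shows "\<exists>!z. \<forall>v. G z v = b v"
proof -
  note bl = scalar_productD(1)[OF G]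
  define L where "L z = (\<Sum>j\<in>Basis. G z j *\<^sub>R j)" for z
  have L: "linear L" unfolding L_def
    by (rule linearI) (auto simp: bilinear_simps[OF bl] scaleR_add_left sum.distrib scaleR_sum_right)
  have Lj: "L z \<bullet> j = G z j" if "j \<in> Basis" for z j
    using that by (simp add: L_def inner_sum_left inner_Basis if_distrib sum.delta cong: if_cong)
  have ext: "(\<forall>v. G z v = b v) \<longleftrightarrow> (\<forall>j\<in>Basis. G z j = b j)" for z
  proof
    assume "\<forall>j\<in>Basis. G z j = b j"
    then show "\<forall>v. G z v = b v"
      using linear_eq_stdbasis[OF bilinear_linear_right[OF bl] b] by metis
  qed auto
  have "inj L"
    unfolding linear_injective_0[OF L]
  proof (intro allI impI)
    fix z assume "L z = 0"
    then have "G z j = 0" if "j \<in> Basis" for j using Lj[OF that, of z] by simp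
    then have "G z = (\<lambda>_. 0)"
      by (intro linear_eq_stdbasis bilinear_linear_right[OF bl] linear_zero) auto
    then have "G z z = 0" by simp
    then show "z = 0" using scalar_productD(5)[OF G] by auto
  qed
  then have "surj L" "inj L" using linear_injective_imp_surjective[OF L] by auto
  have iff: "(\<forall>j\<in>Basis. G z j = b j) \<longleftrightarrow> L z = (\<Sum>j\<in>Basis. b j *\<^sub>R j)" for z
  proof
    assume "\<forall>j\<in>Basis. G z j = b j" then show "L z = (\<Sum>j\<in>Basis. b j *\<^sub>R j)" by (simp add: L_def)
  next
    assume *: "L z = (\<Sum>j\<in>Basis. b j *\<^sub>R j)"
    show "\<forall>j\<in>Basis. G z j = b j"
    proof
      fix j :: 'a assume j: "j \<in> Basis"
      have "L z \<bullet> j = b j" unfolding *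
        using j by (simp add: inner_sum_left inner_Basis if_distrib sum.delta cong: if_cong)
      then show "G z j = b j" using Lj[OF j] by simp
    qed
  qed
  obtain z where z: "L z = (\<Sum>j\<in>Basis. b j *\<^sub>R j)" using \<open>surj L\<close> by (metis surjD)
  show ?thesis
  proof (rule ex1I[of _ z])
    show "\<forall>v. G z v = b v" unfolding ext iff by (rule z)
    fix y assume "\<forall>v. G y v = b v"
    then have "L y = L z" unfolding ext iff z .
    then show "y = z" by (rule injD[OF \<open>inj L\<close>])
  qed
qed

definition raise :: "('a::euclidean_space \<Rightarrow> 'a \<Rightarrow> real) \<Rightarrow> ('a \<Rightarrow> real) \<Rightarrow> 'a" where
  "raise G b = (THE z. \<forall>v. G z v = b v)"

lemma raise: "scalar_product G \<Longrightarrow> linear b \<Longrightarrow> G (raise G b) v = b v"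
  using theI'[OF scalar_product_representer, of G b] by (auto simp: raise_def)

lemma scalar_product_cancel:
  assumes G: "scalar_product G" and eq: "\<And>v. G x v = G y v"
  shows "x = y"
proof -
  have "G (x - y) (x - y) = 0"
    using eq[of "x - y"] by (simp add: bilinear_lsub[OF scalar_productD(1)[OF G]])
  then show ?thesis using scalar_productD(5)[OF G] by simp
qed

lemma independent_pair_coefficients:
  fixes x y :: "'a::real_vector"
  assumes "\<And>c. y \<noteq> c *\<^sub>R x" "x \<noteq> 0" "p *\<^sub>R x + q *\<^sub>R y = 0"
  shows "p = 0" "q = 0"
proof -
  show "q = 0"
  proof (rule ccontr)
    assume "q \<noteq> 0"
    have "q *\<^sub>R y = (- p) *\<^sub>R x" using assms(3) by (simp add: eq_neg_iff_add_eq_0 add.commute)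
    then have "inverse q *\<^sub>R q *\<^sub>R y = (inverse q * (- p)) *\<^sub>R x" by simp
    then have "y = (inverse q * (- p)) *\<^sub>R x" using \<open>q \<noteq> 0\<close> by simp
    then show False using assms(1) by blast
  qed
  then show "p = 0" using assms by simp
qed

text \<open>
  This is the classical form of the difference of two projectively equivalent connections. The eigenvalue \<open>l\<close> is additive on
  independent pairs by comparing \<open>T (x + y) (x + y)\<close> with \<open>T (x - y) (x - y)\<close>, and polarization gives \<open>T\<close>.
\<close>

lemma quadratic_in_span:
  fixes T :: "'a::euclidean_space \<Rightarrow> 'a \<Rightarrow> 'a"
  assumes T: "bilinear T" "\<And>x y. T x y = T y x" and span: "\<And>x. \<exists>l. T x x = l *\<^sub>R x"
  obtains l where "linear l" "\<And>x y. T x y = (1/2) *\<^sub>R (l x *\<^sub>R y + l y *\<^sub>R x)"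
proof -
  note bs = bilinear_simps[OF T(1)]
  define l where "l x = (T x x \<bullet> x) / (x \<bullet> x)" for x
  have l: "T x x = l x *\<^sub>R x" for x
  proof -
    obtain k where k: "T x x = k *\<^sub>R x" using span by blast
    show ?thesis by (cases "x = 0") (simp_all add: l_def k bs)
  qed
  have lc: "l (c *\<^sub>R x) = c * l x" for c x
    by (cases "c = 0") (simp_all add: l_def bs field_simps)
  have Txy: "T x y = (1/2) *\<^sub>R (l x *\<^sub>R y + l y *\<^sub>R x)" for x y
  proof -
    consider "x = 0" | c where "y = c *\<^sub>R x" | "x \<noteq> 0" "\<And>c. y \<noteq> c *\<^sub>R x" by blast
    then show ?thesis
    proof cases
      case 1
      then show ?thesis using lc[of 0 x] by (simp add: bs)
    next
      case (2 c)
      then show ?thesis using l[of x] lc by (simp add: bs scaleR_add_left[symmetric] del: scaleR_add_left)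
    next
      case 3
      have plus: "T (x + y) (x + y) = T x x + 2 *\<^sub>R T x y + T y y"
        and minus: "T (x - y) (x - y) = T x x - 2 *\<^sub>R T x y + T y y"
        using T(2)[of y x] by (simp_all add: bs scaleR_2)
      have "l (x + y) *\<^sub>R (x + y) + l (x - y) *\<^sub>R (x - y) = 2 *\<^sub>R (l x *\<^sub>R x) + 2 *\<^sub>R (l y *\<^sub>R y)"
        unfolding l[symmetric] plus minus by (simp add: scaleR_2)
      then have "(l (x + y) + l (x - y) - 2 * l x) *\<^sub>R x + (l (x + y) - l (x - y) - 2 * l y) *\<^sub>R y = 0"
        by (simp add: algebra_simps)
      from independent_pair_coefficients[OF 3(2,1) this]
      have a: "l (x + y) = l x + l y" by simp
      have "2 *\<^sub>R T x y = l (x + y) *\<^sub>R (x + y) - l x *\<^sub>R x - l y *\<^sub>R y"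
        unfolding l[symmetric] plus by simp
      also have "\<dots> = l x *\<^sub>R y + l y *\<^sub>R x" unfolding a by (simp add: algebra_simps)
      finally have "(1/2) *\<^sub>R (2 *\<^sub>R T x y) = (1/2) *\<^sub>R (l x *\<^sub>R y + l y *\<^sub>R x)" by simp
      then show ?thesis by simp
    qed
  qed
  have "linear l"
  proof (rule linearI)
    fix x y :: 'a
    obtain z :: 'a where z: "z \<noteq> 0" using nonempty_Basis nonzero_Basis by blast
    have T2: "2 *\<^sub>R T x y = l x *\<^sub>R y + l y *\<^sub>R x" for x y by (simp add: Txy)
    have "2 *\<^sub>R T (x + y) z = 2 *\<^sub>R T x z + 2 *\<^sub>R T y z" by (simp add: bs scaleR_add_right)
    then have "(l (x + y) - l x - l y) *\<^sub>R z = 0"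
      unfolding T2 by (simp add: algebra_simps)
    then show "l (x + y) = l x + l y" using z by simp
  qed (simp add: lc)
  then show ?thesis using that Txy by blast
qed

text \<open>
  The trace recovers \<open>l\<close> from \<open>T\<close>. Traces of Christoffel symbols are logarithmic derivatives of Gram determinants, so
  this makes \<open>l\<close> exact.
\<close>

lemma quadratic_in_span_trace:
  fixes T :: "'a::euclidean_space \<Rightarrow> 'a \<Rightarrow> 'a"
  assumes l: "linear l" and T: "\<And>x y. T x y = (1/2) *\<^sub>R (l x *\<^sub>R y + l y *\<^sub>R x)"
  shows "(\<Sum>j\<in>Basis. T k j \<bullet> j) = (real DIM('a) + 1) / 2 * l k"
proof -
  have "(\<Sum>j\<in>Basis. T k j \<bullet> j) = (\<Sum>j\<in>(Basis::'a set). l k / 2 + (k \<bullet> j) * l j / 2)"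
    by (rule sum.cong) (auto simp: T inner_add_left field_simps)
  also have "\<dots> = real DIM('a) * l k / 2 + (\<Sum>j\<in>Basis. (k \<bullet> j) * l j) / 2"
    by (simp add: sum.distrib sum_divide_distrib)
  also have "(\<Sum>j\<in>Basis. (k \<bullet> j) * l j) = l (\<Sum>j\<in>Basis. (k \<bullet> j) *\<^sub>R j)"
    by (simp add: linear_sum[OF l] linear_scale[OF l])
  finally show ?thesis by (simp add: euclidean_representation field_simps)
qed

lemma quadratic_form_vanishing_on_ball:
  fixes Q :: "'a::euclidean_space \<Rightarrow> 'a \<Rightarrow> real"
  assumes Q: "bilinear Q" "\<And>x y. Q x y = Q y x" and e: "e > 0"
    and van: "\<And>x. x \<in> ball x0 e \<Longrightarrow> Q x x = 0"
  shows "Q x y = 0"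
proof -
  note bs = bilinear_simps[OF Q(1)]
  have d: "Q y y = 0" for y
  proof -
    \<comment> \<open>Second differences: both \<open>x0 + t y\<close> and \<open>x0 - t y\<close> lie in the ball for this \<open>t\<close>.\<close>
    define t where "t = e / (norm y + 1) / 2"
    have t: "t > 0" "t * norm y < e"
    proof -
      have n: "norm y + 1 > 0" by (simp add: add_nonneg_pos)
      show "t > 0" using e n by (simp add: t_def)
      have "t * norm y \<le> t * (norm y + 1)" using \<open>t > 0\<close> by (simp add: mult_left_mono)
      also have "e / m / 2 * m = e / 2" if "m > 0" for m :: real using that by simp
      from this[OF n] have "t * (norm y + 1) = e / 2" by (simp only: t_def)
      finally show "t * norm y < e" using e by simp
    qed
    then have "x0 + t *\<^sub>R y \<in> ball x0 e" "x0 - t *\<^sub>R y \<in> ball x0 e" "x0 \<in> ball x0 e"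
      using e by (auto simp: dist_norm)
    then have "Q (x0 + t *\<^sub>R y) (x0 + t *\<^sub>R y) = 0" "Q (x0 - t *\<^sub>R y) (x0 - t *\<^sub>R y) = 0" "Q x0 x0 = 0"
      using van by blast+
    moreover have "Q (x0 + t *\<^sub>R y) (x0 + t *\<^sub>R y) + Q (x0 - t *\<^sub>R y) (x0 - t *\<^sub>R y)
        = 2 * Q x0 x0 + 2 * (t * (t * Q y y))"
      by (simp add: bs algebra_simps)
    ultimately have "t * (t * Q y y) = 0" by linarith
    then show ?thesis using t by simp
  qed
  have "Q (x + y) (x + y) = Q x x + 2 * Q x y + Q y y" using Q(2)[of x y] by (simp add: bs)
  then show ?thesis using d by simp
qed

lemma irreducible_quadratic:
  fixes q :: "real poly"
  assumes "degree q = 2" "\<And>t. poly q t \<noteq> 0"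
  shows "irreducible q"
proof (rule irreducibleI)
  show "q \<noteq> 0" using assms by auto
  show "\<not> is_unit q" using assms by (simp add: is_unit_iff_degree \<open>q \<noteq> 0\<close>)
  fix a b assume ab: "q = a * b"
  have nz: "a \<noteq> 0" "b \<noteq> 0" using \<open>q \<noteq> 0\<close> ab by auto
  have no1: "degree r \<noteq> 1" if "r dvd q" for r
  proof
    assume "degree r = 1"
    then obtain u v where r: "r = [:u, v:]" "v \<noteq> 0"
      by (metis degree1_coeffs)
    then have "poly r (- u / v) = 0" by simp
    then show False using that assms(2) by (metis dvdE mult_zero_left poly_mult)
  qed
  have "degree a + degree b = 2" using assms ab nz by (simp add: degree_mult_eq)
  moreover have "degree a \<noteq> 1" "degree b \<noteq> 1" using no1 ab by auto
  ultimately have "degree a = 0 \<or> degree b = 0" by linarith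
  then show "is_unit a \<or> is_unit b" using nz by (simp add: is_unit_iff_degree)
qed

text \<open>
  The prime \<open>q\<close> divides the left-hand side to an odd power. If it did not divide \<open>q'\<close>, it would divide the
  right-hand side to an even power.
\<close>

lemma proportional_quadratics:
  fixes q q' P P' :: "real poly"
  assumes q: "degree q = 2" "\<And>t. poly q t \<noteq> 0" and q': "degree q' = 2" and P: "P \<noteq> 0"
    and eq: "q * P\<^sup>2 = q' * P'\<^sup>2"
  obtains k where "q' = smult k q"
proof -
  have pr: "prime_elem q"
    using irreducible_quadratic[OF q] by (simp add: prime_elem_iff_irreducible)
  have nz: "q \<noteq> 0" "q' \<noteq> 0" "P' \<noteq> 0" using q q' eq P by auto
  have "q dvd q'"
  proof (rule ccontr)
    assume "\<not> q dvd q'"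
    then have "multiplicity q q' = 0" by (rule not_dvd_imp_multiplicity_0)
    then have "multiplicity q (q' * P'\<^sup>2) = 2 * multiplicity q P'"
      using nz pr by (simp add: prime_elem_multiplicity_mult_distrib prime_elem_multiplicity_power_distrib)
    moreover have "multiplicity q (q * P\<^sup>2) = Suc (2 * multiplicity q P)"
      using nz pr P by (simp add: prime_elem_multiplicity_mult_distrib prime_elem_multiplicity_power_distrib
          prime_elem_not_unit)
    ultimately have "Suc (2 * multiplicity q P) = 2 * multiplicity q P'" using eq by simp
    then show False by presburger
  qed
  then obtain r where r: "q' = q * r" by blast
  then have "degree r = 0" using q q' nz by (simp add: degree_mult_eq)
  then obtain k where "r = [:k:]" by (metis degree_eq_zeroE)
  then show ?thesis using that[of k] r by simp
qed

text \<open>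
  The unknown multiple of \<open>x\<close> disappears from the minor \<open>P K x\<close> of \<open>K x\<close> and \<open>x\<close>, which is quadratic in \<open>x\<close>.
  Squaring removes the roots and leaves \<open>G x x (P J x)\<^sup>2 = G' x x (P J' x)\<^sup>2\<close>. On a line \<open>x0 + t y\<close> that misses
  the origin the two forms are real quadratics without zeros, so \<open>proportional_quadratics\<close> applies. Once
  \<open>G = c\<^sup>2 G'\<close>, the map \<open>c J - J'\<close> is skew and has every vector as an eigenvector, so it vanishes.
\<close>

lemma conformal_of_sqrt_multiples:
  fixes G G' :: "'a::euclidean_space \<Rightarrow> 'a \<Rightarrow> real"
  assumes G: "scalar_product G" and G': "scalar_product G'"
    and J: "linear J" "\<And>x. G (J x) x = 0" and J': "linear J'" "\<And>x. G' (J' x) x = 0"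
    and span: "\<And>x. \<exists>f. sqrt (G x x) *\<^sub>R J x - sqrt (G' x x) *\<^sub>R J' x = f *\<^sub>R x"
    and x0: "J x0 \<noteq> 0"
  obtains c where "c > 0" "\<And>x y. G x y = c\<^sup>2 * G' x y" "\<And>x. J' x = c *\<^sub>R J x"
proof -
  note bs = bilinear_simps[OF scalar_productD(1)[OF G]] and bs' = bilinear_simps[OF scalar_productD(1)[OF G']]
  note Gp = scalar_productD[OF G] and Gp' = scalar_productD[OF G']
  have x0nz: "x0 \<noteq> 0" using x0 linear_0[OF J(1)] by auto
  \<comment> \<open>The component of \<open>J x0\<close> orthogonal to \<open>x0\<close>, up to a factor. It makes the minor \<open>P\<close> nonzero at \<open>x0\<close>;
    it is itself nonzero because \<open>J\<close> is skew and \<open>J x0 \<noteq> 0\<close>.\<close>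
  define w where "w = (x0 \<bullet> x0) *\<^sub>R J x0 - (J x0 \<bullet> x0) *\<^sub>R x0"
  have "w \<noteq> 0"
  proof
    assume "w = 0"
    then have "(x0 \<bullet> x0) *\<^sub>R J x0 = (J x0 \<bullet> x0) *\<^sub>R x0" by (simp add: w_def)
    then have "G ((x0 \<bullet> x0) *\<^sub>R J x0) x0 = G ((J x0 \<bullet> x0) *\<^sub>R x0) x0" by simp
    then have "(x0 \<bullet> x0) * G (J x0) x0 = (J x0 \<bullet> x0) * G x0 x0" by (simp add: bs)
    then have "(J x0 \<bullet> x0) * G x0 x0 = 0" using J(2)[of x0] by (simp only: mult_zero_right)
    then have "J x0 \<bullet> x0 = 0" using Gp(3)[OF x0nz] by (simp only: mult_eq_0_iff) linarith
    then show False using \<open>w = 0\<close> x0 x0nz by (simp add: w_def)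
  qed
  have wx0: "x0 \<bullet> w = 0" by (simp add: w_def inner_diff_right inner_commute)
  have "w \<bullet> w = (x0 \<bullet> x0) * (J x0 \<bullet> w)"
    by (subst (1) w_def) (simp add: inner_diff_left wx0)
  then have Jw: "J x0 \<bullet> w \<noteq> 0" using \<open>w \<noteq> 0\<close> by auto
  define P where "P K x = (K x \<bullet> w) * (x \<bullet> x0) - (K x \<bullet> x0) * (x \<bullet> w)" for K x
  have sq: "G x x * (P J x)\<^sup>2 = G' x x * (P J' x)\<^sup>2" for x
  proof -
    obtain f where f: "sqrt (G x x) *\<^sub>R J x = sqrt (G' x x) *\<^sub>R J' x + f *\<^sub>R x"
      using span[of x] by (auto simp: diff_eq_eq add.commute)
    have "sqrt (G x x) * P J x = ((sqrt (G x x) *\<^sub>R J x) \<bullet> w) * (x \<bullet> x0) - ((sqrt (G x x) *\<^sub>R J x) \<bullet> x0) * (x \<bullet> w)"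
      by (simp add: P_def algebra_simps)
    also have "\<dots> = sqrt (G' x x) * P J' x"
      unfolding f by (simp add: P_def inner_add_left algebra_simps)
    finally have "(sqrt (G x x) * P J x)\<^sup>2 = (sqrt (G' x x) * P J' x)\<^sup>2" by simp
    then show ?thesis by (simp add: power_mult_distrib Gp(4) Gp'(4))
  qed
  have ratio: "G' y y * G x0 x0 = G' x0 x0 * G y y" for y
  proof (cases "\<exists>c. y = c *\<^sub>R x0")
    case True
    then show ?thesis by (auto simp: bs bs')
  next
    case False
    define q where "q H = [:H x0 x0, 2 * H x0 y, H y y:]" for H :: "'a \<Rightarrow> 'a \<Rightarrow> real"
    define p where "p K = [:K x0 \<bullet> w, K y \<bullet> w:] * [:x0 \<bullet> x0, y \<bullet> x0:] - [:K x0 \<bullet> x0, K y \<bullet> x0:] * [:x0 \<bullet> w, y \<bullet> w:]"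
      for K :: "'a \<Rightarrow> 'a"
    have nd: "y \<noteq> c *\<^sub>R x0" for c using False by blast
    have ynz: "y \<noteq> 0" and line: "x0 + t *\<^sub>R y \<noteq> 0" for t
    proof -
      show "y \<noteq> 0" using nd[of 0] by simp
      show "x0 + t *\<^sub>R y \<noteq> 0"
      proof
        assume "x0 + t *\<^sub>R y = 0"
        then have "1 *\<^sub>R x0 + t *\<^sub>R y = 0" by (simp only: scaleR_one)
        from independent_pair_coefficients(1)[OF nd x0nz this] show False by (rule one_neq_zero[THEN notE])
      qed
    qed
    have qG: "poly (q G) t = G (x0 + t *\<^sub>R y) (x0 + t *\<^sub>R y)" for t
      using Gp(2)[of x0 y] by (simp add: q_def bs algebra_simps)
    have qG': "poly (q G') t = G' (x0 + t *\<^sub>R y) (x0 + t *\<^sub>R y)" for t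
      using Gp'(2)[of x0 y] by (simp add: q_def bs' algebra_simps)
    have p: "poly (p K) t = P K (x0 + t *\<^sub>R y)" if "linear K" for K t
      by (simp add: p_def P_def linear_add[OF that] linear_scale[OF that] inner_add_left algebra_simps)
    have deg: "degree (q G) = 2" "degree (q G') = 2"
      using Gp(3)[OF ynz] Gp'(3)[OF ynz] by (simp_all add: q_def)
    obtain k where k: "q G' = smult k (q G)"
    proof (rule proportional_quadratics[OF deg(1) _ deg(2)])
      show "poly (q G) t \<noteq> 0" for t unfolding qG using Gp(5) line by simp
      have "poly (p J) 0 \<noteq> 0"
        unfolding p[OF J(1)] using Jw x0nz by (simp add: P_def wx0)
      then show "p J \<noteq> 0" by auto
      show "q G * (p J)\<^sup>2 = q G' * (p J')\<^sup>2"
        by (rule poly_eq_poly_eq_iff[THEN iffD1]) (auto simp: fun_eq_iff qG qG' p J(1) J'(1) sq)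
    qed
    then have "G' x0 x0 = k * G x0 x0" "G' y y = k * G y y" by (auto simp: q_def)
    then show ?thesis by simp
  qed
  define c where "c = sqrt (G x0 x0 / G' x0 x0)"
  have c: "c > 0" "c\<^sup>2 = G x0 x0 / G' x0 x0"
    using Gp(3)[OF x0nz] Gp'(3)[OF x0nz] by (auto simp: c_def)
  have diag: "G y y = c\<^sup>2 * G' y y" for y
    using ratio[of y] Gp'(3)[OF x0nz] unfolding c by (simp add: field_simps)
  have GG': "G x y = c\<^sup>2 * G' x y" for x y
  proof -
    have "G (x + y) (x + y) = G x x + 2 * G x y + G y y" using Gp(2)[of x y] by (simp add: bs)
    moreover have "G' (x + y) (x + y) = G' x x + 2 * G' x y + G' y y" using Gp'(2)[of x y] by (simp add: bs')
    ultimately show ?thesis using diag[of x] diag[of y] diag[of "x + y"] by (simp add: algebra_simps)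
  qed
  have "J' x = c *\<^sub>R J x" for x
  proof (cases "x = 0")
    case True
    then show ?thesis using linear_0[OF J(1)] linear_0[OF J'(1)] by simp
  next
    case False
    obtain f where f: "sqrt (G x x) *\<^sub>R J x - sqrt (G' x x) *\<^sub>R J' x = f *\<^sub>R x" using span by blast
    have s: "sqrt (G x x) = c * sqrt (G' x x)" using c(1) by (simp add: diag real_sqrt_mult)
    have sp: "sqrt (G' x x) > 0" using Gp'(3)[OF False] by simp
    have e: "sqrt (G' x x) *\<^sub>R (c *\<^sub>R J x - J' x) = f *\<^sub>R x"
      using f by (simp add: s scaleR_diff_right mult.commute)
    have "G' (J x) x = 0" using J(2)[of x] c(1) by (simp add: GG')
    then have "G' (sqrt (G' x x) *\<^sub>R (c *\<^sub>R J x - J' x)) x = 0"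
      by (simp add: bs' J'(2))
    then have "f = 0" unfolding e using Gp'(5)[of x] False by (simp add: bs')
    then show ?thesis using e sp by simp
  qed
  then show ?thesis using that c(1) GG' by blast
qed

section \<open>The Gram determinant\<close>

text \<open>
  The Leibniz formula over the standard basis of an arbitrary Euclidean space. For a bilinear \<open>G\<close> it is the determinant of the matrix
  with entries \<open>G b c\<close>, so the rows are indexed by the first argument.
\<close>

definition gram_det :: "('a::euclidean_space \<Rightarrow> 'a \<Rightarrow> real) \<Rightarrow> real" where
  "gram_det M = (\<Sum>\<sigma> | \<sigma> permutes Basis. of_int (sign \<sigma>) * (\<Prod>b\<in>Basis. M b (\<sigma> b)))"

lemma gram_det_inner: "gram_det (\<lambda>b c :: 'a::euclidean_space. b \<bullet> c) = 1"
proof -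
  have z: "of_int (sign \<sigma>) * (\<Prod>b\<in>Basis. b \<bullet> \<sigma> b) = (if \<sigma> = id then 1 else 0)"
    if \<sigma>: "\<sigma> permutes (Basis :: 'a set)" for \<sigma>
  proof (cases "\<sigma> = id")
    case False
    then obtain b where b: "\<sigma> b \<noteq> b" by (auto simp: fun_eq_iff)
    then have "b \<in> Basis" using \<sigma> by (meson permutes_not_in)
    moreover have "\<sigma> b \<in> Basis" using \<sigma> \<open>b \<in> Basis\<close> by (simp add: permutes_in_image)
    ultimately have "b \<bullet> \<sigma> b = 0" using b by (simp add: inner_Basis)
    then have "(\<Prod>b\<in>Basis. b \<bullet> \<sigma> b) = 0" using \<open>b \<in> Basis\<close> by (intro prod_zero) auto
    then show ?thesis using False by simp
  qed (simp add: inner_Basis)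
  have "gram_det (\<lambda>b c :: 'a. b \<bullet> c) = (\<Sum>\<sigma> | \<sigma> permutes (Basis :: 'a set). if \<sigma> = id then 1 else 0)"
    unfolding gram_det_def by (rule sum.cong) (use z in auto)
  also have "\<dots> = 1"
    by (simp add: sum.delta finite_permutations permutes_id)
  finally show ?thesis .
qed

lemma gram_det_scale: "gram_det (\<lambda>b c. k * M b c) = k ^ DIM('a) * gram_det (M :: 'a::euclidean_space \<Rightarrow> 'a \<Rightarrow> real)"
  by (simp add: gram_det_def prod.distrib sum_distrib_left mult_ac)

lemma gram_det_equal_rows:
  fixes M :: "'a::euclidean_space \<Rightarrow> 'a \<Rightarrow> real"
  assumes b: "b0 \<in> Basis" "b1 \<in> Basis" "b0 \<noteq> b1" and eq: "\<And>c. c \<in> Basis \<Longrightarrow> M b0 c = M b1 c"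
  shows "gram_det M = 0"
proof -
  define \<tau> where "\<tau> = Transposition.transpose b0 b1"
  have \<tau>: "\<tau> permutes Basis" unfolding \<tau>_def using b by (intro permutes_swap_id)
  have inv: "\<tau> (\<tau> x) = x" for x by (simp add: \<tau>_def)
  let ?S = "{\<sigma>. \<sigma> permutes (Basis :: 'a set)}"
  have tt: "\<sigma> \<circ> \<tau> \<circ> \<tau> = \<sigma>" for \<sigma> :: "'a \<Rightarrow> 'a" by (simp add: fun_eq_iff inv)
  have perm: "permutation \<sigma>" if "\<sigma> permutes (Basis :: 'a set)" for \<sigma>
    using that permutation_permutes finite_Basis by blast
  have "gram_det M = (\<Sum>\<sigma>\<in>?S. of_int (sign (\<sigma> \<circ> \<tau>)) * (\<Prod>b\<in>Basis. M b ((\<sigma> \<circ> \<tau>) b)))"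
    unfolding gram_det_def
    by (rule sum.reindex_bij_witness[of _ "\<lambda>\<sigma>. \<sigma> \<circ> \<tau>" "\<lambda>\<sigma>. \<sigma> \<circ> \<tau>"])
      (auto simp only: tt mem_Collect_eq intro: permutes_compose \<tau>)
  also have "\<dots> = (\<Sum>\<sigma>\<in>?S. - (of_int (sign \<sigma>) * (\<Prod>b\<in>Basis. M b (\<sigma> b))))"
  proof (rule sum.cong)
    fix \<sigma> assume "\<sigma> \<in> ?S"
    then have \<sigma>: "\<sigma> permutes (Basis :: 'a set)" by simp
    have "sign (\<sigma> \<circ> \<tau>) = - sign \<sigma>"
      using sign_compose[OF perm[OF \<sigma>] perm[OF \<tau>]] b by (simp add: \<tau>_def sign_swap_id)
    moreover have "(\<Prod>b\<in>Basis. M b ((\<sigma> \<circ> \<tau>) b)) = (\<Prod>b\<in>Basis. M (\<tau> b) (\<sigma> b))"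
      by (rule prod.reindex_bij_witness[of _ \<tau> \<tau>]) (auto simp: inv permutes_in_image[OF \<tau>])
    moreover have "(\<Prod>b\<in>Basis. M (\<tau> b) (\<sigma> b)) = (\<Prod>b\<in>Basis. M b (\<sigma> b))"
    proof (rule prod.cong)
      fix x :: 'a assume x: "x \<in> Basis"
      then have "\<sigma> x \<in> Basis" using \<sigma> by (simp add: permutes_in_image)
      then show "M (\<tau> x) (\<sigma> x) = M x (\<sigma> x)"
        using eq by (auto simp: \<tau>_def Transposition.transpose_def)
    qed auto
    ultimately show "of_int (sign (\<sigma> \<circ> \<tau>)) * (\<Prod>b\<in>Basis. M b ((\<sigma> \<circ> \<tau>) b)) = - (of_int (sign \<sigma>) * (\<Prod>b\<in>Basis. M b (\<sigma> b)))"
      by simp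
  qed auto
  also have "\<dots> = - gram_det M" by (simp add: gram_det_def sum_negf)
  finally show ?thesis by simp
qed

lemma gram_det_row:
  fixes M :: "'a::euclidean_space \<Rightarrow> 'a \<Rightarrow> real"
  assumes "b0 \<in> Basis"
  shows "gram_det (M(b0 := N)) = (\<Sum>\<sigma> | \<sigma> permutes Basis. of_int (sign \<sigma>) * (N (\<sigma> b0) * (\<Prod>b\<in>Basis - {b0}. M b (\<sigma> b))))"
  unfolding gram_det_def
proof (intro sum.cong refl arg_cong2[where f = "(*)"])
  fix \<sigma> :: "'a \<Rightarrow> 'a"
  have "(\<Prod>b\<in>Basis. (M(b0 := N)) b (\<sigma> b)) = (M(b0 := N)) b0 (\<sigma> b0) * (\<Prod>b\<in>Basis - {b0}. (M(b0 := N)) b (\<sigma> b))"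
    using assms by (intro prod.remove) auto
  also have "(\<Prod>b\<in>Basis - {b0}. (M(b0 := N)) b (\<sigma> b)) = (\<Prod>b\<in>Basis - {b0}. M b (\<sigma> b))"
    by (rule prod.cong) auto
  finally show "(\<Prod>b\<in>Basis. (M(b0 := N)) b (\<sigma> b)) = N (\<sigma> b0) * (\<Prod>b\<in>Basis - {b0}. M b (\<sigma> b))" by simp
qed

text \<open>
  Expanding the row \<open>G a\<close> over the rows \<open>G d\<close> leaves only the term \<open>d = b0\<close>, since in all others a row is repeated.
\<close>

lemma gram_det_row_combination:
  fixes G :: "'a::euclidean_space \<Rightarrow> 'a \<Rightarrow> real"
  assumes G: "bilinear G" and b: "b0 \<in> Basis"
  shows "gram_det (G(b0 := G a)) = (a \<bullet> b0) * gram_det G"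
proof -
  have Ga: "G a c = (\<Sum>d\<in>Basis. (a \<bullet> d) * G d c)" for c
    by (subst (1) euclidean_representation[of a, symmetric])
      (simp add: linear_sum[OF bilinear_linear_left[OF G]] bilinear_lmul[OF G])
  have "gram_det (G(b0 := G a)) = (\<Sum>\<sigma> | \<sigma> permutes Basis. \<Sum>d\<in>Basis.
      (a \<bullet> d) * (of_int (sign \<sigma>) * (G d (\<sigma> b0) * (\<Prod>b\<in>Basis - {b0}. G b (\<sigma> b)))))"
    unfolding gram_det_row[OF b]
    by (rule sum.cong) (simp_all add: Ga sum_distrib_left sum_distrib_right mult_ac)
  also have "\<dots> = (\<Sum>d\<in>Basis. (a \<bullet> d) * gram_det (G(b0 := G d)))"
    by (subst sum.swap) (simp add: gram_det_row[OF b] sum_distrib_left)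
  also have "\<dots> = (\<Sum>d\<in>Basis. if d = b0 then (a \<bullet> b0) * gram_det G else 0)"
  proof (rule sum.cong)
    fix d :: 'a assume d: "d \<in> Basis"
    show "(a \<bullet> d) * gram_det (G(b0 := G d)) = (if d = b0 then (a \<bullet> b0) * gram_det G else 0)"
    proof (cases "d = b0")
      case False
      then have "gram_det (G(b0 := G d)) = 0"
        using b d by (intro gram_det_equal_rows[of b0 d]) auto
      then show ?thesis using False by simp
    qed simp
  qed auto
  also have "\<dots> = (a \<bullet> b0) * gram_det G" using b by simp
  finally show ?thesis .
qed

text \<open>
  Jacobi's formula. The derivative of the matrix is given by the operator \<open>A h\<close> that represents it with respect to \<open>G\<close>, so the
  trace that appears is the trace of \<open>A h\<close>.
\<close>

lemma has_derivative_gram_det: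
  fixes M :: "'b::real_normed_vector \<Rightarrow> 'a::euclidean_space \<Rightarrow> 'a \<Rightarrow> real"
  assumes M: "\<And>b c. b \<in> Basis \<Longrightarrow> c \<in> Basis \<Longrightarrow> ((\<lambda>y. M y b c) has_derivative (\<lambda>h. G (A h b) c)) (at y within S)"
    and G: "bilinear G" "\<And>b c. M y b c = G b c"
  shows "((\<lambda>y. gram_det (M y)) has_derivative (\<lambda>h. (\<Sum>b\<in>Basis. A h b \<bullet> b) * gram_det G)) (at y within S)"
proof -
  have My: "M y = G" using G(2) by blast
  have "((\<lambda>y. gram_det (M y)) has_derivative
      (\<lambda>h. \<Sum>\<sigma> | \<sigma> permutes Basis. of_int (sign \<sigma>) *
        (\<Sum>b\<in>Basis. G (A h b) (\<sigma> b) * (\<Prod>j\<in>Basis - {b}. M y j (\<sigma> j))))) (at y within S)"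
    unfolding gram_det_def
  proof (intro has_derivative_sum has_derivative_mult_right has_derivative_prod)
    fix \<sigma> b assume "\<sigma> \<in> {\<sigma>. \<sigma> permutes (Basis :: 'a set)}" "b \<in> (Basis :: 'a set)"
    then show "((\<lambda>y. M y b (\<sigma> b)) has_derivative (\<lambda>h. G (A h b) (\<sigma> b))) (at y within S)"
      by (intro M) (auto simp: permutes_in_image)
  qed
  moreover have "(\<Sum>\<sigma> | \<sigma> permutes Basis. of_int (sign \<sigma>) *
        (\<Sum>b\<in>Basis. G (A h b) (\<sigma> b) * (\<Prod>j\<in>Basis - {b}. M y j (\<sigma> j))))
      = (\<Sum>b\<in>Basis. A h b \<bullet> b) * gram_det G" for h
  proof -
    have "(\<Sum>\<sigma> | \<sigma> permutes Basis. of_int (sign \<sigma>) *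
        (\<Sum>b\<in>Basis. G (A h b) (\<sigma> b) * (\<Prod>j\<in>Basis - {b}. M y j (\<sigma> j))))
      = (\<Sum>b\<in>Basis. gram_det (G(b := G (A h b))))"
      unfolding sum_distrib_left My by (subst sum.swap) (rule sum.cong, simp_all add: gram_det_row)
    also have "\<dots> = (\<Sum>b\<in>Basis. (A h b \<bullet> b) * gram_det G)"
      by (rule sum.cong) (simp_all add: gram_det_row_combination[OF G(1)])
    finally show ?thesis by (simp add: sum_distrib_right)
  qed
  ultimately show ?thesis by simp
qed

lemma scalar_product_coercive:
  assumes G: "scalar_product (G :: 'a::euclidean_space \<Rightarrow> 'a \<Rightarrow> real)"
  obtains m where "m > 0" "\<And>z. m * (norm z)\<^sup>2 \<le> G z z"
proof -
  interpret bounded_bilinear G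
    using scalar_productD(1)[OF G] by (simp add: bilinear_conv_bounded_bilinear)
  have ne: "sphere (0::'a) 1 \<noteq> {}" using vector_choose_size[of 1] by (force simp: dist_norm)
  obtain u :: 'a where u: "u \<in> sphere 0 1" "\<And>z. z \<in> sphere 0 1 \<Longrightarrow> G u u \<le> G z z"
    using continuous_attains_inf[OF compact_sphere ne continuous_on[OF continuous_on_id continuous_on_id]]
    by blast
  have "G u u > 0" using u(1) scalar_productD(3)[OF G, of u] by (cases "u = 0") auto
  moreover have "G u u * (norm z)\<^sup>2 \<le> G z z" for z
  proof (cases "z = 0")
    case False
    have "G u u \<le> G (z /\<^sub>R norm z) (z /\<^sub>R norm z)" by (rule u(2)) (use False in simp)
    also have "\<dots> = G z z / (norm z)\<^sup>2" by (simp add: scaleR_left scaleR_right power2_eq_square field_simps)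
    finally show ?thesis using False by (simp add: field_simps)
  qed (simp add: zero_left)
  ultimately show ?thesis using that by blast
qed

lemma scalar_product_combination:
  assumes "scalar_product G" "scalar_product H" "0 \<le> s" "0 \<le> t" "0 < s + t"
  shows "scalar_product (\<lambda>u v. s * G u v + t * H u v)"
proof -
  note G = scalar_productD[OF assms(1)] and H = scalar_productD[OF assms(2)]
  have "bilinear (\<lambda>u v. s * G u v + t * H u v)"
    unfolding bilinear_def
    by (auto intro!: linearI simp: bilinear_simps[OF G(1)] bilinear_simps[OF H(1)] algebra_simps)
  moreover have "s * G u u + t * H u u > 0" if "u \<noteq> 0" for u
  proof (cases "s > 0")
    case True
    then show ?thesis using G(3)[OF that] H(4)[of u] assms(4) by (intro add_pos_nonneg) auto
  next
    case False
    then show ?thesis using H(3)[OF that] G(4)[of u] assms by (intro add_nonneg_pos) auto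
  qed
  ultimately show ?thesis using G(2) H(2) by (auto simp: scalar_product_def)
qed

lemma scalar_product_inner: "scalar_product (\<lambda>u v. u \<bullet> v)"
  by (auto simp: scalar_product_def bilinear_def inner_commute intro!: linearI simp: inner_add_left inner_add_right)

text \<open>
  Deform the standard inner product into \<open>G\<close> along the segment \<open>H t\<close> of scalar products. The determinant \<open>D\<close> starts at 1 and
  satisfies \<open>D' = \<theta> D\<close> with bounded \<open>\<theta>\<close>, so \<open>exp (2 K t) (D t)\<^sup>2\<close> is nondecreasing and \<open>D\<close> cannot
  reach 0.
\<close>

lemma gram_det_nonzero:
  fixes G :: "'a::euclidean_space \<Rightarrow> 'a \<Rightarrow> real"
  assumes G: "scalar_product G"
  shows "gram_det G \<noteq> 0"
proof -
  note bl = scalar_productD(1)[OF G]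
  interpret bounded_bilinear G using bl by (simp add: bilinear_conv_bounded_bilinear)
  obtain B where B: "\<And>x y. norm (G x y) \<le> norm x * norm y * B" and B0: "B > 0" using pos_bounded by blast
  obtain m where m: "m > 0" "\<And>z. m * (norm z)\<^sup>2 \<le> G z z" using scalar_product_coercive[OF G] by blast
  define H where "H t u v = (1 - t) * (u \<bullet> v) + t * G u v" for t :: real and u v :: 'a
  define A where "A t b = raise (H t) (\<lambda>v. G b v - b \<bullet> v)" for t b
  define K where "K = real DIM('a) * ((B + 1) / min 1 m)"
  have H: "scalar_product (H t)" if "t \<in> {0..1}" for t
    unfolding H_def using that by (intro scalar_product_combination scalar_product_inner G) auto
  have lin: "linear (\<lambda>v. G b v - b \<bullet> v)" for b
    by (intro linear_compose_sub bilinear_linear_right[OF bl] linearI) (auto simp: inner_add_right)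
  have A: "H t (A t b) v = G b v - b \<bullet> v" if "t \<in> {0..1}" for t b v
    unfolding A_def by (rule raise[OF H[OF that] lin])
  \<comment> \<open>Testing \<open>A\<close> on itself: \<open>H t\<close> is coercive with constant \<open>min 1 m\<close>, while \<open>H t (A t b)\<close> is a bounded functional.\<close>
  have Abound: "\<bar>A t b \<bullet> b\<bar> \<le> (B + 1) / min 1 m" if t: "t \<in> {0..1}" and b: "b \<in> Basis" for t b
  proof -
    have "min 1 m * (norm (A t b))\<^sup>2 \<le> (1 - t) * (norm (A t b))\<^sup>2 + t * (m * (norm (A t b))\<^sup>2)"
    proof -
      have "min 1 m * (norm (A t b))\<^sup>2 = (1 - t) * (min 1 m * (norm (A t b))\<^sup>2) + t * (min 1 m * (norm (A t b))\<^sup>2)"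
        by (simp add: algebra_simps)
      also have "\<dots> \<le> (1 - t) * (1 * (norm (A t b))\<^sup>2) + t * (m * (norm (A t b))\<^sup>2)"
        using t by (intro add_mono mult_left_mono mult_right_mono) auto
      finally show ?thesis by simp
    qed
    also have "\<dots> \<le> H t (A t b) (A t b)"
      unfolding H_def using m(2)[of "A t b"] t by (simp add: power2_norm_eq_inner mult_left_mono)
    also have "\<dots> = G b (A t b) - b \<bullet> A t b" by (rule A[OF t])
    also have "\<dots> \<le> norm (A t b) * (B + 1)"
      using B[of b "A t b"] Cauchy_Schwarz_ineq2[of b "A t b"] b by (simp add: algebra_simps)
    finally have "norm (A t b) * (min 1 m * norm (A t b)) \<le> norm (A t b) * (B + 1)"
      by (simp add: power2_eq_square mult_ac)
    then have "min 1 m * norm (A t b) \<le> B + 1"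
      using B0 by (cases "A t b = 0") (simp_all del: min_less_iff_conj)
    then have "norm (A t b) \<le> (B + 1) / min 1 m"
      using m by (simp add: field_simps)
    then show ?thesis using Basis_le_norm[OF b, of "A t b"] by simp
  qed
  define D where "D t = gram_det (H t)" for t
  define \<theta> where "\<theta> t = (\<Sum>b\<in>Basis. A t b \<bullet> b)" for t
  have \<theta>: "\<bar>\<theta> t\<bar> \<le> K" if "t \<in> {0..1}" for t
  proof -
    have "\<bar>\<theta> t\<bar> \<le> (\<Sum>b\<in>Basis. \<bar>A t b \<bullet> b\<bar>)" unfolding \<theta>_def by (rule sum_abs)
    also have "\<dots> \<le> K" unfolding K_def by (rule sum_bounded_above) (use Abound that in auto)
    finally show ?thesis .
  qed
  have D': "(D has_real_derivative \<theta> t * D t) (at t)" if t: "t \<in> {0..1}" for t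
  proof -
    have "((\<lambda>t. gram_det (H t)) has_derivative (\<lambda>h. (\<Sum>b\<in>Basis. (h *\<^sub>R A t b) \<bullet> b) * gram_det (H t))) (at t)"
    proof (rule has_derivative_gram_det)
      fix b c :: 'a
      have "((\<lambda>t. H t b c) has_derivative (\<lambda>h. h * (G b c - b \<bullet> c))) (at t)"
        unfolding H_def by (auto intro!: derivative_eq_intros simp: algebra_simps)
      then show "((\<lambda>t. H t b c) has_derivative (\<lambda>h. H t (h *\<^sub>R A t b) c)) (at t)"
        by (simp add: bilinear_lmul[OF scalar_productD(1)[OF H[OF t]]] A[OF t])
    qed (simp_all add: scalar_productD(1)[OF H[OF t]])
    then show ?thesis
      unfolding has_field_derivative_def D_def \<theta>_def
      by (rule has_derivative_eq_rhs) (auto simp: fun_eq_iff sum_distrib_left sum_distrib_right mult_ac)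
  qed
  define f where "f t = exp (2 * K * t) * (D t)\<^sup>2" for t
  have "f 0 \<le> f 1"
  proof (rule DERIV_nonneg_imp_nondecreasing[of 0 1 f])
    fix t :: real assume "0 \<le> t" "t \<le> 1"
    then have t: "t \<in> {0..1}" by simp
    have "(f has_real_derivative 2 * exp (2 * K * t) * (D t)\<^sup>2 * (K + \<theta> t)) (at t)"
      unfolding f_def by (rule derivative_eq_intros D'[OF t] refl)+ (simp add: power2_eq_square algebra_simps)
    moreover have "2 * exp (2 * K * t) * (D t)\<^sup>2 * (K + \<theta> t) \<ge> 0"
      using \<theta>[OF t] by (intro mult_nonneg_nonneg) auto
    ultimately show "\<exists>y. (f has_real_derivative y) (at t) \<and> 0 \<le> y" by blast
  qed simp
  moreover have "H 0 = (\<lambda>u v. u \<bullet> v)" "H 1 = G" by (simp_all add: H_def fun_eq_iff)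
  then have "f 0 = 1" "D 1 = gram_det G" by (simp_all add: f_def D_def gram_det_inner)
  ultimately show ?thesis by (auto simp: f_def)
qed

section \<open>Metrics and one-forms in a chart\<close>

locale chart_metric =
  fixes U :: "'a::euclidean_space set" and G :: "'a \<Rightarrow> 'a \<Rightarrow> 'a \<Rightarrow> real"
  assumes open_U: "open U"
    and scalar_product: "y \<in> U \<Longrightarrow> scalar_product (G y)"
    and G_C2: "Ck_open 2 (\<lambda>y. G y u v) U"
begin

text \<open>
  Here \<open>k\<close> is the direction of differentiation and \<open>u\<close>, \<open>v\<close> are the frozen arguments.
\<close>

definition DG :: "'a \<Rightarrow> 'a \<Rightarrow> 'a \<Rightarrow> 'a \<Rightarrow> real" where
  "DG y k u v = frechet_derivative (\<lambda>z. G z u v) (at y) k"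

lemmas bilinear_G = scalar_productD(1)[OF scalar_product]
  and G_sym = scalar_productD(2)[OF scalar_product]
  and G_pos = scalar_productD(3)[OF scalar_product]
  and G_nonneg = scalar_productD(4)[OF scalar_product]

lemmas G_simps = bilinear_simps[OF bilinear_G]

lemma G_derivative: "y \<in> U \<Longrightarrow> ((\<lambda>z. G z u v) has_derivative (\<lambda>k. DG y k u v)) (at y)"
  unfolding DG_def using Ck_open_SucD[of 1 "\<lambda>z. G z u v" U y] G_C2 by (simp add: numeral_2_eq_2)

lemma DG_continuous: "continuous_on U (\<lambda>y. DG y k u v)"
proof -
  have "Ck_open 1 (\<lambda>y. DG y k u v) U" using G_C2[of u v] by (simp add: numeral_2_eq_2 DG_def)
  then show ?thesis by (rule Ck_open_imp_continuous_on)
qed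

lemma G_continuous: "continuous_on U (\<lambda>y. G y u v)"
  using G_C2 by (rule Ck_open_imp_continuous_on)

lemma DG_unique:
  assumes y: "y \<in> U" and d: "(f has_derivative f') (at y)" and eq: "\<And>z. z \<in> U \<Longrightarrow> G z u v = f z"
  shows "DG y k u v = f' k"
proof -
  have "(f has_derivative (\<lambda>k. DG y k u v)) (at y)"
    by (rule has_derivative_transform_within_open[OF G_derivative[OF y] open_U y eq])
  from has_derivative_unique[OF this d] show ?thesis by meson
qed

lemma DG_linear: "y \<in> U \<Longrightarrow> linear (\<lambda>k. DG y k u v)"
  using G_derivative has_derivative_linear by blast

lemma DG_sym: "y \<in> U \<Longrightarrow> DG y k u v = DG y k v u"
  by (rule DG_unique[OF _ G_derivative]) (simp_all add: G_sym)

lemma DG_bilinear: "y \<in> U \<Longrightarrow> bilinear (DG y k)"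
  unfolding bilinear_def
proof (intro conjI allI linearI)
  fix u u' v :: 'a and c :: real assume y: "y \<in> U"
  show "DG y k (u + u') v = DG y k u v + DG y k u' v" "DG y k v (u + u') = DG y k v u + DG y k v u'"
    by (rule DG_unique[OF y has_derivative_add[OF G_derivative[OF y] G_derivative[OF y]]], simp add: G_simps)+
  show "DG y k (c *\<^sub>R u) v = c *\<^sub>R DG y k u v" "DG y k v (c *\<^sub>R u) = c *\<^sub>R DG y k v u"
    by (rule DG_unique[OF y has_derivative_scaleR_right[OF G_derivative[OF y]]], simp add: G_simps)+
qed

lemmas DG_simps = bilinear_simps[OF DG_bilinear] linear_add[OF DG_linear] linear_scale[OF DG_linear]
  linear_diff[OF DG_linear] linear_0[OF DG_linear] linear_neg[OF DG_linear]

lemma DG_expand: "y \<in> U \<Longrightarrow> DG y k u v = (\<Sum>l\<in>Basis. (k \<bullet> l) * DG y l u v)"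
  by (subst (1) euclidean_representation[of k, symmetric])
    (simp add: linear_sum[OF DG_linear] linear_scale[OF DG_linear])

text \<open>
  Continuity is assumed only for fixed vectors; finite expansion over the basis gives joint continuity. The same device
  yields the derivative below.
\<close>

lemma continuous_on_G:
  assumes "continuous_on S x" "x ` S \<subseteq> U" "continuous_on S u" "continuous_on S v"
  shows "continuous_on S (\<lambda>s. G (x s) (u s) (v s))"
proof -
  have "continuous_on S (\<lambda>s. \<Sum>i\<in>Basis. \<Sum>j\<in>Basis. (u s \<bullet> i) * (v s \<bullet> j) * G (x s) i j)"
    by (intro continuous_intros assms continuous_on_compose2[OF G_continuous assms(1,2)])
  then show ?thesis
    by (rule continuous_on_eq) (use assms(2) in \<open>auto simp: bilinear_basis_expansion[OF bilinear_G, symmetric]\<close>)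
qed

lemma continuous_on_DG:
  assumes "continuous_on S x" "x ` S \<subseteq> U" "continuous_on S k" "continuous_on S u" "continuous_on S v"
  shows "continuous_on S (\<lambda>s. DG (x s) (k s) (u s) (v s))"
proof -
  have "continuous_on S (\<lambda>s. \<Sum>l\<in>Basis. (k s \<bullet> l) * (\<Sum>i\<in>Basis. \<Sum>j\<in>Basis. (u s \<bullet> i) * (v s \<bullet> j) * DG (x s) l i j))"
    by (intro continuous_intros assms continuous_on_compose2[OF DG_continuous assms(1,2)])
  then show ?thesis
    by (rule continuous_on_eq)
      (use assms(2) in \<open>auto simp: bilinear_basis_expansion[OF DG_bilinear, symmetric] DG_expand[symmetric]\<close>)
qed

lemma has_derivative_G:
  assumes x: "(x has_derivative x') (at s within S)" "x ` S \<subseteq> U" "s \<in> S"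
    and u: "(u has_derivative u') (at s within S)" and v: "(v has_derivative v') (at s within S)"
  shows "((\<lambda>s. G (x s) (u s) (v s)) has_derivative
    (\<lambda>h. DG (x s) (x' h) (u s) (v s) + G (x s) (u' h) (v s) + G (x s) (u s) (v' h))) (at s within S)"
proof -
  have xs: "x s \<in> U" using x by auto
  have Gij: "((\<lambda>s. G (x s) i j) has_derivative (\<lambda>h. DG (x s) (x' h) i j)) (at s within S)" for i j
    using has_derivative_compose[OF x(1) G_derivative[OF xs]] .
  have "((\<lambda>s. \<Sum>i\<in>Basis. \<Sum>j\<in>Basis. (u s \<bullet> i) * (v s \<bullet> j) * G (x s) i j) has_derivative
     (\<lambda>h. \<Sum>i\<in>Basis. \<Sum>j\<in>Basis. ((u s \<bullet> i) * (v s \<bullet> j)) * DG (x s) (x' h) i j +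
        ((u s \<bullet> i) * (v' h \<bullet> j) + (u' h \<bullet> i) * (v s \<bullet> j)) * G (x s) i j)) (at s within S)"
    by (intro has_derivative_sum has_derivative_mult has_derivative_inner_left u v Gij)
  then have "((\<lambda>s. G (x s) (u s) (v s)) has_derivative
     (\<lambda>h. \<Sum>i\<in>Basis. \<Sum>j\<in>Basis. ((u s \<bullet> i) * (v s \<bullet> j)) * DG (x s) (x' h) i j +
        ((u s \<bullet> i) * (v' h \<bullet> j) + (u' h \<bullet> i) * (v s \<bullet> j)) * G (x s) i j)) (at s within S)"
    by (rule has_derivative_transform[OF x(3), rotated])
      (use x(2) in \<open>auto simp: bilinear_basis_expansion[OF bilinear_G, symmetric]\<close>)
  moreover have "(\<Sum>i\<in>Basis. \<Sum>j\<in>Basis. ((u s \<bullet> i) * (v s \<bullet> j)) * DG (x s) (x' h) i j +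
        ((u s \<bullet> i) * (v' h \<bullet> j) + (u' h \<bullet> i) * (v s \<bullet> j)) * G (x s) i j)
      = DG (x s) (x' h) (u s) (v s) + G (x s) (u' h) (v s) + G (x s) (u s) (v' h)" for h
    unfolding bilinear_basis_expansion[OF bilinear_G[OF xs], of "u' h"] bilinear_basis_expansion[OF bilinear_G[OF xs], of _ "v' h"]
      bilinear_basis_expansion[OF DG_bilinear[OF xs], of _ "u s" "v s"]
    by (simp add: sum.distrib distrib_right)
  ultimately show ?thesis by simp
qed

lemma has_vector_derivative_G:
  fixes x u v :: "real \<Rightarrow> 'a"
  assumes x: "(x has_vector_derivative x') (at s within S)" "x ` S \<subseteq> U" "s \<in> S"
    and u: "(u has_vector_derivative u') (at s within S)" and v: "(v has_vector_derivative v') (at s within S)"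
  shows "((\<lambda>s. G (x s) (u s) (v s)) has_real_derivative
    (DG (x s) x' (u s) (v s) + G (x s) u' (v s) + G (x s) (u s) v')) (at s within S)"
proof -
  have xs: "x s \<in> U" using x by auto
  show ?thesis
    unfolding has_field_derivative_def
    by (rule has_derivative_eq_rhs[OF has_derivative_G[OF x(1)[unfolded has_vector_derivative_def] x(2,3)
            u[unfolded has_vector_derivative_def] v[unfolded has_vector_derivative_def]]])
      (auto simp: G_simps[OF xs] DG_simps[OF xs] algebra_simps)
qed

text \<open>
  Entrywise continuity makes the quadratic form vary little on the unit sphere, so half of the coercivity constant at
  \<open>y0\<close> survives nearby.
\<close>

lemma coercive_near:
  assumes y0: "y0 \<in> U"
  obtains m where "m > 0" "\<forall>\<^sub>F y in nhds y0. \<forall>z. m * (norm z)\<^sup>2 \<le> G y z z"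
proof -
  obtain m where m: "m > 0" "\<And>z. m * (norm z)\<^sup>2 \<le> G y0 z z"
    using scalar_product_coercive[OF scalar_product[OF y0]] by blast
  define e where "e y = (\<Sum>i\<in>Basis. \<Sum>j\<in>Basis. \<bar>G y i j - G y0 i j\<bar>)" for y
  have "continuous_on U e" unfolding e_def by (intro continuous_intros G_continuous)
  then have "isCont e y0" using open_U y0 by (simp add: continuous_on_eq_continuous_at)
  then have "(e \<longlongrightarrow> e y0) (nhds y0)" by (simp add: continuous_at tendsto_at_iff_tendsto_nhds)
  then have "\<forall>\<^sub>F y in nhds y0. e y < m / 2"
    by (rule order_tendstoD) (use m in \<open>simp add: e_def\<close>)
  moreover have "\<forall>\<^sub>F y in nhds y0. y \<in> U" using open_U y0 by (rule eventually_nhds_in_open)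
  ultimately have "\<forall>\<^sub>F y in nhds y0. \<forall>z. m / 2 * (norm z)\<^sup>2 \<le> G y z z"
  proof eventually_elim
    case (elim y)
    show ?case
    proof
      fix z
      have "\<bar>G y0 z z - G y z z\<bar> = \<bar>\<Sum>i\<in>Basis. \<Sum>j\<in>Basis. (z \<bullet> i) * (z \<bullet> j) * (G y0 i j - G y i j)\<bar>"
        unfolding bilinear_basis_expansion[OF bilinear_G[OF y0], of z z] bilinear_basis_expansion[OF bilinear_G[OF elim(2)], of z z]
        by (simp add: sum_subtractf algebra_simps)
      also have "\<dots> \<le> (\<Sum>i\<in>Basis. \<Sum>j\<in>Basis. \<bar>(z \<bullet> i) * (z \<bullet> j) * (G y0 i j - G y i j)\<bar>)"
        by (rule order_trans[OF sum_abs]) (intro sum_mono sum_abs)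
      also have "\<dots> \<le> (\<Sum>i\<in>Basis. \<Sum>j\<in>Basis. (norm z)\<^sup>2 * \<bar>G y i j - G y0 i j\<bar>)"
      proof (intro sum_mono)
        fix i j :: 'a assume "i \<in> Basis" "j \<in> Basis"
        then have "\<bar>z \<bullet> i\<bar> * \<bar>z \<bullet> j\<bar> \<le> norm z * norm z"
          by (intro mult_mono Basis_le_norm) auto
        then show "\<bar>(z \<bullet> i) * (z \<bullet> j) * (G y0 i j - G y i j)\<bar> \<le> (norm z)\<^sup>2 * \<bar>G y i j - G y0 i j\<bar>"
          by (simp add: abs_mult power2_eq_square mult_right_mono abs_minus_commute)
      qed
      also have "\<dots> = (norm z)\<^sup>2 * e y" by (simp add: e_def sum_distrib_left)
      also have "\<dots> \<le> (norm z)\<^sup>2 * (m / 2)" using elim by (intro mult_left_mono) auto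
      finally have "G y0 z z - G y z z \<le> m / 2 * (norm z)\<^sup>2"
        by (simp only: abs_le_iff mult.commute)
      moreover have "m * (norm z)\<^sup>2 = m / 2 * (norm z)\<^sup>2 + m / 2 * (norm z)\<^sup>2" by simp
      ultimately show "m / 2 * (norm z)\<^sup>2 \<le> G y z z" using m(2)[of z] by linarith
    qed
  qed
  then show ?thesis using that[of "m / 2"] m by simp
qed

text \<open>
  By coercivity, \<open>z s - z s0\<close> is bounded by the residual \<open>d s\<close> of the equation for
  \<open>z s0\<close> in the metric at \<open>x s\<close>, and this tends to 0.
\<close>

lemma continuous_on_raise:
  assumes x: "continuous_on S x" "x ` S \<subseteq> U"
    and b: "\<And>s. s \<in> S \<Longrightarrow> linear (b s)" "\<And>v. v \<in> Basis \<Longrightarrow> continuous_on S (\<lambda>s. b s v)"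
  shows "continuous_on S (\<lambda>s. raise (G (x s)) (b s))"
  unfolding continuous_on_def
proof
  fix s0 assume s0: "s0 \<in> S"
  define z where "z s = raise (G (x s)) (b s)" for s
  have z: "G (x s) (z s) v = b s v" if "s \<in> S" for s v
    unfolding z_def using that x(2) by (intro raise scalar_product b(1)) auto
  obtain m where m: "m > 0" "\<forall>\<^sub>F y in nhds (x s0). \<forall>z. m * (norm z)\<^sup>2 \<le> G y z z"
    using coercive_near[of "x s0"] s0 x(2) by blast
  define d where "d s = (\<Sum>j\<in>Basis. \<bar>b s j - G (x s) (z s0) j\<bar>)" for s
  have "continuous_on S d" unfolding d_def
    by (intro continuous_intros b(2) continuous_on_G x)
  then have "(d \<longlongrightarrow> d s0) (at s0 within S)" using s0 by (simp add: continuous_on_def)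
  moreover have "d s0 = 0" using s0 by (simp add: d_def z)
  ultimately have d0: "((\<lambda>s. d s / m) \<longlongrightarrow> 0) (at s0 within S)"
    using tendsto_divide[of d 0 _ "\<lambda>_. m" m] m by auto
  have "(x \<longlongrightarrow> x s0) (at s0 within S)" using x s0 by (simp add: continuous_on_def)
  then have "\<forall>\<^sub>F s in at s0 within S. \<forall>z. m * (norm z)\<^sup>2 \<le> G (x s) z z"
    by (rule eventually_compose_filterlim[OF m(2)])
  moreover have "\<forall>\<^sub>F s in at s0 within S. s \<in> S" by (simp add: eventually_at_topological) auto
  ultimately have "\<forall>\<^sub>F s in at s0 within S. norm (z s - z s0) \<le> d s / m"
  proof eventually_elim
    case (elim s)
    have xs: "x s \<in> U" using elim x(2) by auto
    \<comment> \<open>\<open>m |w|\<^sup>2 \<le> G w w \<le> |w| d s\<close>, and one factor \<open>|w|\<close> cancels.\<close>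
    define w where "w = z s - z s0"
    have "m * (norm w)\<^sup>2 \<le> G (x s) w w" using elim by blast
    also have "\<dots> = b s w - G (x s) (z s0) w"
      unfolding w_def by (simp add: G_simps[OF xs] z[OF elim(2)] linear_diff[OF b(1)[OF elim(2)]])
    also have "\<dots> = (\<Sum>j\<in>Basis. (w \<bullet> j) * (b s j - G (x s) (z s0) j))"
    proof -
      have "linear (\<lambda>v. b s v - G (x s) (z s0) v)"
        by (intro linear_compose_sub b(1) elim bilinear_linear_right bilinear_G xs)
      from linear_sum[OF this, of "\<lambda>j. (w \<bullet> j) *\<^sub>R j" Basis] linear_scale[OF this]
      show ?thesis by (simp add: euclidean_representation)
    qed
    also have "\<dots> \<le> (\<Sum>j\<in>Basis. norm w * \<bar>b s j - G (x s) (z s0) j\<bar>)"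
    proof (rule sum_mono)
      fix j :: 'a assume j: "j \<in> Basis"
      have "(w \<bullet> j) * (b s j - G (x s) (z s0) j) \<le> \<bar>w \<bullet> j\<bar> * \<bar>b s j - G (x s) (z s0) j\<bar>"
        by (metis abs_ge_self abs_mult)
      also have "\<dots> \<le> norm w * \<bar>b s j - G (x s) (z s0) j\<bar>"
        by (intro mult_right_mono Basis_le_norm j) auto
      finally show "(w \<bullet> j) * (b s j - G (x s) (z s0) j) \<le> norm w * \<bar>b s j - G (x s) (z s0) j\<bar>" .
    qed
    also have "\<dots> = norm w * d s" by (simp add: d_def sum_distrib_left)
    finally have *: "norm w * (m * norm w) \<le> norm w * d s" by (simp add: power2_eq_square mult_ac)
    have "d s \<ge> 0" unfolding d_def by (intro sum_nonneg) auto
    then have "m * norm w \<le> d s" using * by (cases "w = 0") auto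
    then show ?case using m by (simp add: w_def field_simps)
  qed
  then have "((\<lambda>s. z s - z s0) \<longlongrightarrow> 0) (at s0 within S)"
    by (rule Lim_null_comparison[OF _ d0])
  then show "((\<lambda>s. raise (G (x s)) (b s)) \<longlongrightarrow> raise (G (x s0)) (b s0)) (at s0 within S)"
    unfolding z_def[symmetric] by (rule LIM_zero_cancel)
qed

definition christoffel :: "'a \<Rightarrow> 'a \<Rightarrow> 'a \<Rightarrow> 'a" where
  "christoffel y u v = raise (G y) (\<lambda>z. (DG y u v z + DG y v u z - DG y z u v) / 2)"

lemma christoffel_linear_form: "y \<in> U \<Longrightarrow> linear (\<lambda>z. (DG y u v z + DG y v u z - DG y z u v) / 2)"
  by (rule linearI) (simp_all add: DG_simps algebra_simps add_divide_distrib diff_divide_distrib)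

lemma G_christoffel: "y \<in> U \<Longrightarrow> G y (christoffel y u v) z = (DG y u v z + DG y v u z - DG y z u v) / 2"
  unfolding christoffel_def by (rule raise[OF scalar_product christoffel_linear_form])

lemma christoffel_sym: "y \<in> U \<Longrightarrow> christoffel y u v = christoffel y v u"
  by (rule scalar_product_cancel[OF scalar_product]) (auto simp: G_christoffel DG_sym[of y _ u v])

lemma christoffel_bilinear: "y \<in> U \<Longrightarrow> bilinear (christoffel y)"
  unfolding bilinear_def
proof (intro conjI allI linearI)
  fix u u' v :: 'a and c :: real assume y: "y \<in> U"
  note c = scalar_product_cancel[OF scalar_product[OF y]]
  show "christoffel y (u + u') v = christoffel y u v + christoffel y u' v"
    "christoffel y v (u + u') = christoffel y v u + christoffel y v u'"
    "christoffel y (c *\<^sub>R u) v = c *\<^sub>R christoffel y u v"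
    "christoffel y v (c *\<^sub>R u) = c *\<^sub>R christoffel y v u"
    by (rule c, simp add: G_simps[OF y] DG_simps[OF y] G_christoffel[OF y] field_simps)+
qed

lemma continuous_on_christoffel:
  assumes "continuous_on S x" "x ` S \<subseteq> U" "continuous_on S u" "continuous_on S v"
  shows "continuous_on S (\<lambda>s. christoffel (x s) (u s) (v s))"
  unfolding christoffel_def
  by (rule continuous_on_raise[OF assms(1,2)])
    (use assms in \<open>auto intro!: christoffel_linear_form continuous_intros continuous_on_DG\<close>)

text \<open>
  In coordinates: the trace of \<open>\<Gamma>\<close> is half the logarithmic derivative of the determinant. Of the three terms of \<open>\<Gamma>\<close>,
  the last two cancel in the trace by symmetry of the inverse matrix, whose rows are the vectors \<open>R j\<close>.
\<close>

lemma gram_det_derivative: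
  assumes y: "y \<in> U"
  shows "((\<lambda>y. gram_det (G y)) has_derivative
    (\<lambda>h. 2 * (\<Sum>j\<in>Basis. christoffel y h j \<bullet> j) * gram_det (G y))) (at y)"
proof -
  note sp = scalar_product[OF y]
  define A where "A h b = raise (G y) (DG y h b)" for h b
  define R where "R b = raise (G y) (\<lambda>v. v \<bullet> b)" for b
  have A: "G y (A h b) c = DG y h b c" for h b c
    unfolding A_def by (rule raise[OF sp bilinear_linear_right[OF DG_bilinear[OF y]]])
  have R: "G y (R b) v = v \<bullet> b" for b v
    unfolding R_def by (rule raise[OF sp]) (auto intro!: linearI simp: inner_add_left)
  have "((\<lambda>y. gram_det (G y)) has_derivative (\<lambda>h. (\<Sum>b\<in>Basis. A h b \<bullet> b) * gram_det (G y))) (at y)"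
    by (rule has_derivative_gram_det) (simp_all add: A G_derivative[OF y] bilinear_G[OF y])
  moreover have "(\<Sum>b\<in>Basis. A h b \<bullet> b) = 2 * (\<Sum>j\<in>Basis. christoffel y h j \<bullet> j)" for h
  proof -
    have 1: "A h b \<bullet> b = DG y h b (R b)" for b
      using R[of b "A h b"] A[of h b "R b"] G_sym[OF y, of "R b" "A h b"] by simp
    have 2: "christoffel y h j \<bullet> j = (DG y h j (R j) + DG y j h (R j) - DG y (R j) h j) / 2" for j
      using R[of j "christoffel y h j"] G_sym[OF y, of "R j"] by (simp add: G_christoffel[OF y])
    have Rsym: "R j \<bullet> l = R l \<bullet> j" for j l
      using R[of l "R j"] R[of j "R l"] G_sym[OF y, of "R j"] by simp
    have "(\<Sum>j\<in>Basis. DG y j h (R j)) = (\<Sum>j\<in>Basis. \<Sum>l\<in>Basis. (R j \<bullet> l) * DG y j h l)"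
      by (subst (1) euclidean_representation[of "R _", symmetric])
        (simp add: linear_sum[OF bilinear_linear_right[OF DG_bilinear[OF y]]] DG_simps[OF y])
    also have "\<dots> = (\<Sum>l\<in>Basis. \<Sum>j\<in>Basis. (R l \<bullet> j) * DG y j h l)"
      by (subst sum.swap) (simp add: Rsym)
    also have "\<dots> = (\<Sum>l\<in>Basis. DG y (R l) h l)"
      by (simp add: DG_expand[OF y, of "R _", symmetric])
    finally show ?thesis
      unfolding 1 2 by (simp add: sum.distrib sum_subtractf sum_divide_distrib[symmetric])
  qed
  ultimately show ?thesis by simp
qed

end

locale chart_form =
  fixes U :: "'a::euclidean_space set" and w :: "'a \<Rightarrow> 'a \<Rightarrow> real"
  assumes open_domain: "open U"
    and linear_w: "y \<in> U \<Longrightarrow> linear (w y)"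
    and w_C2: "Ck_open 2 (\<lambda>y. w y u) U"
begin

definition Dw :: "'a \<Rightarrow> 'a \<Rightarrow> 'a \<Rightarrow> real" where
  "Dw y k u = frechet_derivative (\<lambda>z. w z u) (at y) k"

text \<open>
  The exterior derivative of the form, with the convention of \<open>ext_deriv\<close>.
\<close>

definition dext :: "'a \<Rightarrow> 'a \<Rightarrow> 'a \<Rightarrow> real" where
  "dext y u v = Dw y u v - Dw y v u"

lemma w_derivative: "y \<in> U \<Longrightarrow> ((\<lambda>z. w z u) has_derivative (\<lambda>k. Dw y k u)) (at y)"
  unfolding Dw_def using Ck_open_SucD[of 1 "\<lambda>z. w z u" U y] w_C2 by (simp add: numeral_2_eq_2)

lemma Dw_continuous: "continuous_on U (\<lambda>y. Dw y k u)"
proof -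
  have "Ck_open 1 (\<lambda>y. Dw y k u) U" using w_C2[of u] by (simp add: numeral_2_eq_2 Dw_def)
  then show ?thesis by (rule Ck_open_imp_continuous_on)
qed

lemma w_continuous: "continuous_on U (\<lambda>y. w y u)"
  using w_C2 by (rule Ck_open_imp_continuous_on)

lemma w_expand: "y \<in> U \<Longrightarrow> w y u = (\<Sum>i\<in>Basis. (u \<bullet> i) * w y i)"
  by (subst (1) euclidean_representation[of u, symmetric])
    (simp add: linear_sum[OF linear_w] linear_scale[OF linear_w])

lemma Dw_linear: "y \<in> U \<Longrightarrow> linear (\<lambda>k. Dw y k u)"
  using w_derivative has_derivative_linear by blast

lemma Dw_unique:
  assumes y: "y \<in> U" and d: "(f has_derivative f') (at y)" and eq: "\<And>z. z \<in> U \<Longrightarrow> w z u = f z"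
  shows "Dw y k u = f' k"
proof -
  have "(f has_derivative (\<lambda>k. Dw y k u)) (at y)"
    by (rule has_derivative_transform_within_open[OF w_derivative[OF y] open_domain y eq])
  from has_derivative_unique[OF this d] show ?thesis by meson
qed

lemma Dw_bilinear: "y \<in> U \<Longrightarrow> bilinear (Dw y)"
  unfolding bilinear_def
proof (intro conjI allI)
  fix k :: 'a assume y: "y \<in> U"
  show "linear (\<lambda>k'. Dw y k' k)" by (rule Dw_linear[OF y])
  show "linear (Dw y k)"
  proof (rule linearI)
    show "Dw y k (u + v) = Dw y k u + Dw y k v" for u v
      by (rule Dw_unique[OF y has_derivative_add[OF w_derivative[OF y] w_derivative[OF y]]])
        (simp add: linear_add[OF linear_w])
    show "Dw y k (c *\<^sub>R u) = c *\<^sub>R Dw y k u" for c u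
      by (rule Dw_unique[OF y has_derivative_scaleR_right[OF w_derivative[OF y]]])
        (simp add: linear_scale[OF linear_w])
  qed
qed

lemmas Dw_simps = bilinear_simps[OF Dw_bilinear]

lemma continuous_on_w:
  assumes "continuous_on S x" "x ` S \<subseteq> U" "continuous_on S u"
  shows "continuous_on S (\<lambda>s. w (x s) (u s))"
proof -
  have "continuous_on S (\<lambda>s. \<Sum>i\<in>Basis. (u s \<bullet> i) * w (x s) i)"
    by (intro continuous_intros assms continuous_on_compose2[OF w_continuous assms(1,2)])
  then show ?thesis
    by (rule continuous_on_eq) (use assms(2) in \<open>auto simp: w_expand[symmetric]\<close>)
qed

lemma continuous_on_Dw:
  assumes "continuous_on S x" "x ` S \<subseteq> U" "continuous_on S k" "continuous_on S u"
  shows "continuous_on S (\<lambda>s. Dw (x s) (k s) (u s))"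
proof -
  have "continuous_on S (\<lambda>s. \<Sum>i\<in>Basis. \<Sum>j\<in>Basis. (k s \<bullet> i) * (u s \<bullet> j) * Dw (x s) i j)"
    by (intro continuous_intros assms continuous_on_compose2[OF Dw_continuous assms(1,2)])
  then show ?thesis
    by (rule continuous_on_eq) (use assms(2) in \<open>auto simp: bilinear_basis_expansion[OF Dw_bilinear, symmetric]\<close>)
qed

lemma continuous_on_dext:
  assumes "continuous_on S x" "x ` S \<subseteq> U" "continuous_on S k" "continuous_on S u"
  shows "continuous_on S (\<lambda>s. dext (x s) (k s) (u s))"
  unfolding dext_def by (intro continuous_intros continuous_on_Dw assms)

lemma has_derivative_w:
  assumes x: "(x has_derivative x') (at s within S)" "x ` S \<subseteq> U" "s \<in> S"
    and u: "(u has_derivative u') (at s within S)"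
  shows "((\<lambda>s. w (x s) (u s)) has_derivative (\<lambda>h. Dw (x s) (x' h) (u s) + w (x s) (u' h))) (at s within S)"
proof -
  have xs: "x s \<in> U" using x by auto
  have wi: "((\<lambda>s. w (x s) i) has_derivative (\<lambda>h. Dw (x s) (x' h) i)) (at s within S)" for i
    using has_derivative_compose[OF x(1) w_derivative[OF xs]] .
  have "((\<lambda>s. \<Sum>i\<in>Basis. (u s \<bullet> i) * w (x s) i) has_derivative
     (\<lambda>h. \<Sum>i\<in>Basis. (u s \<bullet> i) * Dw (x s) (x' h) i + (u' h \<bullet> i) * w (x s) i)) (at s within S)"
    by (intro has_derivative_sum has_derivative_mult has_derivative_inner_left u wi)
  then have "((\<lambda>s. w (x s) (u s)) has_derivative
     (\<lambda>h. \<Sum>i\<in>Basis. (u s \<bullet> i) * Dw (x s) (x' h) i + (u' h \<bullet> i) * w (x s) i)) (at s within S)"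
    by (rule has_derivative_transform[OF x(3), rotated])
      (use x(2) in \<open>auto simp: w_expand[symmetric]\<close>)
  moreover have "(\<Sum>i\<in>Basis. (u s \<bullet> i) * Dw (x s) (x' h) i + (u' h \<bullet> i) * w (x s) i)
      = Dw (x s) (x' h) (u s) + w (x s) (u' h)" for h
  proof -
    have "Dw (x s) (x' h) (u s) = (\<Sum>i\<in>Basis. (u s \<bullet> i) * Dw (x s) (x' h) i)"
      by (subst (1) euclidean_representation[of "u s", symmetric])
        (simp add: linear_sum[OF bilinear_linear_right[OF Dw_bilinear[OF xs]]] Dw_simps[OF xs])
    then show ?thesis using w_expand[OF xs, of "u' h"] by (simp add: sum.distrib)
  qed
  ultimately show ?thesis by simp
qed

lemma has_vector_derivative_w:
  fixes x u :: "real \<Rightarrow> 'a"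
  assumes x: "(x has_vector_derivative x') (at s within S)" "x ` S \<subseteq> U" "s \<in> S"
    and u: "(u has_vector_derivative u') (at s within S)"
  shows "((\<lambda>s. w (x s) (u s)) has_real_derivative (Dw (x s) x' (u s) + w (x s) u')) (at s within S)"
proof -
  have xs: "x s \<in> U" using x by auto
  show ?thesis
    unfolding has_field_derivative_def
    by (rule has_derivative_eq_rhs[OF has_derivative_w[OF x(1)[unfolded has_vector_derivative_def] x(2,3)
            u[unfolded has_vector_derivative_def]]])
      (auto simp: Dw_simps[OF xs] linear_scale[OF linear_w[OF xs]] algebra_simps)
qed

end

section \<open>The first variation of the length\<close>

text \<open>
  The mean value theorem along the segment, together with uniform continuity of the gradient on a compact neighbourhood of
  \<open>K\<close>. The first variation needs a remainder that is uniform along a whole curve.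
\<close>

lemma uniform_differentiability:
  fixes f :: "'c::euclidean_space \<Rightarrow> real"
  assumes O: "open O'" and K: "compact K" "K \<subseteq> O'"
    and f: "\<And>z. z \<in> O' \<Longrightarrow> (f has_derivative D z) (at z)"
    and D: "\<And>b. b \<in> Basis \<Longrightarrow> continuous_on O' (\<lambda>z. D z b)" and e: "e > 0"
  obtains \<rho> where "\<rho> > 0"
    "\<And>z d. z \<in> K \<Longrightarrow> norm d < \<rho> \<Longrightarrow> z + d \<in> O' \<and> \<bar>f (z + d) - f z - D z d\<bar> \<le> e * norm d"
proof -
  define grad where "grad z = (\<Sum>b\<in>Basis. D z b *\<^sub>R b)" for z
  have grad: "D z d = grad z \<bullet> d" if "z \<in> O'" for z d
  proof -
    have l: "linear (D z)" using f[OF that] has_derivative_linear by blast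
    have "D z d = D z (\<Sum>b\<in>Basis. (d \<bullet> b) *\<^sub>R b)" by (simp add: euclidean_representation)
    also have "\<dots> = (\<Sum>b\<in>Basis. (d \<bullet> b) * D z b)" by (simp add: linear_sum[OF l] linear_scale[OF l])
    also have "\<dots> = grad z \<bullet> d" unfolding grad_def inner_sum_left
      by (rule sum.cong) (simp_all add: inner_commute)
    finally show ?thesis .
  qed
  have gc: "continuous_on O' grad" unfolding grad_def by (intro continuous_intros D)
  obtain \<epsilon> where \<epsilon>: "\<epsilon> > 0" "(\<Union>x\<in>K. cball x \<epsilon>) \<subseteq> O'"
    using compact_subset_open_imp_cball_epsilon_subset[OF K(1) O K(2)] by blast
  define K' where "K' = {x + y |x y. x \<in> K \<and> y \<in> cball 0 \<epsilon>}"
  have K': "compact K'" unfolding K'_def by (intro compact_sums K compact_cball)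
  have inK': "z + d \<in> K'" if "z \<in> K" "norm d \<le> \<epsilon>" for z d
    unfolding K'_def using that by auto
  have K'O: "K' \<subseteq> O'"
  proof
    fix p assume "p \<in> K'"
    then obtain x y where "p = x + y" "x \<in> K" "norm y \<le> \<epsilon>" by (auto simp: K'_def)
    then have "p \<in> cball x \<epsilon>" by (simp add: dist_norm)
    then show "p \<in> O'" using \<epsilon>(2) \<open>x \<in> K\<close> by blast
  qed
  have "uniformly_continuous_on K' grad"
    by (intro compact_uniformly_continuous K' continuous_on_subset[OF gc K'O])
  then obtain \<delta> where \<delta>: "\<delta> > 0" "\<And>x x'. x \<in> K' \<Longrightarrow> x' \<in> K' \<Longrightarrow> dist x' x < \<delta> \<Longrightarrow> dist (grad x') (grad x) < e"
    using e unfolding uniformly_continuous_on_def by meson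
  show ?thesis
  proof (rule that[of "min \<epsilon> \<delta>"])
    show "min \<epsilon> \<delta> > 0" using \<epsilon> \<delta> by simp
    fix z d :: 'c assume z: "z \<in> K" and d: "norm d < min \<epsilon> \<delta>"
    have seg: "z + t *\<^sub>R d \<in> K'" if "t \<in> {0..1}" for t
    proof (rule inK'[OF z])
      have "\<bar>t\<bar> * norm d \<le> 1 * norm d" using that by (intro mult_right_mono) auto
      then show "norm (t *\<^sub>R d) \<le> \<epsilon>" using d by simp
    qed
    have der: "((\<lambda>t. f (z + t *\<^sub>R d)) has_derivative (\<lambda>h. D (z + t *\<^sub>R d) (h *\<^sub>R d))) (at t within {0..1})"
      if "0 \<le> t" "t \<le> 1" for t
    proof (rule has_derivative_compose[of "\<lambda>t. z + t *\<^sub>R d"])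
      show "((\<lambda>t. z + t *\<^sub>R d) has_derivative (\<lambda>h. h *\<^sub>R d)) (at t within {0..1})"
        by (auto intro!: derivative_eq_intros)
      show "(f has_derivative D (z + t *\<^sub>R d)) (at (z + t *\<^sub>R d))"
        by (rule f) (use seg that K'O in auto)
    qed
    obtain \<theta> where \<theta>: "\<theta> \<in> {0..1}" "f (z + 1 *\<^sub>R d) - f (z + 0 *\<^sub>R d) = D (z + \<theta> *\<^sub>R d) ((1 - 0) *\<^sub>R d)"
      using mvt_very_simple[OF zero_le_one der] by blast
    have in1: "z + \<theta> *\<^sub>R d \<in> K'" "z \<in> K'" using seg[OF \<theta>(1)] seg[of 0] by auto
    have "f (z + d) - f z - D z d = (grad (z + \<theta> *\<^sub>R d) - grad z) \<bullet> d"
      using \<theta>(2) in1 K'O by (simp add: grad inner_diff_left subset_iff)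
    also have "\<bar>\<dots>\<bar> \<le> norm (grad (z + \<theta> *\<^sub>R d) - grad z) * norm d" by (rule Cauchy_Schwarz_ineq2)
    also have "\<dots> \<le> e * norm d"
    proof (rule mult_right_mono)
      have "\<bar>\<theta>\<bar> * norm d \<le> 1 * norm d" using \<theta>(1) by (intro mult_right_mono) auto
      then have "dist (z + \<theta> *\<^sub>R d) z < \<delta>" using d by (simp add: dist_norm)
      then show "norm (grad (z + \<theta> *\<^sub>R d) - grad z) \<le> e"
        using \<delta>(2)[OF in1(2,1)] by (simp add: dist_norm)
    qed simp
    finally have "\<bar>f (z + d) - f z - D z d\<bar> \<le> e * norm d" .
    then show "z + d \<in> O' \<and> \<bar>f (z + d) - f z - D z d\<bar> \<le> e * norm d"
      using seg[of 1] K'O by auto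
  qed
qed

locale chart_randers = chart_metric U G + chart_form U w for U :: "'a::euclidean_space set" and G w
begin

text \<open>
  The Lagrangian of the length, as a function of position and velocity.
\<close>

definition lag :: "'a \<Rightarrow> 'a \<Rightarrow> real" where
  "lag y u = sqrt (G y u u) + w y u"

text \<open>
  The skew endomorphism \<open>J\<close> obtained from the exterior derivative by raising an index; it bends geodesics as a magnetic
  field bends the path of a charge.
\<close>

definition gyro :: "'a \<Rightarrow> 'a \<Rightarrow> 'a" where
  "gyro y u = raise (G y) (\<lambda>v. dext y v u)"

definition spray :: "'a \<Rightarrow> 'a \<Rightarrow> 'a" where
  "spray y u = sqrt (G y u u) *\<^sub>R gyro y u - christoffel y u u"

text \<open>
  The Euler-Lagrange expression of the length at a curve with position \<open>y\<close>, velocity \<open>u\<close> and acceleration \<open>a\<close>,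
  as a vector and up to the factor \<open>- sqrt (G y u u)\<close>. The last term makes it orthogonal to \<open>u\<close>, which reflects
  that length does not depend on the parametrization; the numerator \<open>G y (a + \<Gamma>(u, u)) u\<close> is half the
  derivative of \<open>G x' x'\<close>, so the term is absent for constant speed.
\<close>

definition euler_lagrange :: "'a \<Rightarrow> 'a \<Rightarrow> 'a \<Rightarrow> 'a" where
  "euler_lagrange y u a = a - spray y u - (G y (a + christoffel y u u) u / G y u u) *\<^sub>R u"

text \<open>
  The derivative of \<open>lag\<close> at \<open>(y, u)\<close> in direction \<open>(k, v)\<close>.
\<close>

definition Dlag :: "'a \<Rightarrow> 'a \<Rightarrow> 'a \<Rightarrow> 'a \<Rightarrow> real" where
  "Dlag y u k v = (DG y k u u + 2 * G y u v) / (2 * sqrt (G y u u)) + (Dw y k u + w y v)"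

lemma dext_linear: "y \<in> U \<Longrightarrow> linear (\<lambda>v. dext y v u)"
  unfolding dext_def by (rule linearI) (simp_all add: Dw_simps algebra_simps)

lemma G_gyro: "y \<in> U \<Longrightarrow> G y (gyro y u) v = dext y v u"
  unfolding gyro_def by (rule raise[OF scalar_product dext_linear])

lemma gyro_linear: "y \<in> U \<Longrightarrow> linear (gyro y)"
proof (rule linearI)
  fix u v :: 'a and c :: real assume y: "y \<in> U"
  note c = scalar_product_cancel[OF scalar_product[OF y]]
  show "gyro y (u + v) = gyro y u + gyro y v" "gyro y (c *\<^sub>R u) = c *\<^sub>R gyro y u"
    by (rule c, simp add: G_simps[OF y] G_gyro[OF y], simp add: dext_def Dw_simps[OF y] algebra_simps)+
qed

lemma G_gyro_self: "y \<in> U \<Longrightarrow> G y (gyro y u) u = 0"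
  by (simp add: G_gyro dext_def)

lemma continuous_on_gyro:
  assumes "continuous_on S x" "x ` S \<subseteq> U" "continuous_on S u"
  shows "continuous_on S (\<lambda>s. gyro (x s) (u s))"
  unfolding gyro_def
  by (rule continuous_on_raise[OF assms(1,2)])
    (use assms in \<open>auto intro!: dext_linear continuous_intros continuous_on_dext\<close>)

lemma continuous_on_spray:
  assumes "continuous_on S x" "x ` S \<subseteq> U" "continuous_on S u"
  shows "continuous_on S (\<lambda>s. spray (x s) (u s))"
  unfolding spray_def
  by (intro continuous_intros continuous_on_gyro continuous_on_christoffel continuous_on_G assms)

lemma lag_derivative:
  assumes y: "y \<in> U" and u: "u \<noteq> 0"
  shows "((\<lambda>z. lag (fst z) (snd z)) has_derivative (\<lambda>z. Dlag y u (fst z) (snd z))) (at (y, u))"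
proof -
  have o: "open (U \<times> (UNIV :: 'a set))" using open_U by (intro open_Times) auto
  have at: "at (y, u) within (U \<times> UNIV) = at (y, u)" using o y by (intro at_within_open) auto
  have "((\<lambda>z. G (fst z) (snd z) (snd z)) has_derivative
     (\<lambda>z. DG (fst (y, u)) (fst z) (snd (y, u)) (snd (y, u)) + G (fst (y, u)) (snd z) (snd (y, u)) + G (fst (y, u)) (snd (y, u)) (snd z)))
     (at (y, u) within (U \<times> UNIV))"
    by (rule has_derivative_G) (use y in \<open>auto intro!: derivative_eq_intros\<close>)
  then have Gd: "((\<lambda>z. G (fst z) (snd z) (snd z)) has_derivative
     (\<lambda>z. DG y (fst z) u u + 2 * G y u (snd z))) (at (y, u))"
    unfolding at by (rule has_derivative_eq_rhs) (simp add: fun_eq_iff G_sym[OF y, of _ u])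
  have "((\<lambda>z. w (fst z) (snd z)) has_derivative (\<lambda>z. Dw (fst (y, u)) (fst z) (snd (y, u)) + w (fst (y, u)) (snd z)))
     (at (y, u) within (U \<times> UNIV))"
    by (rule has_derivative_w) (use y in \<open>auto intro!: derivative_eq_intros\<close>)
  then have wd: "((\<lambda>z. w (fst z) (snd z)) has_derivative (\<lambda>z. Dw y (fst z) u + w y (snd z))) (at (y, u))"
    by (simp add: at)
  have "0 < G (fst (y, u)) (snd (y, u)) (snd (y, u))" using G_pos[OF y u] by simp
  from has_derivative_add[OF has_derivative_real_sqrt[OF this Gd] wd]
  show ?thesis
    unfolding lag_def Dlag_def by (rule has_derivative_eq_rhs) (auto simp: fun_eq_iff field_simps)
qed

lemma Dlag_continuous:
  assumes "continuous_on S x" "x ` S \<subseteq> U" "continuous_on S u" "0 \<notin> u ` S" "continuous_on S k" "continuous_on S v"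
  shows "continuous_on S (\<lambda>s. Dlag (x s) (u s) (k s) (v s))"
proof -
  have "sqrt (G (x s) (u s) (u s)) \<noteq> 0" if "s \<in> S" for s
  proof -
    have "x s \<in> U" "u s \<noteq> 0" using assms that by auto
    then show ?thesis using G_pos by fastforce
  qed
  then show ?thesis unfolding Dlag_def
    by (intro continuous_intros continuous_on_G continuous_on_DG continuous_on_w continuous_on_Dw assms) auto
qed

lemma lag_continuous:
  assumes "continuous_on S x" "x ` S \<subseteq> U" "continuous_on S u"
  shows "continuous_on S (\<lambda>s. lag (x s) (u s))"
  unfolding lag_def by (intro continuous_intros continuous_on_G continuous_on_w assms)

text \<open>
  Integration by parts in differential form: the derivative of the momentum applied to a variation field \<open>d\<close> is the first-order change
  of \<open>lag\<close> plus the Euler-Lagrange term. Integrated over the curve, the left-hand side contributes only boundary terms.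
\<close>

lemma momentum_derivative:
  assumes x: "(x has_vector_derivative x' t) (at t within S)" "x ` S \<subseteq> U" "t \<in> S"
    and x': "(x' has_vector_derivative a) (at t within S)" "x' t \<noteq> 0"
    and d: "(d has_vector_derivative d') (at t within S)"
  shows "((\<lambda>t. G (x t) (x' t) (d t) / sqrt (G (x t) (x' t) (x' t)) + w (x t) (d t)) has_real_derivative
    Dlag (x t) (x' t) (d t) d' + G (x t) (euler_lagrange (x t) (x' t) a) (d t) / sqrt (G (x t) (x' t) (x' t))) (at t within S)"
proof -
  have xt: "x t \<in> U" using x by auto
  define q where "q = G (x t) (x' t) (x' t)"
  define r where "r = sqrt q"
  have q: "q > 0" unfolding q_def by (rule G_pos[OF xt x'(2)])
  have r: "r > 0" "q = r * r" using q by (auto simp: r_def)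
  have 1: "((\<lambda>t. G (x t) (x' t) (d t)) has_real_derivative DG (x t) (x' t) (x' t) (d t) + G (x t) a (d t) + G (x t) (x' t) d') (at t within S)"
    by (rule has_vector_derivative_G[OF x x'(1) d])
  have 2: "((\<lambda>t. G (x t) (x' t) (x' t)) has_real_derivative DG (x t) (x' t) (x' t) (x' t) + G (x t) a (x' t) + G (x t) (x' t) a) (at t within S)"
    by (rule has_vector_derivative_G[OF x x'(1) x'(1)])
  have 3: "((\<lambda>t. w (x t) (d t)) has_real_derivative Dw (x t) (x' t) (d t) + w (x t) d') (at t within S)"
    by (rule has_vector_derivative_w[OF x d])
  have 4: "((\<lambda>t. sqrt (G (x t) (x' t) (x' t))) has_real_derivative
      (DG (x t) (x' t) (x' t) (x' t) + 2 * G (x t) a (x' t)) / (2 * r)) (at t within S)"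
    using DERIV_chain'[OF 2 DERIV_real_sqrt[of "G (x t) (x' t) (x' t)"]] q G_sym[OF xt, of "x' t" a]
    by (simp add: q_def[symmetric] r_def[symmetric] field_simps)
  have "sqrt (G (x t) (x' t) (x' t)) \<noteq> 0" using r by (simp add: r_def q_def)
  note 5 = DERIV_add[OF DERIV_divide[OF 1 4 this] 3]
  have E: "G (x t) (euler_lagrange (x t) (x' t) a) (d t)
     = G (x t) a (d t) - r * dext (x t) (d t) (x' t) + (DG (x t) (x' t) (x' t) (d t) - DG (x t) (d t) (x' t) (x' t) / 2)
       - (G (x t) a (x' t) + DG (x t) (x' t) (x' t) (x' t) / 2) / q * G (x t) (x' t) (d t)"
    unfolding euler_lagrange_def spray_def
    by (simp add: G_simps[OF xt] G_gyro[OF xt] G_christoffel[OF xt] q_def[symmetric] r_def[symmetric]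
        add_divide_distrib diff_divide_distrib)
  show ?thesis
  proof (rule DERIV_cong[OF 5])
    \<comment> \<open>With \<open>r\<close> the speed and \<open>q = r\<^sup>2\<close>, the letters stand for the derivatives of \<open>G\<close> (\<open>A, K, Q\<close>) and of the form (\<open>W1, W3\<close>),
      for \<open>G\<close> at the acceleration (\<open>B, N\<close>), for \<open>G\<close> and the form at \<open>d'\<close> (\<open>C, W2\<close>), and \<open>g\<close> is \<open>G x' d\<close>.\<close>
    have algebra: "((A + B + C) * r - g * ((Q + 2 * N) / (2 * r))) / (r * r) + (W1 + W2)
      = (K + 2 * C) / (2 * r) + (W3 + W2) + (B - r * (W3 - W1) + (A - K / 2) - (N + Q / 2) / q * g) / r"
      for A B C g Q N K W1 W2 W3 :: real
    proof -
      have rr: "r \<noteq> 0" using r by simp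
      have f1: "((A + B + C) * r - g * ((Q + 2 * N) / (2 * r))) / (r * r) = (A + B + C) / r - g * ((Q + 2 * N) / (2 * r)) / (r * r)"
        using rr by (simp add: diff_divide_distrib)
      have f2: "g * ((Q + 2 * N) / (2 * r)) / (r * r) = (N + Q / 2) / q * g / r"
      proof -
        have "(Q + 2 * N) / (2 * r) = (N + Q / 2) / r" by (simp add: add_divide_distrib)
        moreover have "g * (Z / r) / (r * r) = Z / (r * r) * g / r" for Z by (simp add: mult_ac)
        ultimately show ?thesis by (simp only: r(2))
      qed
      have f3: "(K + 2 * C) / (2 * r) = K / 2 / r + C / r"
        by (simp add: add_divide_distrib)
      have f4: "(B - r * V + (A - K / 2) - P) / r = B / r - V + A / r - K / 2 / r - P / r" for V P
        using rr by (simp add: add_divide_distrib diff_divide_distrib)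
      have f5: "(A + B + C) / r = A / r + B / r + C / r" by (simp add: add_divide_distrib)
      have lin: "a1 + a2 + a3 - a4 + (W1 + W2) = a5 + a3 + (W3 + W2) + (a2 - (W3 - W1) + a1 - a5 - a4)"
        for a1 a2 a3 a4 a5 :: real by simp
      show ?thesis unfolding f1 f2 f3 f4 f5 by (rule lin)
    qed
    show "((DG (x t) (x' t) (x' t) (d t) + G (x t) a (d t) + G (x t) (x' t) d') * sqrt (G (x t) (x' t) (x' t)) -
        G (x t) (x' t) (d t) * ((DG (x t) (x' t) (x' t) (x' t) + 2 * G (x t) a (x' t)) / (2 * r))) /
        (sqrt (G (x t) (x' t) (x' t)) * sqrt (G (x t) (x' t) (x' t))) + (Dw (x t) (x' t) (d t) + w (x t) d')
      = Dlag (x t) (x' t) (d t) d' + G (x t) (euler_lagrange (x t) (x' t) a) (d t) / sqrt (G (x t) (x' t) (x' t))"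
      unfolding E Dlag_def dext_def q_def[symmetric] r_def[symmetric] by (rule algebra)
  qed
qed

text \<open>
  The variation enters only through the bounds \<open>|h s - x| \<le> C |s|\<close> and \<open>|h' s - x'| \<le> C |s|\<close>. The length
  is expanded to first order in \<open>(h s - x, h' s - x')\<close> with an error \<open>o(s)\<close> uniform in \<open>t\<close>, and
  the linear term is integrated by parts at each fixed \<open>s\<close>, where the momentum contributes boundary terms that vanish.
\<close>

theorem first_variation:
  fixes x x' x'' :: "real \<Rightarrow> 'a" and h h' :: "real \<Rightarrow> real \<Rightarrow> 'a"
  assumes ab: "a < b"
    and x: "\<And>t. t \<in> {a..b} \<Longrightarrow> (x has_vector_derivative x' t) (at t within {a..b})" "x ` {a..b} \<subseteq> U"
    and x': "\<And>t. t \<in> {a..b} \<Longrightarrow> (x' has_vector_derivative x'' t) (at t within {a..b})" "0 \<notin> x' ` {a..b}"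
    and x'': "continuous_on {a..b} x''"
    and s0: "s0 > 0"
    and h: "\<And>s t. \<bar>s\<bar> < s0 \<Longrightarrow> t \<in> {a..b} \<Longrightarrow> (h s has_vector_derivative h' s t) (at t within {a..b})"
      "\<And>s. \<bar>s\<bar> < s0 \<Longrightarrow> continuous_on {a..b} (h' s)"
      "\<And>s t. \<bar>s\<bar> < s0 \<Longrightarrow> t \<in> {a..b} \<Longrightarrow> norm (h s t - x t) \<le> C * \<bar>s\<bar>"
      "\<And>s t. \<bar>s\<bar> < s0 \<Longrightarrow> t \<in> {a..b} \<Longrightarrow> norm (h' s t - x' t) \<le> C * \<bar>s\<bar>"
      "\<And>s. \<bar>s\<bar> < s0 \<Longrightarrow> h s a = x a" "\<And>s. \<bar>s\<bar> < s0 \<Longrightarrow> h s b = x b"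
  shows "((\<lambda>s. integral {a..b} (\<lambda>t. lag (h s t) (h' s t)) +
      integral {a..b} (\<lambda>t. G (x t) (euler_lagrange (x t) (x' t) (x'' t)) (h s t - x t) / sqrt (G (x t) (x' t) (x' t))))
    has_real_derivative 0) (at 0)"
proof -
  let ?I = "{a..b}"
  let ?O = "U \<times> - {0 :: 'a}"
  define E where "E t v = G (x t) (euler_lagrange (x t) (x' t) (x'' t)) v / sqrt (G (x t) (x' t) (x' t))" for t v
  define L where "L s = integral ?I (\<lambda>t. lag (h s t) (h' s t)) + integral ?I (\<lambda>t. E t (h s t - x t))" for s
  have oO: "open ?O" using open_U by (intro open_Times) auto
  have xc: "continuous_on ?I x" and x'c: "continuous_on ?I x'"
    by (rule continuous_on_vector_derivative[OF x(1)], assumption, rule continuous_on_vector_derivative[OF x'(1)], assumption)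
  have xU: "x t \<in> U" and x'0: "x' t \<noteq> 0" if "t \<in> ?I" for t using x(2) x'(2) that by auto
  have sq0: "sqrt (G (x t) (x' t) (x' t)) \<noteq> 0" if "t \<in> ?I" for t
    using G_pos[OF xU[OF that] x'0[OF that]] by simp
  define K where "K = (\<lambda>t. (x t, x' t)) ` ?I"
  have K: "compact K" "K \<subseteq> ?O" unfolding K_def
    using xU x'0 by (auto intro!: compact_continuous_image continuous_intros xc x'c)
  have C: "0 \<le> C"
  proof -
    have "0 \<le> C * \<bar>s0 / 2\<bar>" by (rule order_trans[OF norm_ge_zero h(3)[of "s0 / 2" a]]) (use s0 ab in auto)
    then show ?thesis using s0 by (simp add: zero_le_mult_iff)
  qed
  have h0: "h 0 t = x t" "h' 0 t = x' t" if "t \<in> ?I" for t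
    using h(3)[of 0 t] h(4)[of 0 t] s0 that by auto
  have L0: "L 0 = integral ?I (\<lambda>t. lag (x t) (x' t))"
  proof -
    have "integral ?I (\<lambda>t. lag (h 0 t) (h' 0 t)) = integral ?I (\<lambda>t. lag (x t) (x' t))"
      by (rule integral_cong) (simp add: h0)
    moreover have "integral ?I (\<lambda>t. E t (h 0 t - x t)) = integral ?I (\<lambda>t. 0)"
      by (rule integral_cong) (simp add: h0 E_def G_simps[OF xU])
    ultimately show ?thesis by (simp add: L_def)
  qed
  have "\<exists>d>0. \<forall>s. norm (s - 0) < d \<longrightarrow> norm (L s - L 0 - 0 * (s - 0)) \<le> e * norm (s - 0)" if e: "e > 0" for e
  proof -
    \<comment> \<open>The pair of deviations has norm at most \<open>2 C |s|\<close>; the summand 1 keeps the denominators positive.\<close>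
    define e' where "e' = e / ((b - a) * (2 * C + 1))"
    have e': "e' > 0" using e ab C by (simp add: e'_def)
    obtain \<rho> where \<rho>: "\<rho> > 0"
      "\<And>z d. z \<in> K \<Longrightarrow> norm d < \<rho> \<Longrightarrow> z + d \<in> ?O \<and>
        \<bar>lag (fst (z + d)) (snd (z + d)) - lag (fst z) (snd z) - Dlag (fst z) (snd z) (fst d) (snd d)\<bar> \<le> e' * norm d"
    proof (rule uniform_differentiability[OF oO K, of "\<lambda>z. lag (fst z) (snd z)" "\<lambda>z d. Dlag (fst z) (snd z) (fst d) (snd d)" e'])
      show "((\<lambda>z. lag (fst z) (snd z)) has_derivative (\<lambda>d. Dlag (fst z) (snd z) (fst d) (snd d))) (at z)" if "z \<in> ?O" for z
        using lag_derivative[of "fst z" "snd z"] that by (simp add: mem_Times_iff)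
      show "continuous_on ?O (\<lambda>z. Dlag (fst z) (snd z) (fst b) (snd b))" for b :: "'a \<times> 'a"
        by (rule Dlag_continuous) (auto intro!: continuous_intros)
    qed (use e' in auto)
    define \<sigma> where "\<sigma> = min s0 (\<rho> / (2 * C + 1))"
    have \<sigma>: "\<sigma> > 0" using s0 \<rho> C by (simp add: \<sigma>_def)
    show ?thesis
    proof (intro exI conjI allI impI)
      show "\<sigma> > 0" by (rule \<sigma>)
      fix s :: real assume "norm (s - 0) < \<sigma>"
      then have s: "\<bar>s\<bar> < s0" "\<bar>s\<bar> * (2 * C + 1) < \<rho>"
        using C by (auto simp: \<sigma>_def field_simps)
      define \<delta> where "\<delta> t = h s t - x t" for t
      define \<delta>' where "\<delta>' t = h' s t - x' t" for t
      have nd: "norm (\<delta> t, \<delta>' t) \<le> \<bar>s\<bar> * (2 * C)" if "t \<in> ?I" for t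
      proof -
        have "norm (\<delta> t, \<delta>' t) \<le> norm (\<delta> t) + norm (\<delta>' t)"
          by (rule norm_Pair_le)
        also have "\<dots> \<le> C * \<bar>s\<bar> + C * \<bar>s\<bar>"
          unfolding \<delta>_def \<delta>'_def by (intro add_mono h(3,4) s that)
        finally show ?thesis by (simp add: algebra_simps)
      qed
      have small: "norm (\<delta> t, \<delta>' t) < \<rho>" if "t \<in> ?I" for t
        using nd[OF that] s(2) by (simp add: algebra_simps)
      have hO: "(h s t, h' s t) \<in> ?O"
        and rem: "\<bar>lag (h s t) (h' s t) - lag (x t) (x' t) - Dlag (x t) (x' t) (\<delta> t) (\<delta>' t)\<bar> \<le> e' * (\<bar>s\<bar> * (2 * C))"
        if t: "t \<in> ?I" for t
      proof -
        have zK: "(x t, x' t) \<in> K" using t by (auto simp: K_def)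
        have eq: "(x t, x' t) + (\<delta> t, \<delta>' t) = (h s t, h' s t)" by (simp add: \<delta>_def \<delta>'_def)
        show "(h s t, h' s t) \<in> ?O" using \<rho>(2)[OF zK small[OF t]] eq by metis
        have "\<bar>lag (h s t) (h' s t) - lag (x t) (x' t) - Dlag (x t) (x' t) (\<delta> t) (\<delta>' t)\<bar> \<le> e' * norm (\<delta> t, \<delta>' t)"
          using \<rho>(2)[OF zK small[OF t]] unfolding eq fst_conv snd_conv by blast
        also have "\<dots> \<le> e' * (\<bar>s\<bar> * (2 * C))" using e' nd[OF t] by (intro mult_left_mono) auto
        finally show "\<bar>lag (h s t) (h' s t) - lag (x t) (x' t) - Dlag (x t) (x' t) (\<delta> t) (\<delta>' t)\<bar> \<le> e' * (\<bar>s\<bar> * (2 * C))" .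
      qed
      have hc: "continuous_on ?I (h s)"
        by (rule continuous_on_vector_derivative[OF h(1)[OF s(1)]])
      note h'c = h(2)[OF s(1)]
      have \<delta>c: "continuous_on ?I \<delta>" "continuous_on ?I \<delta>'"
        unfolding \<delta>_def \<delta>'_def by (intro continuous_intros hc h'c xc x'c)+
      have c1: "continuous_on ?I (\<lambda>t. lag (h s t) (h' s t))"
        by (rule lag_continuous[OF hc _ h'c]) (use hO in auto)
      have c2: "continuous_on ?I (\<lambda>t. lag (x t) (x' t))"
        by (rule lag_continuous[OF xc x(2) x'c])
      have c3: "continuous_on ?I (\<lambda>t. Dlag (x t) (x' t) (\<delta> t) (\<delta>' t))"
        by (rule Dlag_continuous[OF xc x(2) x'c x'(2) \<delta>c])
      have c4: "continuous_on ?I (\<lambda>t. E t (\<delta> t))"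
        unfolding E_def euler_lagrange_def
        by (intro continuous_intros continuous_on_G continuous_on_spray continuous_on_christoffel xc x(2) x'c x'' \<delta>c)
          (use sq0 in auto)
      have "((\<lambda>t. Dlag (x t) (x' t) (\<delta> t) (\<delta>' t) + E t (\<delta> t)) has_integral
          (G (x b) (x' b) (\<delta> b) / sqrt (G (x b) (x' b) (x' b)) + w (x b) (\<delta> b)) -
          (G (x a) (x' a) (\<delta> a) / sqrt (G (x a) (x' a) (x' a)) + w (x a) (\<delta> a))) ?I"
      proof (rule fundamental_theorem_of_calculus)
        fix t assume t: "t \<in> ?I"
        have "(\<delta> has_vector_derivative \<delta>' t) (at t within ?I)"
          unfolding \<delta>_def \<delta>'_def by (intro has_vector_derivative_diff h(1) s x(1) t)
        from momentum_derivative[OF x(1)[OF t] x(2) t x'(1)[OF t] x'0[OF t] this]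
        show "((\<lambda>t. G (x t) (x' t) (\<delta> t) / sqrt (G (x t) (x' t) (x' t)) + w (x t) (\<delta> t)) has_vector_derivative
            Dlag (x t) (x' t) (\<delta> t) (\<delta>' t) + E t (\<delta> t)) (at t within ?I)"
          by (simp add: E_def has_real_derivative_iff_has_vector_derivative)
      qed (use ab in simp)
      moreover have "\<delta> a = 0" "\<delta> b = 0" using h(5,6)[OF s(1)] by (simp_all add: \<delta>_def)
      moreover have "x a \<in> U" "x b \<in> U" using ab by (auto intro!: xU)
      ultimately have int0: "integral ?I (\<lambda>t. Dlag (x t) (x' t) (\<delta> t) (\<delta>' t) + E t (\<delta> t)) = 0"
        by (simp add: integral_unique G_simps linear_0[OF linear_w])
      have "L s - L 0 = integral ?I (\<lambda>t. lag (h s t) (h' s t)) + integral ?I (\<lambda>t. E t (\<delta> t))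
          - integral ?I (\<lambda>t. lag (x t) (x' t)) - integral ?I (\<lambda>t. Dlag (x t) (x' t) (\<delta> t) (\<delta>' t) + E t (\<delta> t))"
        unfolding L0 int0 by (simp add: L_def \<delta>_def)
      also have "\<dots> = integral ?I (\<lambda>t. lag (h s t) (h' s t) - lag (x t) (x' t) - Dlag (x t) (x' t) (\<delta> t) (\<delta>' t))"
        using c1 c2 c3 c4 by (simp add: integral_diff integral_add integrable_continuous_real continuous_on_diff)
      finally have eq: "L s - L 0 = integral ?I (\<lambda>t. lag (h s t) (h' s t) - lag (x t) (x' t) - Dlag (x t) (x' t) (\<delta> t) (\<delta>' t))" .
      have "norm (L s - L 0) \<le> e' * (\<bar>s\<bar> * (2 * C)) * (b - a)"
        unfolding eq by (rule integral_bound) (use ab rem c1 c2 c3 in \<open>auto intro!: continuous_intros\<close>)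
      also have "\<dots> \<le> e' * (\<bar>s\<bar> * (2 * C + 1)) * (b - a)"
        using e' ab by (intro mult_right_mono mult_left_mono) auto
      also have "\<dots> = e * \<bar>s\<bar>" using ab C by (simp add: e'_def)
      finally show "norm (L s - L 0 - 0 * (s - 0)) \<le> e * norm (s - 0)" by simp
    qed
  qed
  then have "(L has_derivative (\<lambda>h. 0 * h)) (at 0)"
    unfolding has_derivative_at_alt by (auto intro: bounded_linear_mult_right)
  then have "(L has_real_derivative 0) (at 0)" unfolding has_field_derivative_def .
  then show ?thesis unfolding L_def[abs_def] E_def .
qed

lemma spray_euler_lagrange: "y \<in> U \<Longrightarrow> euler_lagrange y u (spray y u) = 0"
  by (simp add: euler_lagrange_def spray_def G_simps G_gyro_self)

text \<open>
  Peano's theorem for the first-order system of position and velocity. Initial data vary in a neighbourhood with a common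
  existence time and a common quadratic bound on the deviation from the straight line.
\<close>

lemma spray_flow:
  assumes y0: "y0 \<in> U" and u0: "u0 \<noteq> 0"
  obtains r M T where "r > 0" "M > 0" "T > 0"
    "\<And>y u. dist y y0 < r \<Longrightarrow> dist u u0 < r \<Longrightarrow> \<exists>x x'. x 0 = y \<and> x' 0 = u \<and>
      (\<forall>t\<in>{0..T}. (x has_vector_derivative x' t) (at t within {0..T}) \<and>
        (x' has_vector_derivative spray (x t) (x' t)) (at t within {0..T}) \<and>
        x t \<in> U \<and> x' t \<noteq> 0 \<and> norm (x t - y - t *\<^sub>R u) \<le> M * t\<^sup>2)"
proof -
  let ?O = "U \<times> - {0 :: 'a}"
  have "open ?O" using open_U by (intro open_Times) auto
  moreover have "(y0, u0) \<in> ?O" using assms by auto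
  ultimately obtain R where R: "R > 0" "cball (y0, u0) R \<subseteq> ?O"
    using open_contains_cball by blast
  define f where "f z = (snd z, spray (fst z) (snd z))" for z
  have fc: "continuous_on (cball (y0, u0) R) f"
    unfolding f_def by (intro continuous_intros continuous_on_spray) (use R in auto)
  then have "bounded (f ` cball (y0, u0) R)"
    by (intro compact_imp_bounded compact_continuous_image) auto
  then obtain M where M: "M > 0" "\<And>z. z \<in> cball (y0, u0) R \<Longrightarrow> norm (f z) \<le> M"
    unfolding bounded_pos by blast
  \<comment> \<open>Initial data within \<open>r\<close> in each component are within \<open>R / 2\<close> of \<open>(y0, u0)\<close>, and during time \<open>T\<close> the
    solution moves by at most \<open>R / 2\<close>.\<close>
  define r where "r = R / 4"
  define T where "T = R / 2 / M"
  have rT: "r > 0" "T > 0" "T * M \<le> R / 2" using R M by (auto simp: r_def T_def)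
  show ?thesis
  proof (rule that[OF rT(1) M(1) rT(2)])
    fix y u assume yu: "dist y y0 < r" "dist u u0 < r"
    have "dist (y, u) (y0, u0) \<le> dist y y0 + dist u u0"
      unfolding dist_norm using norm_Pair_le[of "y - y0" "u - u0"] by simp
    then have near: "dist (y, u) (y0, u0) \<le> R / 2" using yu by (simp add: r_def)
    have sub: "cball (y, u) (R / 2) \<subseteq> cball (y0, u0) R"
      using near by (intro cball_subset_cball_iff[THEN iffD2]) auto
    obtain z where z: "z 0 = (y, u)" "z ` {0..T} \<subseteq> cball (y, u) (R / 2)"
      and z': "\<And>t. t \<in> {0..T} \<Longrightarrow> (z has_vector_derivative f (z t)) (at t within {0..T})"
      and zM: "\<And>t. t \<in> {0..T} \<Longrightarrow> norm (z t - (y, u)) \<le> M * t"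
    proof (rule peano_existence[of "(y, u)" "R / 2" f M T])
      show "continuous_on (cball (y, u) (R / 2)) f" by (rule continuous_on_subset[OF fc sub])
      show "norm (f p) \<le> M" if "p \<in> cball (y, u) (R / 2)" for p using M(2) sub that by blast
    qed (use rT R in auto)
    define x where "x t = fst (z t)" for t
    define x' where "x' t = snd (z t)" for t
    have xd: "(x has_vector_derivative x' t) (at t within {0..T})"
      and x'd: "(x' has_vector_derivative spray (x t) (x' t)) (at t within {0..T})" if "t \<in> {0..T}" for t
      using bounded_linear.has_vector_derivative[OF bounded_linear_fst z'[OF that]]
        bounded_linear.has_vector_derivative[OF bounded_linear_snd z'[OF that]]
      by (simp_all add: x_def[abs_def] x'_def[abs_def] f_def)
    have xO: "x t \<in> U" "x' t \<noteq> 0" if "t \<in> {0..T}" for t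
    proof -
      have "z t \<in> ?O" using z(2) sub R(2) that by blast
      then show "x t \<in> U" "x' t \<noteq> 0" by (auto simp: x_def x'_def mem_Times_iff)
    qed
    have x'M: "norm (x' t - u) \<le> M * t" if "t \<in> {0..T}" for t
    proof -
      have "z t - (y, u) = (fst (z t) - y, snd (z t) - u)" by (simp add: prod_eq_iff)
      then show ?thesis
        using zM[OF that] norm_snd_le[of "snd (z t) - u" "fst (z t) - y"] by (simp add: x'_def)
    qed
    have xM: "norm (x t - y - t *\<^sub>R u) \<le> M * t\<^sup>2" if t: "t \<in> {0..T}" for t
    proof -
      have "norm ((x t - t *\<^sub>R u) - (x 0 - 0 *\<^sub>R u)) \<le> M * t * norm (t - 0)"
      proof (rule differentiable_bound[of "{0..t}" "\<lambda>s. x s - s *\<^sub>R u" "\<lambda>s h. h *\<^sub>R (x' s - u)"])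
        fix s assume s: "s \<in> {0..t}"
        then have sT: "s \<in> {0..T}" using t by auto
        have "(x has_vector_derivative x' s) (at s within {0..t})"
          by (rule has_vector_derivative_within_subset[OF xd[OF sT]]) (use t in auto)
        then have "((\<lambda>s. x s - s *\<^sub>R u) has_vector_derivative x' s - 1 *\<^sub>R u) (at s within {0..t})"
          by (rule has_vector_derivative_diff) (auto simp: has_vector_derivative_def intro!: derivative_eq_intros)
        then show "((\<lambda>s. x s - s *\<^sub>R u) has_derivative (\<lambda>h. h *\<^sub>R (x' s - u))) (at s within {0..t})"
          by (simp add: has_vector_derivative_def)
        have "norm (x' s - u) \<le> M * t"
          using x'M[OF sT] s M by (meson atLeastAtMost_iff less_imp_le mult_left_mono order_trans)
        then show "onorm (\<lambda>h. h *\<^sub>R (x' s - u)) \<le> M * t"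
          by (intro onorm_le) (simp add: mult.commute mult_left_mono)
      qed (use t in auto)
      then show ?thesis using t by (simp add: x_def z(1) power2_eq_square algebra_simps)
    qed
    show "\<exists>x x'. x 0 = y \<and> x' 0 = u \<and>
      (\<forall>t\<in>{0..T}. (x has_vector_derivative x' t) (at t within {0..T}) \<and>
        (x' has_vector_derivative spray (x t) (x' t)) (at t within {0..T}) \<and>
        x t \<in> U \<and> x' t \<noteq> 0 \<and> norm (x t - y - t *\<^sub>R u) \<le> M * t\<^sup>2)"
      by (rule exI[of _ x], rule exI[of _ x']) (use xd x'd xO xM in \<open>auto simp: x_def x'_def z(1)\<close>)
  qed
qed

end

section \<open>Charts, tangent vectors and curves\<close>

locale manifold =
  fixes X :: "'m topology" and A :: "('m, 'a::euclidean_space) chart set"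
  assumes manifold: "smooth_manifold X A"
begin

lemma chart: "\<kappa> \<in> A \<Longrightarrow> is_chart X \<kappa>"
  using manifold by (simp add: smooth_manifold_def)

lemma open_dom: "\<kappa> \<in> A \<Longrightarrow> openin X (chart_dom \<kappa>)"
  and open_img: "\<kappa> \<in> A \<Longrightarrow> open (chart_img \<kappa>)"
  and chart_homeo: "\<kappa> \<in> A \<Longrightarrow> homeomorphic_map (subtopology X (chart_dom \<kappa>)) (top_of_set (chart_img \<kappa>)) (chart_map \<kappa>)"
  using chart by (auto simp: is_chart_def)

lemma topspace_dom: "\<kappa> \<in> A \<Longrightarrow> topspace (subtopology X (chart_dom \<kappa>)) = chart_dom \<kappa>"
  by (simp add: topspace_subtopology openin_subset[OF open_dom] Int_absorb1)

lemma chart_around: "p \<in> topspace X \<Longrightarrow> \<exists>\<kappa>\<in>A. p \<in> chart_dom \<kappa>"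
  using manifold by (force simp: smooth_manifold_def)

lemma dom_in_topspace: "\<kappa> \<in> A \<Longrightarrow> p \<in> chart_dom \<kappa> \<Longrightarrow> p \<in> topspace X"
  using open_dom openin_subset by blast

lemma chart_inj: "\<kappa> \<in> A \<Longrightarrow> inj_on (chart_map \<kappa>) (chart_dom \<kappa>)"
  using homeomorphic_imp_injective_map[OF chart_homeo] topspace_dom by metis

lemma chart_inv_map: "\<kappa> \<in> A \<Longrightarrow> p \<in> chart_dom \<kappa> \<Longrightarrow> chart_inv \<kappa> (chart_map \<kappa> p) = p"
  using chart_inj by (simp add: inv_into_f_f)

lemma chart_map_inv: "y \<in> chart_img \<kappa> \<Longrightarrow> chart_map \<kappa> (chart_inv \<kappa> y) = y"
  by (rule f_inv_into_f)

lemma chart_inv_dom: "y \<in> chart_img \<kappa> \<Longrightarrow> chart_inv \<kappa> y \<in> chart_dom \<kappa>"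
  by (rule inv_into_into)

lemma chart_continuous:
  assumes \<kappa>: "\<kappa> \<in> A"
  shows "continuous_map (subtopology X (chart_dom \<kappa>)) (top_of_set (chart_img \<kappa>)) (chart_map \<kappa>)"
    and "continuous_map (top_of_set (chart_img \<kappa>)) X (chart_inv \<kappa>)"
proof -
  show "continuous_map (subtopology X (chart_dom \<kappa>)) (top_of_set (chart_img \<kappa>)) (chart_map \<kappa>)"
    by (rule homeomorphic_imp_continuous_map[OF chart_homeo[OF \<kappa>]])
  obtain g where g: "homeomorphic_maps (subtopology X (chart_dom \<kappa>)) (top_of_set (chart_img \<kappa>)) (chart_map \<kappa>) g"
    using chart_homeo[OF \<kappa>] homeomorphic_map_maps by blast
  then have gc: "continuous_map (top_of_set (chart_img \<kappa>)) (subtopology X (chart_dom \<kappa>)) g"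
    and gi: "\<And>p. p \<in> chart_dom \<kappa> \<Longrightarrow> g (chart_map \<kappa> p) = p"
    unfolding homeomorphic_maps_def topspace_dom[OF \<kappa>] by auto
  have "chart_inv \<kappa> y = g y" if "y \<in> chart_img \<kappa>" for y
    using that gi chart_inv_map[OF \<kappa>] by auto
  then have "continuous_map (top_of_set (chart_img \<kappa>)) (subtopology X (chart_dom \<kappa>)) (chart_inv \<kappa>)"
    by (intro continuous_map_eq[OF gc]) auto
  then show "continuous_map (top_of_set (chart_img \<kappa>)) X (chart_inv \<kappa>)"
    by (rule continuous_map_into_fulltopology)
qed

lemma open_chart_image:
  assumes \<kappa>: "\<kappa> \<in> A" and W: "openin X W" "W \<subseteq> chart_dom \<kappa>"
  shows "open (chart_map \<kappa> ` W)"
proof -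
  have "openin (subtopology X (chart_dom \<kappa>)) W"
    using W open_dom[OF \<kappa>] openin_open_subtopology by blast
  then have "openin (top_of_set (chart_img \<kappa>)) (chart_map \<kappa> ` W)"
    using homeomorphic_imp_open_map[OF chart_homeo[OF \<kappa>]] by (simp add: open_map_def)
  then show ?thesis using open_img[OF \<kappa>] openin_open_eq by blast
qed

lemma open_chart_preimage:
  assumes \<kappa>: "\<kappa> \<in> A" and V: "open V"
  shows "openin X {p \<in> chart_dom \<kappa>. chart_map \<kappa> p \<in> V}"
proof -
  have "openin (subtopology X (chart_dom \<kappa>)) {p \<in> topspace (subtopology X (chart_dom \<kappa>)). chart_map \<kappa> p \<in> V}"
    using V continuous_map_into_fulltopology[OF chart_continuous(1)[OF \<kappa>]]
    by (intro openin_continuous_map_preimage[where Y = euclidean]) auto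
  then show ?thesis
    unfolding topspace_dom[OF \<kappa>] openin_open_subtopology[OF open_dom[OF \<kappa>]] by blast
qed

lemma open_overlap: "\<kappa> \<in> A \<Longrightarrow> \<mu> \<in> A \<Longrightarrow> open (chart_map \<kappa> ` (chart_dom \<kappa> \<inter> chart_dom \<mu>))"
  by (rule open_chart_image) (auto intro: openin_Int open_dom)

lemma transition_Ck: "\<kappa> \<in> A \<Longrightarrow> \<mu> \<in> A \<Longrightarrow> Ck_open k (transition \<kappa> \<mu>) (chart_map \<kappa> ` (chart_dom \<kappa> \<inter> chart_dom \<mu>))"
  using manifold by (simp add: smooth_manifold_def)

lemma transition_map: "\<kappa> \<in> A \<Longrightarrow> p \<in> chart_dom \<kappa> \<Longrightarrow> transition \<kappa> \<mu> (chart_map \<kappa> p) = chart_map \<mu> p"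
  by (simp add: transition_def chart_inv_map)

text \<open>
  The matrix that changes coordinates of tangent vectors at \<open>p\<close> from \<open>\<kappa>\<close> to \<open>\<mu>\<close>.
\<close>

definition Dtrans :: "('m, 'a) chart \<Rightarrow> ('m, 'a) chart \<Rightarrow> 'm \<Rightarrow> 'a \<Rightarrow> 'a" where
  "Dtrans \<kappa> \<mu> p = frechet_derivative (transition \<kappa> \<mu>) (at (chart_map \<kappa> p))"

lemma Dtrans:
  assumes "\<kappa> \<in> A" "\<mu> \<in> A" "p \<in> chart_dom \<kappa>" "p \<in> chart_dom \<mu>"
  shows "(transition \<kappa> \<mu> has_derivative Dtrans \<kappa> \<mu> p) (at (chart_map \<kappa> p))"
  unfolding Dtrans_def
  by (rule Ck_open_SucD[OF transition_Ck[OF assms(1,2), of "Suc 0"]]) (use assms in auto)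

lemma Dtrans_linear:
  assumes "\<kappa> \<in> A" "\<mu> \<in> A" "p \<in> chart_dom \<kappa>" "p \<in> chart_dom \<mu>"
  shows "linear (Dtrans \<kappa> \<mu> p)"
  using Dtrans[OF assms] has_derivative_linear by blast

lemma Dtrans_self:
  assumes \<kappa>: "\<kappa> \<in> A" and p: "p \<in> chart_dom \<kappa>"
  shows "Dtrans \<kappa> \<kappa> p u = u"
proof -
  have "(transition \<kappa> \<kappa> has_derivative (\<lambda>u. u)) (at (chart_map \<kappa> p))"
    by (rule has_derivative_transform_within_open[OF has_derivative_ident open_img[OF \<kappa>]])
      (use p \<kappa> in \<open>auto simp: transition_map\<close>)
  then show ?thesis using has_derivative_unique[OF Dtrans[OF \<kappa> \<kappa> p p]] by metis
qed

text \<open>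
  The chain rule for the cocycle of transition maps; it makes \<open>coord_vec\<close> a tangent vector.
\<close>

lemma Dtrans_compose:
  assumes c: "\<kappa> \<in> A" "\<mu> \<in> A" "\<nu> \<in> A" and p: "p \<in> chart_dom \<kappa>" "p \<in> chart_dom \<mu>" "p \<in> chart_dom \<nu>"
  shows "Dtrans \<mu> \<nu> p (Dtrans \<kappa> \<mu> p u) = Dtrans \<kappa> \<nu> p u"
proof -
  let ?W = "chart_dom \<kappa> \<inter> chart_dom \<mu>"
  have "(transition \<mu> \<nu> has_derivative Dtrans \<mu> \<nu> p) (at (transition \<kappa> \<mu> (chart_map \<kappa> p)))"
    using Dtrans[OF c(2,3) p(2,3)] c p by (simp add: transition_map)
  from has_derivative_compose[OF Dtrans[OF c(1,2) p(1,2)] this]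
  have "((\<lambda>y. transition \<mu> \<nu> (transition \<kappa> \<mu> y)) has_derivative (\<lambda>u. Dtrans \<mu> \<nu> p (Dtrans \<kappa> \<mu> p u))) (at (chart_map \<kappa> p))" .
  then have "(transition \<kappa> \<nu> has_derivative (\<lambda>u. Dtrans \<mu> \<nu> p (Dtrans \<kappa> \<mu> p u))) (at (chart_map \<kappa> p))"
    by (rule has_derivative_transform_within_open[OF _ open_overlap[OF c(1,2)]])
      (use c p in \<open>auto simp: transition_map\<close>)
  then show ?thesis using has_derivative_unique[OF Dtrans[OF c(1,3) p(1,3)]] by metis
qed

lemma coord_vec_Dtrans:
  "coord_vec A \<kappa> p u \<mu> = (if \<mu> \<in> A \<and> p \<in> chart_dom \<mu> then Dtrans \<kappa> \<mu> p u else 0)"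
  by (simp add: coord_vec_def Dtrans_def)

lemma coord_vec_tangent:
  assumes "\<kappa> \<in> A" "p \<in> chart_dom \<kappa>"
  shows "coord_vec A \<kappa> p u \<in> tangent_space A p"
  unfolding tangent_space_def
proof (clarify, intro conjI ballI impI allI)
  fix \<mu> \<nu> assume "\<mu> \<in> A" "\<nu> \<in> A" "p \<in> chart_dom \<mu> \<inter> chart_dom \<nu>"
  then show "coord_vec A \<kappa> p u \<nu> = frechet_derivative (transition \<mu> \<nu>) (at (chart_map \<mu> p)) (coord_vec A \<kappa> p u \<mu>)"
    unfolding Dtrans_def[symmetric] using assms by (simp only: coord_vec_Dtrans Dtrans_compose Int_iff simp_thms if_True)
next
  fix \<mu> assume "\<not> (\<mu> \<in> A \<and> p \<in> chart_dom \<mu>)"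
  then show "coord_vec A \<kappa> p u \<mu> = 0" by (simp only: coord_vec_def if_False)
qed

lemma tangent_coord_vec:
  assumes "\<kappa> \<in> A" "p \<in> chart_dom \<kappa>" and \<xi>: "\<xi> \<in> tangent_space A p"
  shows "\<xi> = coord_vec A \<kappa> p (\<xi> \<kappa>)"
proof (rule ext)
  fix \<mu>
  show "\<xi> \<mu> = coord_vec A \<kappa> p (\<xi> \<kappa>) \<mu>"
  proof (cases "\<mu> \<in> A \<and> p \<in> chart_dom \<mu>")
    case True
    have "\<forall>\<kappa>\<in>A. \<forall>\<mu>\<in>A. p \<in> chart_dom \<kappa> \<inter> chart_dom \<mu> \<longrightarrow>
        \<xi> \<mu> = frechet_derivative (transition \<kappa> \<mu>) (at (chart_map \<kappa> p)) (\<xi> \<kappa>)"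
      using \<xi> unfolding tangent_space_def mem_Collect_eq by (rule conjunct1)
    then have "\<xi> \<mu> = frechet_derivative (transition \<kappa> \<mu>) (at (chart_map \<kappa> p)) (\<xi> \<kappa>)"
      using True assms(1,2) by blast
    then show ?thesis using True by (simp only: coord_vec_def if_True simp_thms)
  next
    case False
    then have "\<xi> \<mu> = 0" using \<xi> unfolding tangent_space_def by blast
    then show ?thesis using False by (simp only: coord_vec_def if_False)
  qed
qed

text \<open>
  Near \<open>t\<close> the representation of the curve in any other chart is that in \<open>\<kappa>\<close> followed by a transition map, so the chain rule gives all
  components of the velocity from one. At an isolated point of \<open>I\<close> every vector would be a derivative, whence the condition on
  \<open>at t within I\<close>.
\<close>

lemma velocity_coord_vec:
  assumes \<kappa>: "\<kappa> \<in> A" and c: "continuous_map (top_of_set I) X c" and t: "t \<in> I" "c t \<in> chart_dom \<kappa>"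
    and nt: "at t within I \<noteq> bot"
    and v: "((\<lambda>t. chart_map \<kappa> (c t)) has_vector_derivative v) (at t within I)"
  shows "velocity A I c t = coord_vec A \<kappa> (c t) v"
proof (rule ext)
  fix \<mu>
  show "velocity A I c t \<mu> = coord_vec A \<kappa> (c t) v \<mu>"
  proof (cases "\<mu> \<in> A \<and> c t \<in> chart_dom \<mu>")
    case True
    let ?W = "chart_dom \<kappa> \<inter> chart_dom \<mu>"
    have "openin X ?W" using True \<kappa> by (intro openin_Int open_dom) auto
    then have "openin (top_of_set I) {s \<in> I. c s \<in> ?W}"
      using openin_continuous_map_preimage[OF c] by (simp del: Int_iff)
    then obtain V where V: "open V" "{s \<in> I. c s \<in> ?W} = I \<inter> V" by (auto simp: openin_open)
    have tV: "t \<in> V" using V(2) t True by auto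
    have "(transition \<kappa> \<mu> has_derivative Dtrans \<kappa> \<mu> (c t)) (at (chart_map \<kappa> (c t)))"
      by (rule Dtrans) (use \<kappa> True t in auto)
    from has_derivative_compose[OF v[unfolded has_vector_derivative_def] this]
    have "((\<lambda>s. transition \<kappa> \<mu> (chart_map \<kappa> (c s))) has_derivative (\<lambda>h. Dtrans \<kappa> \<mu> (c t) (h *\<^sub>R v))) (at t within I)" .
    moreover have "Dtrans \<kappa> \<mu> (c t) (h *\<^sub>R v) = h *\<^sub>R Dtrans \<kappa> \<mu> (c t) v" for h
      by (rule linear_scale[OF Dtrans_linear]) (use \<kappa> True t in auto)
    ultimately have "((\<lambda>s. transition \<kappa> \<mu> (chart_map \<kappa> (c s))) has_vector_derivative Dtrans \<kappa> \<mu> (c t) v) (at t within I)"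
      by (simp add: has_vector_derivative_def)
    moreover have "\<forall>\<^sub>F s in at t within I. transition \<kappa> \<mu> (chart_map \<kappa> (c s)) = chart_map \<mu> (c s)"
    proof -
      have "\<forall>\<^sub>F s in at t within I. s \<in> V \<and> s \<in> I"
        using V(1) tV by (auto simp: eventually_at_topological)
      then show ?thesis
      proof (rule eventually_mono)
        fix s assume "s \<in> V \<and> s \<in> I"
        then have "c s \<in> chart_dom \<kappa>" using V(2) by blast
        then show "transition \<kappa> \<mu> (chart_map \<kappa> (c s)) = chart_map \<mu> (c s)" by (rule transition_map[OF \<kappa>])
      qed
    qed
    ultimately have "((\<lambda>s. chart_map \<mu> (c s)) has_vector_derivative Dtrans \<kappa> \<mu> (c t) v) (at t within I)"
      unfolding has_vector_derivative_def
      by (rule has_derivative_transform_eventually) (use t \<kappa> in \<open>auto simp: transition_map\<close>)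
    then have "vector_derivative (chart_map \<mu> \<circ> c) (at t within I) = Dtrans \<kappa> \<mu> (c t) v"
      using nt by (simp add: o_def vector_derivative_within)
    then show ?thesis using True by (simp add: velocity_def coord_vec_Dtrans)
  qed (auto simp: velocity_def coord_vec_def)
qed

lemma forward_length_in_chart:
  assumes \<kappa>: "\<kappa> \<in> A" and c: "continuous_map (top_of_set {a..b}) X c" and ab: "a < b"
    and dom: "\<And>t. t \<in> {a..b} \<Longrightarrow> c t \<in> chart_dom \<kappa>"
    and v: "\<And>t. t \<in> {a..b} \<Longrightarrow> ((\<lambda>t. chart_map \<kappa> (c t)) has_vector_derivative v t) (at t within {a..b})"
  shows "forward_length A F a b c = integral {a..b} (\<lambda>t. local_rep A \<kappa> F (chart_map \<kappa> (c t)) (v t))"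
  unfolding forward_length_def
proof (rule integral_cong)
  fix t assume t: "t \<in> {a..b}"
  have "at t within {a..b} \<noteq> bot" using t ab by (simp add: trivial_limit_within islimpt_Icc)
  from velocity_coord_vec[OF \<kappa> c t dom[OF t] this v[OF t]]
  show "F (c t) (velocity A {a..b} c t) = local_rep A \<kappa> F (chart_map \<kappa> (c t)) (v t)"
    by (simp add: local_rep_def chart_inv_map[OF \<kappa> dom[OF t]])
qed

text \<open>
  A \<open>C\<^sup>k\<close> map into one chart is \<open>C\<^sup>k\<close> into the manifold, because its other representations are compositions with
  transition maps. It provides curves and variations.
\<close>

lemma Ck_map_chart_inv:
  assumes \<kappa>: "\<kappa> \<in> A" and \<Omega>: "open \<Omega>" "Ck_open k \<Phi> \<Omega>" "\<Phi> ` \<Omega> \<subseteq> chart_img \<kappa>" and S: "S \<subseteq> \<Omega>"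
  shows "Ck_map k X A S (\<lambda>z. chart_inv \<kappa> (\<Phi> z))"
  unfolding Ck_map_def
proof (intro conjI ballI)
  have "continuous_map (top_of_set S) (top_of_set (chart_img \<kappa>)) \<Phi>"
    using continuous_on_subset[OF Ck_open_imp_continuous_on[OF \<Omega>(2)] S] \<Omega>(3) S
    by (auto simp: continuous_map_in_subtopology)
  from continuous_map_compose[OF this chart_continuous(2)[OF \<kappa>]]
  show "continuous_map (top_of_set S) X (\<lambda>z. chart_inv \<kappa> (\<Phi> z))" by (simp add: o_def)
  fix \<mu> assume \<mu>: "\<mu> \<in> A"
  let ?W = "chart_map \<kappa> ` (chart_dom \<kappa> \<inter> chart_dom \<mu>)"
  let ?V = "\<Omega> \<inter> \<Phi> -` ?W"
  have "open ?V"
    by (intro continuous_open_preimage Ck_open_imp_continuous_on[OF \<Omega>(2)] \<Omega>(1) open_overlap \<kappa> \<mu>)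
  moreover have "Ck_open k (\<lambda>z. transition \<kappa> \<mu> (\<Phi> z)) ?V"
    by (rule Ck_open_compose[OF calculation open_overlap[OF \<kappa> \<mu>] _ transition_Ck[OF \<kappa> \<mu>] Ck_open_subset[OF \<Omega>(2)]]) auto
  moreover have "z \<in> ?V" if z: "z \<in> S" "chart_inv \<kappa> (\<Phi> z) \<in> chart_dom \<mu>" for z
  proof -
    have "\<Phi> z \<in> chart_img \<kappa>" "z \<in> \<Omega>" using z S \<Omega>(3) by auto
    then show ?thesis
      using z chart_inv_dom[of "\<Phi> z" \<kappa>] chart_map_inv[of "\<Phi> z" \<kappa>]
      by (auto intro!: image_eqI[of _ _ "chart_inv \<kappa> (\<Phi> z)"])
  qed
  ultimately show "Ck_on k (chart_map \<mu> \<circ> (\<lambda>z. chart_inv \<kappa> (\<Phi> z))) (S \<inter> (\<lambda>z. chart_inv \<kappa> (\<Phi> z)) -` chart_dom \<mu>)"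
    unfolding Ck_on_def
    by (intro ballI exI[of _ ?V] exI[of _ "\<lambda>z. transition \<kappa> \<mu> (\<Phi> z)"]) (auto simp: transition_def)
qed

lemma randers_chart:
  assumes \<kappa>: "\<kappa> \<in> A" and R: "randers_metric A g \<omega>"
  shows "chart_randers (chart_img \<kappa>) (local_rep2 A \<kappa> g) (local_rep A \<kappa> \<omega>)"
    and "local_rep A \<kappa> (randers g \<omega>) = chart_randers.lag (local_rep2 A \<kappa> g) (local_rep A \<kappa> \<omega>)"
proof -
  show cr: "chart_randers (chart_img \<kappa>) (local_rep2 A \<kappa> g) (local_rep A \<kappa> \<omega>)"
  proof (intro chart_randers.intro chart_metric.intro chart_form.intro open_img[OF \<kappa>])
    have rm: "riemannian_metric A g" "one_form A \<omega>" using R by (simp_all add: randers_metric_def)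
    show "scalar_product (local_rep2 A \<kappa> g y)" if "y \<in> chart_img \<kappa>" for y
      using bspec[OF conjunct1[OF bspec[OF rm(1)[unfolded riemannian_metric_def] \<kappa>]] that]
      unfolding scalar_product_def .
    show "Ck_open 2 (\<lambda>y. local_rep2 A \<kappa> g y u v) (chart_img \<kappa>)" for u v
      using conjunct2[OF bspec[OF rm(1)[unfolded riemannian_metric_def] \<kappa>]] by (elim allE)
    show "linear (local_rep A \<kappa> \<omega> y)" if "y \<in> chart_img \<kappa>" for y
      using bspec[OF conjunct1[OF bspec[OF rm(2)[unfolded one_form_def] \<kappa>]] that] .
    show "Ck_open 2 (\<lambda>y. local_rep A \<kappa> \<omega> y u) (chart_img \<kappa>)" for u
      using conjunct2[OF bspec[OF rm(2)[unfolded one_form_def] \<kappa>]] by (elim allE)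
  qed
  show "local_rep A \<kappa> (randers g \<omega>) = chart_randers.lag (local_rep2 A \<kappa> g) (local_rep A \<kappa> \<omega>)"
    by (intro ext) (simp add: chart_randers.lag_def[OF cr] local_rep_def local_rep2_def randers_def)
qed

lemma chart_velocity_nonzero:
  assumes \<kappa>: "\<kappa> \<in> A" "\<mu> \<in> A" "p \<in> chart_dom \<kappa>" "p \<in> chart_dom \<mu>" and u: "u \<noteq> 0"
  shows "coord_vec A \<kappa> p u \<mu> \<noteq> 0"
proof
  assume "coord_vec A \<kappa> p u \<mu> = 0"
  then have "Dtrans \<kappa> \<mu> p u = 0" using \<kappa> by (simp add: coord_vec_Dtrans)
  then have "Dtrans \<mu> \<kappa> p 0 = u" using Dtrans_compose[OF \<kappa>(1,2,1,3,4,3), of u] Dtrans_self[OF \<kappa>(1,3)] by simp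
  then show False using linear_0[OF Dtrans_linear[OF \<kappa>(2,1,4,3)]] u by simp
qed

end

text \<open>
  Mean value inequality with the sum of the norms of the partial derivatives as bound.
\<close>

lemma C1_lipschitz_on_cball:
  fixes f :: "'c::euclidean_space \<Rightarrow> 'd::euclidean_space"
  assumes V: "cball z r \<subseteq> V" and f: "Ck_open (Suc 0) f V"
  obtains C where "C \<ge> 0" "\<And>p q. p \<in> cball z r \<Longrightarrow> q \<in> cball z r \<Longrightarrow> norm (f p - f q) \<le> C * norm (p - q)"
proof -
  define D where "D p = frechet_derivative f (at p)" for p
  have fd: "(f has_derivative D p) (at p)" if "p \<in> cball z r" for p
    unfolding D_def by (rule Ck_open_SucD[OF f]) (use that V in auto)
  have "continuous_on (cball z r) (\<lambda>p. \<Sum>b\<in>Basis. norm (D p b))"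
    unfolding D_def by (intro continuous_intros continuous_on_subset[OF _ V]) (use f in auto)
  then have "bounded ((\<lambda>p. \<Sum>b\<in>Basis. norm (D p b)) ` cball z r)"
    by (intro compact_imp_bounded compact_continuous_image) auto
  then obtain C where C: "C > 0" "\<And>p. p \<in> cball z r \<Longrightarrow> norm (\<Sum>b\<in>Basis. norm (D p b)) \<le> C"
    unfolding bounded_pos by blast
  show ?thesis
  proof (rule that)
    show "C \<ge> 0" using C by simp
    fix p q assume pq: "p \<in> cball z r" "q \<in> cball z r"
    show "norm (f p - f q) \<le> C * norm (p - q)"
    proof (rule differentiable_bound[OF convex_cball _ _ pq])
      fix x assume x: "x \<in> cball z r"
      show "(f has_derivative D x) (at x within cball z r)"
        using fd[OF x] has_derivative_at_withinI by blast
      have l: "linear (D x)" using fd[OF x] has_derivative_linear by blast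
      show "onorm (D x) \<le> C"
      proof (rule onorm_le)
        fix h
        have "D x h = (\<Sum>b\<in>Basis. (h \<bullet> b) *\<^sub>R D x b)"
          by (subst (1) euclidean_representation[of h, symmetric]) (simp add: linear_sum[OF l] linear_scale[OF l])
        also have "norm \<dots> \<le> (\<Sum>b\<in>Basis. norm (D x b) * norm h)"
          by (rule sum_norm_le) (auto simp: mult.commute intro!: mult_right_mono Basis_le_norm)
        also have "\<dots> = (\<Sum>b\<in>Basis. norm (D x b)) * norm h" by (simp add: sum_distrib_right)
        also have "\<dots> \<le> C * norm h" using C(2)[OF x] by (intro mult_right_mono) auto
        finally show "norm (D x h) \<le> C * norm h" .
      qed
    qed
  qed
qed

context manifold
begin

text \<open>
  Near \<open>(0, t0)\<close> the variation is the restriction of a \<open>C\<^sup>2\<close> map \<open>k\<close> on an open set. On a small ball both \<open>k\<close> and its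
  partial derivative \<open>k2\<close> in \<open>t\<close> are Lipschitz, which bounds the deviations by a multiple of \<open>|s|\<close>.
\<close>

lemma variation_in_chart_near:
  assumes \<kappa>: "\<kappa> \<in> A" and ab: "a < b" and V: "variation X A a b x \<epsilon> H" "\<epsilon> > 0"
    and t0: "t0 \<in> {a..b}" "x t0 \<in> chart_dom \<kappa>"
  defines "h \<equiv> \<lambda>s t. chart_map \<kappa> (H s t)"
  defines "h' \<equiv> \<lambda>s t. vector_derivative (h s) (at t within {a..b})"
  obtains r C where "r > 0" "C \<ge> 0"
    "\<And>s t. \<bar>s\<bar> < r \<Longrightarrow> \<bar>t - t0\<bar> < r \<Longrightarrow> t \<in> {a..b} \<Longrightarrow> H s t \<in> chart_dom \<kappa> \<and>
      (h s has_vector_derivative h' s t) (at t within {a..b}) \<and> continuous (at t within {a..b}) (h' s) \<and>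
      norm (h s t - h 0 t) \<le> C * \<bar>s\<bar> \<and> norm (h' s t - h' 0 t) \<le> C * \<bar>s\<bar>"
proof -
  let ?S = "{-\<epsilon><..<\<epsilon>} \<times> {a..b}"
  let ?H = "\<lambda>(s, t). H s t"
  have Hc: "continuous_map (top_of_set ?S) X ?H"
    and Hk: "Ck_on 2 (chart_map \<kappa> \<circ> ?H) (?S \<inter> ?H -` chart_dom \<kappa>)"
    using V \<kappa> by (auto simp: variation_def Ck_map_def)
  have H0: "H 0 t = x t" if "t \<in> {a..b}" for t using V that by (simp add: variation_def)
  have "openin (top_of_set ?S) {z \<in> ?S. ?H z \<in> chart_dom \<kappa>}"
    using openin_continuous_map_preimage[OF Hc open_dom[OF \<kappa>]] by simp
  then obtain W where W: "open W" "{z \<in> ?S. ?H z \<in> chart_dom \<kappa>} = ?S \<inter> W" by (auto simp: openin_open)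
  have z0S: "(0, t0) \<in> ?S" "?H (0, t0) \<in> chart_dom \<kappa>" using V(2) t0 H0 by auto
  then have z0W: "(0, t0) \<in> W" using W(2) by blast
  obtain V' k where V': "open V'" "(0, t0) \<in> V'" and k: "Ck_open 2 k V'"
    and eq: "\<And>z. z \<in> (?S \<inter> ?H -` chart_dom \<kappa>) \<inter> V' \<Longrightarrow> (chart_map \<kappa> \<circ> ?H) z = k z"
    using Hk z0S unfolding Ck_on_def by (metis (no_types, lifting) IntI vimageI)
  have "open (V' \<inter> W)" "(0, t0) \<in> V' \<inter> W" using V' W z0W by auto
  then obtain R where R: "R > 0" "cball (0, t0) R \<subseteq> V' \<inter> W" using open_contains_cball by blast
  define r where "r = min (R / 2) \<epsilon>"
  have r: "r > 0" using R V(2) by (simp add: r_def)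
  define k2 where "k2 z = frechet_derivative k (at z) (0, 1)" for z
  have k1: "Ck_open (Suc 0) k V'" and k21: "Ck_open (Suc 0) k2 V'"
  proof -
    have kk: "Ck_open (Suc (Suc 0)) k V'" using k by (simp only: numeral_2_eq_2)
    show "Ck_open (Suc 0) k V'" by (rule Ck_open_Suc_imp[OF kk])
    show "Ck_open (Suc 0) k2 V'"
      using conjunct2[OF kk[unfolded Ck_open.simps(2)[of "Suc 0"]]] unfolding k2_def by (elim allE)
  qed
  have sub: "cball (0, t0) R \<subseteq> V'" using R by auto
  obtain C1 where C1: "C1 \<ge> 0" "\<And>p q. p \<in> cball (0, t0) R \<Longrightarrow> q \<in> cball (0, t0) R \<Longrightarrow> norm (k p - k q) \<le> C1 * norm (p - q)"
    using C1_lipschitz_on_cball[OF sub k1] by blast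
  obtain C2 where C2: "C2 \<ge> 0" "\<And>p q. p \<in> cball (0, t0) R \<Longrightarrow> q \<in> cball (0, t0) R \<Longrightarrow> norm (k2 p - k2 q) \<le> C2 * norm (p - q)"
    using C1_lipschitz_on_cball[OF sub k21] by blast
  have ball: "(s, t) \<in> ball (0, t0) R" if "\<bar>s\<bar> < r" "\<bar>t - t0\<bar> < r" for s t
  proof -
    have "dist (0, t0) (s, t) \<le> \<bar>s\<bar> + \<bar>t - t0\<bar>"
      using norm_Pair_le[of "- s" "t0 - t"] by (simp add: dist_norm)
    then show ?thesis using that by (simp add: r_def)
  qed
  have in_dom: "H s t \<in> chart_dom \<kappa>" "h s t = k (s, t)"
    if "\<bar>s\<bar> < r" "\<bar>t - t0\<bar> < r" "t \<in> {a..b}" for s t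
  proof -
    have st: "(s, t) \<in> ?S" using that by (auto simp: r_def)
    have b: "(s, t) \<in> V' \<inter> W" using ball[OF that(1,2)] R(2) ball_subset_cball by blast
    then have "(s, t) \<in> {z \<in> ?S. ?H z \<in> chart_dom \<kappa>}" using st unfolding W(2) by blast
    then show "H s t \<in> chart_dom \<kappa>" by simp
    then show "h s t = k (s, t)" using eq[of "(s, t)"] st b by (simp add: h_def)
  qed
  have nt: "at t within {a..b} \<noteq> bot" if "t \<in> {a..b}" for t
    using that ab by (simp add: trivial_limit_within islimpt_Icc)
  have near: "\<forall>\<^sub>F t' in at t within {a..b}. \<bar>t' - t0\<bar> < r \<and> t' \<in> {a..b}" if "\<bar>t - t0\<bar> < r" for t
  proof -
    have "open {t'. \<bar>t' - t0\<bar> < r}" by (intro open_Collect_less continuous_intros)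
    then show ?thesis using that by (auto simp: eventually_at_topological)
  qed
  have der: "(h s has_vector_derivative k2 (s, t)) (at t within {a..b})"
    if st: "\<bar>s\<bar> < r" "\<bar>t - t0\<bar> < r" "t \<in> {a..b}" for s t
  proof -
    have "(s, t) \<in> V'" using ball[OF st(1,2)] sub ball_subset_cball by blast
    then have kd: "(k has_derivative frechet_derivative k (at (s, t))) (at (s, t))"
      by (rule Ck_open_SucD[OF k1])
    have "((\<lambda>t. (s, t)) has_derivative (\<lambda>h. (0, h))) (at t within {a..b})"
      by (auto intro!: derivative_eq_intros)
    from has_derivative_compose[OF this kd]
    have "((\<lambda>t. k (s, t)) has_derivative (\<lambda>h. frechet_derivative k (at (s, t)) (0, h))) (at t within {a..b})" .
    moreover have "frechet_derivative k (at (s, t)) (0, h) = h *\<^sub>R k2 (s, t)" for h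
      using linear_scale[OF has_derivative_linear[OF kd], of h "(0, 1)"] by (simp add: k2_def)
    ultimately have "((\<lambda>t. k (s, t)) has_derivative (\<lambda>h. h *\<^sub>R k2 (s, t))) (at t within {a..b})" by simp
    then have "(h s has_derivative (\<lambda>h. h *\<^sub>R k2 (s, t))) (at t within {a..b})"
      by (rule has_derivative_transform_eventually)
        (use near[OF st(2)] in_dom(2) st in \<open>auto elim!: eventually_mono\<close>)
    then show ?thesis by (simp add: has_vector_derivative_def)
  qed
  have h': "h' s t = k2 (s, t)" if "\<bar>s\<bar> < r" "\<bar>t - t0\<bar> < r" "t \<in> {a..b}" for s t
    unfolding h'_def by (rule vector_derivative_within[OF nt[OF that(3)] der[OF that]])
  show ?thesis
  proof (rule that[OF r, of "max C1 C2"])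
    show "max C1 C2 \<ge> 0" using C1 by simp
    fix s t assume st: "\<bar>s\<bar> < r" "\<bar>t - t0\<bar> < r" "t \<in> {a..b}"
    have s0: "\<bar>0::real\<bar> < r" using r by simp
    note cb = subsetD[OF ball_subset_cball ball[OF st(1,2)]] subsetD[OF ball_subset_cball ball[OF s0 st(2)]]
    have n: "norm ((s, t) - (0, t)) = \<bar>s\<bar>" by (simp add: norm_Pair)
    have "(s, t) \<in> V'" using cb sub by blast
    then have "isCont k2 (s, t)"
      using Ck_open_imp_continuous_on[OF k21] V'(1) by (simp add: continuous_on_eq_continuous_at)
    then have "((\<lambda>t'. k2 (s, t')) \<longlongrightarrow> k2 (s, t)) (at t within {a..b})"
      by (intro isCont_tendsto_compose[of "(s, t)" k2] tendsto_intros)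
    moreover have "\<forall>\<^sub>F t' in at t within {a..b}. k2 (s, t') = h' s t'"
      using near[OF st(2)] by eventually_elim (use h' st in auto)
    ultimately have "(h' s \<longlongrightarrow> k2 (s, t)) (at t within {a..b})"
      by (rule Lim_transform_eventually)
    then have hc: "continuous (at t within {a..b}) (h' s)"
      using h'[OF st] by (simp add: continuous_within)
    have "norm (h s t - h 0 t) \<le> C1 * \<bar>s\<bar>"
      using C1(2)[OF cb] in_dom(2)[OF st] in_dom(2)[OF s0 st(2,3)] n by simp
    moreover have "C1 * \<bar>s\<bar> \<le> max C1 C2 * \<bar>s\<bar>" by (intro mult_right_mono) auto
    moreover have "norm (h' s t - h' 0 t) \<le> C2 * \<bar>s\<bar>"
      using C2(2)[OF cb] h'[OF st] h'[OF s0 st(2,3)] n by simp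
    moreover have "C2 * \<bar>s\<bar> \<le> max C1 C2 * \<bar>s\<bar>" by (intro mult_right_mono) auto
    ultimately show "H s t \<in> chart_dom \<kappa> \<and>
      (h s has_vector_derivative h' s t) (at t within {a..b}) \<and> continuous (at t within {a..b}) (h' s) \<and>
      norm (h s t - h 0 t) \<le> max C1 C2 * \<bar>s\<bar> \<and> norm (h' s t - h' 0 t) \<le> max C1 C2 * \<bar>s\<bar>"
      using in_dom(1)[OF st] der[OF st] h'[OF st] hc by auto
  qed
qed

text \<open>
  Compactness of \<open>[a, b]\<close> turns the local estimates into the hypotheses of \<open>first_variation\<close>.
\<close>

lemma variation_in_chart:
  assumes \<kappa>: "\<kappa> \<in> A" and ab: "a < b" and V: "variation X A a b x \<epsilon> H" "\<epsilon> > 0"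
    and dom: "\<And>t. t \<in> {a..b} \<Longrightarrow> x t \<in> chart_dom \<kappa>"
  defines "h \<equiv> \<lambda>s t. chart_map \<kappa> (H s t)"
  defines "h' \<equiv> \<lambda>s t. vector_derivative (h s) (at t within {a..b})"
  obtains s0 C where "s0 > 0" "s0 \<le> \<epsilon>"
    "\<And>s t. \<bar>s\<bar> < s0 \<Longrightarrow> t \<in> {a..b} \<Longrightarrow> H s t \<in> chart_dom \<kappa>"
    "\<And>s t. \<bar>s\<bar> < s0 \<Longrightarrow> t \<in> {a..b} \<Longrightarrow> (h s has_vector_derivative h' s t) (at t within {a..b})"
    "\<And>s. \<bar>s\<bar> < s0 \<Longrightarrow> continuous_on {a..b} (h' s)"
    "\<And>s t. \<bar>s\<bar> < s0 \<Longrightarrow> t \<in> {a..b} \<Longrightarrow> norm (h s t - h 0 t) \<le> C * \<bar>s\<bar>"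
    "\<And>s t. \<bar>s\<bar> < s0 \<Longrightarrow> t \<in> {a..b} \<Longrightarrow> norm (h' s t - h' 0 t) \<le> C * \<bar>s\<bar>"
proof -
  define P where "P s t C \<longleftrightarrow> H s t \<in> chart_dom \<kappa> \<and>
      (h s has_vector_derivative h' s t) (at t within {a..b}) \<and> continuous (at t within {a..b}) (h' s) \<and>
      norm (h s t - h 0 t) \<le> C * \<bar>s\<bar> \<and> norm (h' s t - h' 0 t) \<le> C * \<bar>s\<bar>" for s t C
  have mono: "P s t C'" if "P s t C" "C \<le> C'" for s t C C'
    using that unfolding P_def by (meson abs_ge_zero mult_right_mono order_trans)
  have "\<exists>r C. r > 0 \<and> (\<forall>s t. \<bar>s\<bar> < r \<longrightarrow> \<bar>t - t0\<bar> < r \<longrightarrow> t \<in> {a..b} \<longrightarrow> P s t C)" if "t0 \<in> {a..b}" for t0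
    using variation_in_chart_near[OF \<kappa> ab V that dom[OF that]] unfolding P_def h_def h'_def by metis
  then obtain r C where r: "\<And>t0. t0 \<in> {a..b} \<Longrightarrow> r t0 > 0"
    and P: "\<And>t0 s t. t0 \<in> {a..b} \<Longrightarrow> \<bar>s\<bar> < r t0 \<Longrightarrow> \<bar>t - t0\<bar> < r t0 \<Longrightarrow> t \<in> {a..b} \<Longrightarrow> P s t (C t0)"
    by metis
  obtain F where F: "F \<subseteq> {a..b}" "finite F" "{a..b} \<subseteq> (\<Union>t0\<in>F. ball t0 (r t0))"
    by (rule compactE_image[OF compact_Icc, of "{a..b}" "\<lambda>t0. ball t0 (r t0)"]) (use r in auto)
  have Fne: "F \<noteq> {}" using F(3) ab by force
  define s0 where "s0 = min \<epsilon> (Min (r ` F))"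
  define C0 where "C0 = Max (C ` F)"
  have s0: "s0 > 0" "s0 \<le> \<epsilon>" unfolding s0_def using F Fne r V(2) by auto
  have PC: "P s t C0" if "\<bar>s\<bar> < s0" "t \<in> {a..b}" for s t
  proof -
    obtain t0 where t0: "t0 \<in> F" "\<bar>t - t0\<bar> < r t0" using F(3) \<open>t \<in> {a..b}\<close> by (auto simp: dist_real_def abs_minus_commute)
    have "s0 \<le> r t0" unfolding s0_def using F(2) t0(1) by (simp add: min.coboundedI2)
    then have "P s t (C t0)" using P[of t0 s t] t0 F(1) that by auto
    moreover have "C t0 \<le> C0" unfolding C0_def using F(2) t0(1) by simp
    ultimately show ?thesis by (rule mono)
  qed
  show ?thesis
    by (rule that[OF s0, of C0]) (use PC in \<open>auto simp: P_def continuous_on_eq_continuous_within\<close>)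
qed

end

section \<open>Forward geodesics and the spray\<close>

context manifold
begin

lemma chart_curve_C2:
  fixes c c' c'' :: "real \<Rightarrow> 'a"
  assumes "open I" "\<And>t. t \<in> I \<Longrightarrow> (c has_vector_derivative c' t) (at t)"
    and "\<And>t. t \<in> I \<Longrightarrow> (c' has_vector_derivative c'' t) (at t)" and "continuous_on I c''"
  shows "Ck_open 2 c I"
  unfolding numeral_2_eq_2
  by (rule Ck_open_real_SucI[OF assms(1,2)], assumption, rule Ck_open_real_SucI[OF assms(1,3)], assumption)
    (simp add: assms(4))

text \<open>
  The image of the curve lies in one chart, so every variation stays in that chart for small \<open>s\<close>, and the
  first variation vanishes with the Euler-Lagrange expression.
\<close>

lemma spray_solution_is_geodesic:
  fixes c c' c'' :: "real \<Rightarrow> 'a"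
  assumes \<kappa>: "\<kappa> \<in> A" and R: "randers_metric A g \<omega>" and T: "0 < T"
    and c: "\<And>t. t \<in> {0<..<T} \<Longrightarrow> (c has_vector_derivative c' t) (at t)"
    and c': "\<And>t. t \<in> {0<..<T} \<Longrightarrow> (c' has_vector_derivative c'' t) (at t)"
    and c'': "continuous_on {0<..<T} c''"
    and U: "\<And>t. t \<in> {0<..<T} \<Longrightarrow> c t \<in> chart_img \<kappa>" and nz: "\<And>t. t \<in> {0<..<T} \<Longrightarrow> c' t \<noteq> 0"
    and EL: "\<And>t. t \<in> {0<..<T} \<Longrightarrow>
      chart_randers.euler_lagrange (local_rep2 A \<kappa> g) (local_rep A \<kappa> \<omega>) (c t) (c' t) (c'' t) = 0"
  shows "forward_geodesic X A (randers g \<omega>) {0<..<T} (\<lambda>t. chart_inv \<kappa> (c t))"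
proof -
  interpret R: chart_randers "chart_img \<kappa>" "local_rep2 A \<kappa> g" "local_rep A \<kappa> \<omega>"
    by (rule randers_chart(1)[OF \<kappa> R])
  let ?I = "{0<..<T}" and ?x = "\<lambda>t. chart_inv \<kappa> (c t)"
  have ck: "Ck_map 2 X A ?I ?x"
    by (rule Ck_map_chart_inv[OF \<kappa> _ chart_curve_C2[OF _ c c' c'']]) (use U in auto)
  then have xc: "continuous_map (top_of_set ?I) X ?x" by (simp add: Ck_map_def)
  have xdom: "?x t \<in> chart_dom \<kappa>" and cx: "chart_map \<kappa> (?x t) = c t" if "t \<in> ?I" for t
    using chart_inv_dom[OF U[OF that]] chart_map_inv[OF U[OF that]] by auto
  have cxd: "((\<lambda>t. chart_map \<kappa> (?x t)) has_vector_derivative c' t) (at t)" if "t \<in> ?I" for t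
    by (rule has_vector_derivative_transform_within_open[OF c[OF that] _ that]) (auto simp: cx)
  have reg: "regular_curve X A ?I ?x"
    unfolding regular_curve_def
  proof (intro conjI ck ballI impI)
    fix t \<mu> assume t: "t \<in> ?I" and \<mu>: "\<mu> \<in> A" "?x t \<in> chart_dom \<mu>"
    have "at t within ?I \<noteq> bot" unfolding at_within_open[OF t open_greaterThanLessThan] by (rule at_neq_bot)
    from velocity_coord_vec[OF \<kappa> xc t xdom[OF t] this has_vector_derivative_at_within[OF cxd[OF t]]]
    show "velocity A ?I ?x t \<mu> \<noteq> 0"
      using chart_velocity_nonzero[OF \<kappa> \<mu>(1) xdom[OF t] \<mu>(2) nz[OF t]] by (simp only: not_False_eq_True)
  qed
  have ext: "extremal X A (randers g \<omega>) a b ?x" if ab: "a \<in> ?I" "b \<in> ?I" "a \<le> b" for a b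
    unfolding extremal_def
  proof (intro allI impI)
    fix \<epsilon> :: real and H assume \<epsilon>: "\<epsilon> > 0" and V: "variation X A a b ?x \<epsilon> H"
    show "((\<lambda>s. forward_length A (randers g \<omega>) a b (H s)) has_real_derivative 0) (at 0)"
    proof (cases "a = b")
      case True
      then show ?thesis by (simp add: forward_length_def)
    next
      case False
      then have lt: "a < b" using ab by simp
      have sub: "{a..b} \<subseteq> ?I" using ab by auto
      define h where "h = (\<lambda>s t. chart_map \<kappa> (H s t))"
      define h' where "h' = (\<lambda>s t. vector_derivative (h s) (at t within {a..b}))"
      have xdom': "?x t \<in> chart_dom \<kappa>" if "t \<in> {a..b}" for t using that sub xdom by blast
      have "\<exists>s0 C. 0 < s0 \<and> s0 \<le> \<epsilon> \<and> (\<forall>s t. \<bar>s\<bar> < s0 \<longrightarrow> t \<in> {a..b} \<longrightarrow>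
          H s t \<in> chart_dom \<kappa> \<and> (h s has_vector_derivative h' s t) (at t within {a..b}) \<and>
          norm (h s t - h 0 t) \<le> C * \<bar>s\<bar> \<and> norm (h' s t - h' 0 t) \<le> C * \<bar>s\<bar>) \<and>
          (\<forall>s. \<bar>s\<bar> < s0 \<longrightarrow> continuous_on {a..b} (h' s))"
        unfolding h_def h'_def by (rule variation_in_chart[OF \<kappa> lt V \<epsilon> xdom']) (assumption, blast)
      then obtain s0 C where s0: "s0 > 0" "s0 \<le> \<epsilon>"
        and dom: "\<And>s t. \<bar>s\<bar> < s0 \<Longrightarrow> t \<in> {a..b} \<Longrightarrow> H s t \<in> chart_dom \<kappa>"
        and hd: "\<And>s t. \<bar>s\<bar> < s0 \<Longrightarrow> t \<in> {a..b} \<Longrightarrow> (h s has_vector_derivative h' s t) (at t within {a..b})"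
        and h'c: "\<And>s. \<bar>s\<bar> < s0 \<Longrightarrow> continuous_on {a..b} (h' s)"
        and hC: "\<And>s t. \<bar>s\<bar> < s0 \<Longrightarrow> t \<in> {a..b} \<Longrightarrow> norm (h s t - h 0 t) \<le> C * \<bar>s\<bar>"
        and h'C: "\<And>s t. \<bar>s\<bar> < s0 \<Longrightarrow> t \<in> {a..b} \<Longrightarrow> norm (h' s t - h' 0 t) \<le> C * \<bar>s\<bar>"
        by blast
      have h0: "h 0 t = c t" if "t \<in> {a..b}" for t
      proof -
        have "H 0 t = ?x t" using V that by (simp add: variation_def)
        then show ?thesis using cx sub that by (auto simp: h_def)
      qed
      have nt: "at t within {a..b} \<noteq> bot" if "t \<in> {a..b}" for t
        using that lt by (simp add: trivial_limit_within islimpt_Icc)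
      have cd: "(c has_vector_derivative c' t) (at t within {a..b})" if "t \<in> {a..b}" for t
        by (rule has_vector_derivative_at_within[OF c[OF subsetD[OF sub that]]])
      have c'd: "(c' has_vector_derivative c'' t) (at t within {a..b})" if "t \<in> {a..b}" for t
        by (rule has_vector_derivative_at_within[OF c'[OF subsetD[OF sub that]]])
      have h'0: "h' 0 t = c' t" if t: "t \<in> {a..b}" for t
      proof -
        have "(h 0 has_vector_derivative c' t) (at t within {a..b})"
          by (rule has_vector_derivative_transform[OF t h0 cd[OF t]])
        then show ?thesis unfolding h'_def by (rule vector_derivative_within[OF nt[OF t]])
      qed
      have "((\<lambda>s. integral {a..b} (\<lambda>t. R.lag (h s t) (h' s t)) +
          integral {a..b} (\<lambda>t. local_rep2 A \<kappa> g (c t) (R.euler_lagrange (c t) (c' t) (c'' t)) (h s t - c t) /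
            sqrt (local_rep2 A \<kappa> g (c t) (c' t) (c' t)))) has_real_derivative 0) (at 0)"
      proof (rule R.first_variation[OF lt cd _ c'd _ _ s0(1) hd h'c])
        show "c ` {a..b} \<subseteq> chart_img \<kappa>" by (rule image_subsetI, rule U, erule subsetD[OF sub])
        show "0 \<notin> c' ` {a..b}"
        proof
          assume "0 \<in> c' ` {a..b}"
          then obtain t where t: "0 = c' t" "t \<in> {a..b}" by (rule imageE)
          show False using nz[OF subsetD[OF sub t(2)]] t(1) by simp
        qed
        show "continuous_on {a..b} c''" by (rule continuous_on_subset[OF c'' sub])
        fix s :: real assume s: "\<bar>s\<bar> < s0"
        show "norm (h s t - c t) \<le> C * \<bar>s\<bar>" "norm (h' s t - c' t) \<le> C * \<bar>s\<bar>" if "t \<in> {a..b}" for t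
          using hC[OF s that] h'C[OF s that] h0[OF that] h'0[OF that] by simp_all
        have "s \<in> {-\<epsilon><..<\<epsilon>}" using s s0(2) by auto
        then have "H s a = ?x a" "H s b = ?x b" using V by (auto simp: variation_def)
        then show "h s a = c a" "h s b = c b" using cx ab by (simp_all add: h_def)
      qed
      moreover have "integral {a..b} (\<lambda>t. local_rep2 A \<kappa> g (c t) (R.euler_lagrange (c t) (c' t) (c'' t)) (h s t - c t) /
            sqrt (local_rep2 A \<kappa> g (c t) (c' t) (c' t))) = integral {a..b} (\<lambda>t. 0)" for s
        by (rule integral_cong) (use EL sub U in \<open>auto simp: R.G_simps subset_iff\<close>)
      ultimately have "((\<lambda>s. integral {a..b} (\<lambda>t. R.lag (h s t) (h' s t))) has_real_derivative 0) (at 0)"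
        by simp
      moreover have "forward_length A (randers g \<omega>) a b (H s) = integral {a..b} (\<lambda>t. R.lag (h s t) (h' s t))"
        if s: "s \<in> {-s0<..<s0}" for s
      proof -
        have s': "\<bar>s\<bar> < s0" using s by auto
        have "continuous_map (top_of_set {a..b}) (top_of_set ({-\<epsilon><..<\<epsilon>} \<times> {a..b})) (\<lambda>t. (s, t))"
          using s s0 by (auto simp: continuous_map_in_subtopology intro!: continuous_intros)
        moreover have "continuous_map (top_of_set ({-\<epsilon><..<\<epsilon>} \<times> {a..b})) X (\<lambda>(s, t). H s t)"
          using V by (simp add: variation_def Ck_map_def)
        ultimately have "continuous_map (top_of_set {a..b}) X ((\<lambda>(s, t). H s t) \<circ> (\<lambda>t. (s, t)))"
          by (rule continuous_map_compose)
        then have "continuous_map (top_of_set {a..b}) X (H s)" by (simp add: o_def)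
        from forward_length_in_chart[OF \<kappa> this lt dom[OF s'], of "h' s" "randers g \<omega>"] hd[OF s']
        show ?thesis by (simp add: randers_chart(2)[OF \<kappa> R] h_def)
      qed
      ultimately show ?thesis
        by (elim has_field_derivative_transform_within_open[where S = "{-s0<..<s0}"]) (use s0 in auto)
    qed
  qed
  show ?thesis
    unfolding forward_geodesic_def
  proof (intro conjI reg ballI)
    show "is_interval ?I" by (rule is_interval_oo)
    show "interior ?I \<noteq> {}" using T by (simp add: interior_open)
    fix t show "\<exists>\<delta>>0. \<forall>a\<in>?I. \<forall>b\<in>?I. \<bar>a - t\<bar> < \<delta> \<longrightarrow> \<bar>b - t\<bar> < \<delta> \<longrightarrow> a \<le> b \<longrightarrow> extremal X A (randers g \<omega>) a b ?x"
      using ext zero_less_one by blast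
  qed
qed

text \<open>
  The polynomial \<open>(t - a) (b - t)\<close> vanishes at both ends and is positive between them, so it serves as a smooth cutoff
  for the variation \<open>c + s (t - a) (b - t) v\<close> in the chart.
\<close>

lemma extremal_weak_euler_lagrange:
  fixes c c' c'' :: "real \<Rightarrow> 'a"
  assumes \<kappa>: "\<kappa> \<in> A" and R: "randers_metric A g \<omega>" and I: "open I" and ab: "a < b" "{a..b} \<subseteq> I"
    and c: "\<And>t. t \<in> I \<Longrightarrow> (c has_vector_derivative c' t) (at t)"
    and c': "\<And>t. t \<in> I \<Longrightarrow> (c' has_vector_derivative c'' t) (at t)"
    and c'': "continuous_on I c''"
    and U: "\<And>t. t \<in> I \<Longrightarrow> c t \<in> chart_img \<kappa>" and nz: "\<And>t. t \<in> I \<Longrightarrow> c' t \<noteq> 0"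
    and ext: "extremal X A (randers g \<omega>) a b (\<lambda>t. chart_inv \<kappa> (c t))"
  shows "integral {a..b} (\<lambda>t. (t - a) * (b - t) *
      (local_rep2 A \<kappa> g (c t) (chart_randers.euler_lagrange (local_rep2 A \<kappa> g) (local_rep A \<kappa> \<omega>) (c t) (c' t) (c'' t)) v /
       sqrt (local_rep2 A \<kappa> g (c t) (c' t) (c' t)))) = 0"
proof -
  interpret R: chart_randers "chart_img \<kappa>" "local_rep2 A \<kappa> g" "local_rep A \<kappa> \<omega>"
    by (rule randers_chart(1)[OF \<kappa> R])
  define E where "E t = local_rep2 A \<kappa> g (c t) (R.euler_lagrange (c t) (c' t) (c'' t)) v / sqrt (local_rep2 A \<kappa> g (c t) (c' t) (c' t))" for t
  define \<eta> where "\<eta> t = (t - a) * (b - t)" for t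
  define \<Phi> where "\<Phi> z = c (snd z) + (fst z * \<eta> (snd z)) *\<^sub>R v" for z
  define \<Omega> where "\<Omega> = {z \<in> UNIV \<times> I. \<Phi> z \<in> chart_img \<kappa>}"
  have cC2: "Ck_open 2 c I" by (rule chart_curve_C2[OF I c c' c''])
  have oI: "open (UNIV \<times> I :: (real \<times> real) set)" using I by (intro open_Times) auto
  have \<eta>C: "Ck_open 2 \<eta> UNIV"
    unfolding numeral_2_eq_2
  proof (rule Ck_open_real_SucI)
    show "(\<eta> has_vector_derivative a + b - 2 * t) (at t)" for t
      unfolding has_real_derivative_iff_has_vector_derivative[symmetric] \<eta>_def[abs_def]
      by (auto intro!: derivative_eq_intros simp: algebra_simps)
    show "Ck_open (Suc 0) (\<lambda>t. a + b - 2 * t) UNIV"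
    proof (rule Ck_open_real_SucI)
      show "((\<lambda>t. a + b - 2 * t) has_vector_derivative - 2) (at t)" for t
        unfolding has_real_derivative_iff_has_vector_derivative[symmetric]
        by (auto intro!: derivative_eq_intros)
    qed (auto intro: Ck_open_const simp del: Ck_open.simps)
  qed simp
  have "Ck_open 2 (\<lambda>z. c (snd z)) (UNIV \<times> I :: (real \<times> real) set)"
    by (rule Ck_open_compose[OF oI I _ cC2 Ck_open_bounded_linear[OF oI bounded_linear_snd]]) auto
  moreover have "Ck_open 2 (\<lambda>z. \<eta> (snd z)) (UNIV \<times> I :: (real \<times> real) set)"
    by (rule Ck_open_compose[OF oI open_UNIV _ \<eta>C Ck_open_bounded_linear[OF oI bounded_linear_snd]]) auto
  from Ck_open_scaleR[OF oI Ck_open_bounded_linear[OF oI bounded_linear_fst] this]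
  have "Ck_open 2 (\<lambda>z. fst z * \<eta> (snd z)) (UNIV \<times> I :: (real \<times> real) set)" by simp
  ultimately have \<Phi>C: "Ck_open 2 \<Phi> (UNIV \<times> I)"
    unfolding \<Phi>_def by (intro Ck_open_add Ck_open_scaleR Ck_open_const oI)
  have o\<Omega>: "open \<Omega>"
  proof -
    have "open ((UNIV \<times> I) \<inter> \<Phi> -` chart_img \<kappa>)"
      by (rule continuous_open_preimage[OF Ck_open_imp_continuous_on[OF \<Phi>C] oI open_img[OF \<kappa>]])
    moreover have "(UNIV \<times> I) \<inter> \<Phi> -` chart_img \<kappa> = \<Omega>" by (auto simp: \<Omega>_def)
    ultimately show ?thesis by simp
  qed
  \<comment> \<open>For \<open>|s| < \<rho> / K\<close> the variation moves each point by less than \<open>\<rho>\<close>, so it stays in the chart.\<close>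
  define K where "K = (b - a)\<^sup>2 * norm v + 1"
  have K: "K > 0" by (simp add: K_def add_nonneg_pos)
  have \<eta>b: "\<bar>\<eta> t\<bar> \<le> (b - a)\<^sup>2" "\<bar>a + b - 2 * t\<bar> \<le> b - a" if "t \<in> {a..b}" for t
  proof -
    have "(t - a) * (b - t) \<le> (b - a) * (b - a)" using that by (intro mult_mono) auto
    moreover have "(t - a) * (b - t) \<ge> 0" using that by auto
    ultimately show "\<bar>\<eta> t\<bar> \<le> (b - a)\<^sup>2" by (simp add: \<eta>_def power2_eq_square)
    show "\<bar>a + b - 2 * t\<bar> \<le> b - a" using that by auto
  qed
  have cc: "continuous_on {a..b} c"
    using continuous_on_subset[OF Ck_open_imp_continuous_on[OF cC2] ab(2)] .
  obtain \<rho> where \<rho>: "\<rho> > 0" "(\<Union>y\<in>c ` {a..b}. ball y \<rho>) \<subseteq> chart_img \<kappa>"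
  proof (rule compact_subset_open_imp_ball_epsilon_subset)
    show "compact (c ` {a..b})" by (rule compact_continuous_image[OF cc compact_Icc])
    show "open (chart_img \<kappa>)" by (rule open_img[OF \<kappa>])
    show "c ` {a..b} \<subseteq> chart_img \<kappa>" using ab U by blast
  qed blast
  define \<epsilon> where "\<epsilon> = \<rho> / K"
  have \<epsilon>: "\<epsilon> > 0" using \<rho> K by (simp add: \<epsilon>_def)
  have in\<Omega>: "(s, t) \<in> \<Omega>" if s: "\<bar>s\<bar> < \<epsilon>" and t: "t \<in> {a..b}" for s t
  proof -
    have "norm ((s * \<eta> t) *\<^sub>R v) = \<bar>s\<bar> * (\<bar>\<eta> t\<bar> * norm v)" by (simp add: abs_mult)
    also have "\<dots> \<le> \<bar>s\<bar> * K"
      unfolding K_def using mult_right_mono[OF \<eta>b(1)[OF t], of "norm v"] by (intro mult_left_mono) auto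
    also have "\<dots> < \<rho>" using s K by (simp add: \<epsilon>_def field_simps)
    finally have "\<Phi> (s, t) \<in> ball (c t) \<rho>" by (simp add: \<Phi>_def dist_norm)
    then have "\<Phi> (s, t) \<in> chart_img \<kappa>" using \<rho>(2) t by blast
    then show ?thesis using t ab by (auto simp: \<Omega>_def)
  qed
  have sub: "{-\<epsilon><..<\<epsilon>} \<times> {a..b} \<subseteq> \<Omega>" using in\<Omega> by auto
  define H where "H s t = chart_inv \<kappa> (\<Phi> (s, t))" for s t
  have V: "variation X A a b (\<lambda>t. chart_inv \<kappa> (c t)) \<epsilon> H"
    unfolding variation_def
  proof (intro conjI ballI)
    have "Ck_map 2 X A ({-\<epsilon><..<\<epsilon>} \<times> {a..b}) (\<lambda>z. chart_inv \<kappa> (\<Phi> z))"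
      by (rule Ck_map_chart_inv[OF \<kappa> o\<Omega> Ck_open_subset[OF \<Phi>C] _ sub]) (auto simp: \<Omega>_def)
    then show "Ck_map 2 X A ({-\<epsilon><..<\<epsilon>} \<times> {a..b}) (\<lambda>(s, t). H s t)"
      by (simp add: H_def case_prod_unfold)
  qed (auto simp: H_def \<Phi>_def \<eta>_def)
  have L: "((\<lambda>s. forward_length A (randers g \<omega>) a b (H s)) has_real_derivative 0) (at 0)"
    using ext V \<epsilon> by (auto simp: extremal_def)
  define h where "h s t = c t + (s * \<eta> t) *\<^sub>R v" for s t
  define h' where "h' s t = c' t + (s * (a + b - 2 * t)) *\<^sub>R v" for s t
  have cd: "(c has_vector_derivative c' t) (at t within {a..b})" if "t \<in> {a..b}" for t
    by (rule has_vector_derivative_at_within[OF c[OF subsetD[OF ab(2) that]]])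
  have c'd: "(c' has_vector_derivative c'' t) (at t within {a..b})" if "t \<in> {a..b}" for t
    by (rule has_vector_derivative_at_within[OF c'[OF subsetD[OF ab(2) that]]])
  have c'c: "continuous_on {a..b} c'" by (rule continuous_on_vector_derivative[OF c'd])
  have hd: "(h s has_vector_derivative h' s t) (at t within {a..b})" if "t \<in> {a..b}" for s t
    unfolding h_def h'_def
  proof (rule has_vector_derivative_add[OF cd[OF that]])
    have "((\<lambda>t. s * \<eta> t) has_real_derivative s * (a + b - 2 * t)) (at t within {a..b})"
      unfolding \<eta>_def by (auto intro!: derivative_eq_intros simp: algebra_simps)
    from has_vector_derivative_scaleR[OF this has_vector_derivative_const[of v]]
    show "((\<lambda>t. (s * \<eta> t) *\<^sub>R v) has_vector_derivative (s * (a + b - 2 * t)) *\<^sub>R v) (at t within {a..b})"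
      by simp
  qed
  have h\<Phi>: "h s t = \<Phi> (s, t)" for s t by (simp add: h_def \<Phi>_def)
  define C where "C = ((b - a)\<^sup>2 + (b - a)) * norm v"
  have "((\<lambda>s. integral {a..b} (\<lambda>t. R.lag (h s t) (h' s t)) +
      integral {a..b} (\<lambda>t. local_rep2 A \<kappa> g (c t) (R.euler_lagrange (c t) (c' t) (c'' t)) (h s t - c t) /
        sqrt (local_rep2 A \<kappa> g (c t) (c' t) (c' t)))) has_real_derivative 0) (at 0)"
  proof (rule R.first_variation[OF ab(1) cd _ c'd _ _ \<epsilon> hd])
    show "c ` {a..b} \<subseteq> chart_img \<kappa>" by (rule image_subsetI, rule U, erule subsetD[OF ab(2)])
    show "0 \<notin> c' ` {a..b}"
    proof
      assume "0 \<in> c' ` {a..b}"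
      then obtain t where t: "0 = c' t" "t \<in> {a..b}" by (rule imageE)
      show False using nz[OF subsetD[OF ab(2) t(2)]] t(1) by simp
    qed
    show "continuous_on {a..b} c''" by (rule continuous_on_subset[OF c'' ab(2)])
    fix s :: real assume s: "\<bar>s\<bar> < \<epsilon>"
    show "continuous_on {a..b} (h' s)" unfolding h'_def by (intro continuous_intros c'c)
    fix t assume t: "t \<in> {a..b}"
    have "norm (h s t - c t) = \<bar>s\<bar> * (\<bar>\<eta> t\<bar> * norm v)" by (simp add: h_def abs_mult)
    also have "\<dots> \<le> \<bar>s\<bar> * C" unfolding C_def
      using \<eta>b(1)[OF t] ab by (intro mult_left_mono mult_right_mono) auto
    finally show "norm (h s t - c t) \<le> C * \<bar>s\<bar>" by (simp add: mult.commute)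
    have "norm (h' s t - c' t) = \<bar>s\<bar> * (\<bar>a + b - 2 * t\<bar> * norm v)" by (simp add: h'_def abs_mult)
    also have "\<dots> \<le> \<bar>s\<bar> * C" unfolding C_def
    proof (intro mult_left_mono mult_right_mono)
      show "\<bar>a + b - 2 * t\<bar> \<le> (b - a)\<^sup>2 + (b - a)" using \<eta>b(2)[OF t] by (smt (verit) zero_le_power2)
    qed auto
    finally show "norm (h' s t - c' t) \<le> C * \<bar>s\<bar>" by (simp add: mult.commute)
  qed (simp_all add: h_def \<eta>_def)
  moreover have "integral {a..b} (\<lambda>t. local_rep2 A \<kappa> g (c t) (R.euler_lagrange (c t) (c' t) (c'' t)) (h s t - c t) /
        sqrt (local_rep2 A \<kappa> g (c t) (c' t) (c' t))) = s * integral {a..b} (\<lambda>t. \<eta> t * E t)" for s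
  proof -
    have "integral {a..b} (\<lambda>t. local_rep2 A \<kappa> g (c t) (R.euler_lagrange (c t) (c' t) (c'' t)) (h s t - c t) /
        sqrt (local_rep2 A \<kappa> g (c t) (c' t) (c' t))) = integral {a..b} (\<lambda>t. s * (\<eta> t * E t))"
    proof (rule integral_cong)
      fix t assume "t \<in> {a..b}"
      then have ct: "c t \<in> chart_img \<kappa>" using ab U by blast
      show "local_rep2 A \<kappa> g (c t) (R.euler_lagrange (c t) (c' t) (c'' t)) (h s t - c t) /
          sqrt (local_rep2 A \<kappa> g (c t) (c' t) (c' t)) = s * (\<eta> t * E t)"
        by (simp add: h_def E_def bilinear_rmul[OF R.bilinear_G[OF ct]])
    qed
    then show ?thesis by simp
  qed
  moreover have "((\<lambda>s. integral {a..b} (\<lambda>t. R.lag (h s t) (h' s t))) has_real_derivative 0) (at 0)"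
  proof -
    have "forward_length A (randers g \<omega>) a b (H s) = integral {a..b} (\<lambda>t. R.lag (h s t) (h' s t))"
      if s: "s \<in> {-\<epsilon><..<\<epsilon>}" for s
    proof -
      have s': "\<bar>s\<bar> < \<epsilon>" using s by auto
      have img: "h s t \<in> chart_img \<kappa>" if "t \<in> {a..b}" for t
        using in\<Omega>[OF s' that] by (simp add: \<Omega>_def h\<Phi>)
      have hs: "H s t \<in> chart_dom \<kappa>" "chart_map \<kappa> (H s t) = h s t" if "t \<in> {a..b}" for t
        using chart_inv_dom[OF img[OF that]] chart_map_inv[OF img[OF that]] by (simp_all add: H_def h\<Phi>)
      have "continuous_on {a..b} (h s)" by (rule continuous_on_vector_derivative[OF hd])
      then have "continuous_map (top_of_set {a..b}) (top_of_set (chart_img \<kappa>)) (h s)"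
        using img by (auto simp: continuous_map_in_subtopology)
      note continuous_map_compose[OF this chart_continuous(2)[OF \<kappa>]]
      moreover have "H s = (\<lambda>t. chart_inv \<kappa> (h s t))" by (simp add: fun_eq_iff H_def h\<Phi>)
      ultimately have Hc: "continuous_map (top_of_set {a..b}) X (H s)" by (simp add: o_def)
      have "forward_length A (randers g \<omega>) a b (H s)
          = integral {a..b} (\<lambda>t. local_rep A \<kappa> (randers g \<omega>) (chart_map \<kappa> (H s t)) (h' s t))"
      proof (rule forward_length_in_chart[OF \<kappa> Hc ab(1) hs(1)])
        fix t assume t: "t \<in> {a..b}"
        show "((\<lambda>t. chart_map \<kappa> (H s t)) has_vector_derivative h' s t) (at t within {a..b})"
          by (rule has_vector_derivative_transform[OF t hs(2) hd[OF t]])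
      qed
      also have "\<dots> = integral {a..b} (\<lambda>t. R.lag (h s t) (h' s t))"
        by (rule integral_cong) (simp add: hs(2) randers_chart(2)[OF \<kappa> R])
      finally show ?thesis .
    qed
    then show ?thesis
      by (intro has_field_derivative_transform_within_open[OF L, where S = "{-\<epsilon><..<\<epsilon>}"]) (use \<epsilon> in auto)
  qed
  ultimately have "((\<lambda>s. s * integral {a..b} (\<lambda>t. \<eta> t * E t)) has_real_derivative 0 - 0) (at 0)"
    using DERIV_diff by fastforce
  moreover have "((\<lambda>s. s * integral {a..b} (\<lambda>t. \<eta> t * E t)) has_real_derivative integral {a..b} (\<lambda>t. \<eta> t * E t)) (at 0)"
    by (auto intro!: derivative_eq_intros)
  ultimately have "integral {a..b} (\<lambda>t. \<eta> t * E t) = 0" using DERIV_unique by fastforce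
  then show ?thesis by (simp add: \<eta>_def E_def)
qed

text \<open>
  If the Euler-Lagrange vector were \<open>v \<noteq> 0\<close> at \<open>t0\<close>, its product with \<open>v\<close> would be positive on an interval around
  \<open>t0\<close>, and the weak equation on that interval would equate a positive integral to 0.
\<close>

lemma geodesic_euler_lagrange:
  fixes c c' c'' :: "real \<Rightarrow> 'a"
  assumes \<kappa>: "\<kappa> \<in> A" and R: "randers_metric A g \<omega>" and I: "open I"
    and c: "\<And>t. t \<in> I \<Longrightarrow> (c has_vector_derivative c' t) (at t)"
    and c': "\<And>t. t \<in> I \<Longrightarrow> (c' has_vector_derivative c'' t) (at t)"
    and c'': "continuous_on I c''"
    and U: "\<And>t. t \<in> I \<Longrightarrow> c t \<in> chart_img \<kappa>" and nz: "\<And>t. t \<in> I \<Longrightarrow> c' t \<noteq> 0"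
    and geo: "forward_geodesic X A (randers g \<omega>) I (\<lambda>t. chart_inv \<kappa> (c t))" and t0: "t0 \<in> I"
  shows "chart_randers.euler_lagrange (local_rep2 A \<kappa> g) (local_rep A \<kappa> \<omega>) (c t0) (c' t0) (c'' t0) = 0"
proof (rule ccontr)
  interpret R: chart_randers "chart_img \<kappa>" "local_rep2 A \<kappa> g" "local_rep A \<kappa> \<omega>"
    by (rule randers_chart(1)[OF \<kappa> R])
  assume ne: "R.euler_lagrange (c t0) (c' t0) (c'' t0) \<noteq> 0"
  define v where "v = R.euler_lagrange (c t0) (c' t0) (c'' t0)"
  define E where "E t = local_rep2 A \<kappa> g (c t) (R.euler_lagrange (c t) (c' t) (c'' t)) v / sqrt (local_rep2 A \<kappa> g (c t) (c' t) (c' t))" for t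
  have cc: "continuous_on I c" and c'c: "continuous_on I c'"
    using c c' by (auto intro!: continuous_at_imp_continuous_on intro: has_vector_derivative_continuous)
  have pos: "local_rep2 A \<kappa> g (c t) (c' t) (c' t) > 0" if "t \<in> I" for t
    by (rule R.G_pos[OF U[OF that] nz[OF that]])
  have Ec: "continuous_on I E"
    unfolding E_def R.euler_lagrange_def
    by (intro continuous_intros R.continuous_on_G R.continuous_on_spray R.continuous_on_christoffel cc c'c c'')
      (use U pos in \<open>force+\<close>)
  have "E t0 > 0" unfolding E_def v_def using R.G_pos[OF U[OF t0] ne] pos[OF t0] by simp
  obtain \<delta> where \<delta>: "\<delta> > 0" "\<And>a b. a \<in> I \<Longrightarrow> b \<in> I \<Longrightarrow> \<bar>a - t0\<bar> < \<delta> \<Longrightarrow> \<bar>b - t0\<bar> < \<delta> \<Longrightarrow> a \<le> b \<Longrightarrow>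
      extremal X A (randers g \<omega>) a b (\<lambda>t. chart_inv \<kappa> (c t))"
    using geo t0 unfolding forward_geodesic_def by blast
  have "isCont E t0" using Ec I t0 by (simp add: continuous_on_eq_continuous_at)
  then have "\<forall>\<^sub>F t in nhds t0. E t > 0"
    using \<open>E t0 > 0\<close> by (auto simp: continuous_at tendsto_at_iff_tendsto_nhds intro: order_tendstoD(1))
  moreover have "\<forall>\<^sub>F t in nhds t0. t \<in> I" using I t0 by (rule eventually_nhds_in_open)
  ultimately have "\<forall>\<^sub>F t in nhds t0. E t > 0 \<and> t \<in> I" by (rule eventually_conj)
  then obtain d where d: "d > 0" "\<And>t. dist t t0 < d \<Longrightarrow> E t > 0 \<and> t \<in> I"
    unfolding eventually_nhds_metric by blast
  define a where "a = t0 - min d \<delta> / 2"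
  define b where "b = t0 + min d \<delta> / 2"
  have ab: "a < b" "\<bar>a - t0\<bar> < \<delta>" "\<bar>b - t0\<bar> < \<delta>" using d \<delta> by (auto simp: a_def b_def)
  have inI: "E t > 0" "t \<in> I" if "t \<in> {a..b}" for t
  proof -
    have "\<bar>t - t0\<bar> \<le> min d \<delta> / 2" using that unfolding a_def b_def atLeastAtMost_iff abs_le_iff by linarith
    also have "\<dots> < d" using d \<delta> by auto
    finally show "E t > 0" "t \<in> I" using d(2)[of t] by (auto simp: dist_real_def)
  qed
  have aI: "a \<in> I" "b \<in> I" "{a..b} \<subseteq> I" using inI ab by auto
  have "integral {a..b} (\<lambda>t. (t - a) * (b - t) * E t) = 0"
    unfolding E_def
    by (rule extremal_weak_euler_lagrange[OF \<kappa> R I ab(1) aI(3) c c' c'' U nz])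
      (use \<delta>(2)[OF aI(1,2) ab(2,3)] ab in auto)
  moreover have "continuous_on {a..b} (\<lambda>t. (t - a) * (b - t) * E t)"
    by (intro continuous_intros continuous_on_subset[OF Ec aI(3)])
  moreover have "(t - a) * (b - t) * E t \<ge> 0" if "t \<in> {a..b}" for t
    using that inI(1)[OF that] by auto
  ultimately have "\<forall>t\<in>{a..b}. (t - a) * (b - t) * E t = 0"
    using integral_eq_0_iff[of a b "\<lambda>t. (t - a) * (b - t) * E t"] ab(1) by blast
  moreover have m: "(a + b) / 2 \<in> {a..b}" using ab by auto
  ultimately have "((a + b) / 2 - a) * (b - (a + b) / 2) * E ((a + b) / 2) = 0" by blast
  then show False using inI(1)[OF m] ab(1) by auto
qed

text \<open>
  A solution of the spray equation of \<open>F\<close> with initial data \<open>(y, u)\<close> is a forward geodesic of \<open>F\<close>, hence of \<open>F'\<close>, so its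
  Euler-Lagrange expression for \<open>F'\<close> vanishes.
\<close>

theorem projectively_equivalent_sprays:
  assumes \<kappa>: "\<kappa> \<in> A" and R: "randers_metric A g \<omega>" and R': "randers_metric A g' \<omega>'"
    and proj: "projectively_equivalent X A (randers g \<omega>) (randers g' \<omega>')"
    and y: "y \<in> chart_img \<kappa>" and u: "u \<noteq> 0"
  shows "\<exists>l. chart_randers.spray (local_rep2 A \<kappa> g) (local_rep A \<kappa> \<omega>) y u
    - chart_randers.spray (local_rep2 A \<kappa> g') (local_rep A \<kappa> \<omega>') y u = l *\<^sub>R u"
proof -
  interpret R: chart_randers "chart_img \<kappa>" "local_rep2 A \<kappa> g" "local_rep A \<kappa> \<omega>"
    by (rule randers_chart(1)[OF \<kappa> R])
  interpret R': chart_randers "chart_img \<kappa>" "local_rep2 A \<kappa> g'" "local_rep A \<kappa> \<omega>'"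
    by (rule randers_chart(1)[OF \<kappa> R'])
  obtain r M T where "r > 0" "T > 0" and flow: "\<And>y' u'. dist y' y < r \<Longrightarrow> dist u' u < r \<Longrightarrow> \<exists>x x'. x 0 = y' \<and> x' 0 = u' \<and>
      (\<forall>t\<in>{0..T}. (x has_vector_derivative x' t) (at t within {0..T}) \<and>
        (x' has_vector_derivative R.spray (x t) (x' t)) (at t within {0..T}) \<and>
        x t \<in> chart_img \<kappa> \<and> x' t \<noteq> 0 \<and> norm (x t - y' - t *\<^sub>R u') \<le> M * t\<^sup>2)"
    using R.spray_flow[OF y u] by metis
  obtain c c' where c0: "c 0 = y" "c' 0 = u"
    and cd: "\<And>t. t \<in> {0..T} \<Longrightarrow> (c has_vector_derivative c' t) (at t within {0..T})"
    and c'd: "\<And>t. t \<in> {0..T} \<Longrightarrow> (c' has_vector_derivative R.spray (c t) (c' t)) (at t within {0..T})"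
    and U: "\<And>t. t \<in> {0..T} \<Longrightarrow> c t \<in> chart_img \<kappa>" and nz: "\<And>t. t \<in> {0..T} \<Longrightarrow> c' t \<noteq> 0"
    using flow[of y u] \<open>r > 0\<close> by auto
  let ?I = "{0<..<T}"
  have sub: "?I \<subseteq> {0..T}" by auto
  have at: "at t within {0..T} = at t" if "t \<in> ?I" for t
    using that by (intro at_within_interior) (simp add: interior_atLeastAtMost_real)
  have c1: "(c has_vector_derivative c' t) (at t)" "(c' has_vector_derivative R.spray (c t) (c' t)) (at t)" if "t \<in> ?I" for t
    using cd[of t] c'd[of t] that at[OF that] sub by auto
  have cc: "continuous_on {0..T} c" by (rule continuous_on_vector_derivative[OF cd])
  have c'c: "continuous_on {0..T} c'" by (rule continuous_on_vector_derivative[OF c'd])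
  have sc: "continuous_on {0..T} (\<lambda>t. R.spray (c t) (c' t))"
    by (rule R.continuous_on_spray[OF cc _ c'c]) (use U in auto)
  have sc1: "continuous_on ?I (\<lambda>t. R.spray (c t) (c' t))" by (rule continuous_on_subset[OF sc sub])
  have U1: "c t \<in> chart_img \<kappa>" "c' t \<noteq> 0" if "t \<in> ?I" for t using U nz that by auto
  have geo: "forward_geodesic X A (randers g \<omega>) ?I (\<lambda>t. chart_inv \<kappa> (c t))"
    by (rule spray_solution_is_geodesic[OF \<kappa> R \<open>T > 0\<close> c1(1) c1(2) sc1 U1]) (auto simp: R.spray_euler_lagrange U1)
  then have geo': "forward_geodesic X A (randers g' \<omega>') ?I (\<lambda>t. chart_inv \<kappa> (c t))"
    using proj by (simp add: projectively_equivalent_def)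
  define f where "f t = R'.euler_lagrange (c t) (c' t) (R.spray (c t) (c' t))" for t
  have f0: "f t = 0" if "t \<in> ?I" for t
    unfolding f_def by (rule geodesic_euler_lagrange[OF \<kappa> R' open_greaterThanLessThan c1(1) c1(2) sc1 U1 geo' that])
  have pos: "local_rep2 A \<kappa> g' (c t) (c' t) (c' t) > 0" if "t \<in> {0..T}" for t
    by (rule R'.G_pos[OF U[OF that] nz[OF that]])
  have cl: "closure ?I = {0..T}" using \<open>T > 0\<close> by (simp add: closure_greaterThanLessThan)
  \<comment> \<open>The geodesic lives on the open interval; the initial point is reached by continuity.\<close>
  have "continuous_on {0..T} f"
    unfolding f_def R'.euler_lagrange_def
    by (intro continuous_intros R'.continuous_on_G R'.continuous_on_spray R'.continuous_on_christoffel cc c'c sc)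
      (use U pos in \<open>force+\<close>)
  then have "f 0 = 0"
    using continuous_constant_on_closure[of ?I f 0 0] f0 \<open>T > 0\<close> unfolding cl by auto
  then show ?thesis
    unfolding f_def c0 R'.euler_lagrange_def by (metis right_minus_eq)
qed

end

section \<open>Projectively related metrics in a chart\<close>

lemma linear_form_kernel:
  fixes b :: "'a::euclidean_space \<Rightarrow> real"
  assumes "linear b" "DIM('a) \<ge> 2"
  obtains x where "x \<noteq> 0" "b x = 0"
proof -
  obtain e :: 'a where e: "e \<in> Basis" using nonempty_Basis by blast
  have "\<not> Basis \<subseteq> {e}"
    using assms(2) card_mono[of "{e}" "Basis :: 'a set"] by auto
  then obtain f where f: "f \<in> Basis" "f \<noteq> e" by blast
  show ?thesis
  proof (cases "b e = 0")
    case True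
    then show ?thesis using that e nonzero_Basis by blast
  next
    case False
    have "(b f *\<^sub>R e - b e *\<^sub>R f) \<bullet> f = - b e"
      using e f by (simp add: inner_diff_left inner_Basis)
    then have "b f *\<^sub>R e - b e *\<^sub>R f \<noteq> 0" using False by auto
    moreover have "b (b f *\<^sub>R e - b e *\<^sub>R f) = 0"
      by (simp add: linear_diff[OF assms(1)] linear_scale[OF assms(1)])
    ultimately show ?thesis using that by blast
  qed
qed

text \<open>
  The last condition says that the geodesics of the two metrics coincide up to parametrization.
\<close>

locale projective_pair = M: chart_metric U G + M': chart_metric U G'
  for U :: "'a::euclidean_space set" and G G' +
  assumes same_geodesics: "y \<in> U \<Longrightarrow> \<exists>l. M'.christoffel y u u - M.christoffel y u u = l *\<^sub>R u"
begin

lemma difference_tensor: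
  assumes y: "y \<in> U"
  obtains l where "linear l" "\<And>u v. M'.christoffel y u v - M.christoffel y u v = (1/2) *\<^sub>R (l u *\<^sub>R v + l v *\<^sub>R u)"
proof (rule quadratic_in_span)
  note b = bilinear_simps[OF M.christoffel_bilinear[OF y]] bilinear_simps[OF M'.christoffel_bilinear[OF y]]
  show "bilinear (\<lambda>u v. M'.christoffel y u v - M.christoffel y u v)"
    unfolding bilinear_def by (auto intro!: linearI simp: b scaleR_diff_right)
  show "M'.christoffel y u v - M.christoffel y u v = M'.christoffel y v u - M.christoffel y v u" for u v
    by (simp add: M.christoffel_sym[OF y, of u v] M'.christoffel_sym[OF y, of u v])
  show "\<exists>l. M'.christoffel y u u - M.christoffel y u u = l *\<^sub>R u" for u
    by (rule same_geodesics[OF y])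
qed (rule that)

text \<open>
  Weyl's argument. Differentiating \<open>G = \<rho> G'\<close> gives, for \<open>x\<close> orthogonal to \<open>v\<close>, that
  \<open>G (\<Gamma>'(x, x) - \<Gamma>(x, x)) v\<close> is half of \<open>\<rho>'(v) G'(x, x)\<close>. The left-hand side is a multiple of \<open>G x v = 0\<close>. A
  nonzero \<open>x\<close> orthogonal to \<open>v\<close> exists in dimension at least 2.
\<close>

theorem conformal_factor_constant:
  assumes dim: "DIM('a) \<ge> 2" and V: "open V" "connected V" "V \<subseteq> U"
    and conf: "\<And>y. y \<in> V \<Longrightarrow> \<exists>k. \<forall>u v. G y u v = k * G' y u v"
  obtains k where "\<And>y u v. y \<in> V \<Longrightarrow> G y u v = k * G' y u v"
proof -
  obtain e :: 'a where e: "e \<in> Basis" using nonempty_Basis by blast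
  have enz: "e \<noteq> 0" using e nonzero_Basis by blast
  define \<rho> where "\<rho> y = G y e e / G' y e e" for y
  have \<rho>: "G y u v = \<rho> y * G' y u v" if y: "y \<in> V" for y u v
  proof -
    obtain k where k: "\<And>u v. G y u v = k * G' y u v" using conf[OF y] by blast
    have "G' y e e > 0" using M'.G_pos[OF _ enz] y V by blast
    then have "\<rho> y = k" by (simp add: \<rho>_def k)
    then show ?thesis using k by simp
  qed
  have \<rho>d: "(\<rho> has_derivative (\<lambda>h. 0)) (at y)" if y: "y \<in> V" for y
  proof -
    have yU: "y \<in> U" using y V by blast
    have "G' y e e \<noteq> 0" using M'.G_pos[OF yU enz] by simp
    moreover have "(\<lambda>y. G y e e) differentiable (at y)" "(\<lambda>y. G' y e e) differentiable (at y)"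
      unfolding differentiable_def using M.G_derivative[OF yU] M'.G_derivative[OF yU] by blast+
    ultimately have "\<rho> differentiable (at y)" unfolding \<rho>_def by (intro differentiable_divide)
    then obtain \<rho>' where \<rho>': "(\<rho> has_derivative \<rho>') (at y)" by (auto simp: differentiable_def)
    have D: "M.DG y h u v = \<rho>' h * G' y u v + \<rho> y * M'.DG y h u v" for h u v
    proof -
      have "((\<lambda>z. \<rho> z * G' z u v) has_derivative (\<lambda>h. \<rho> y * M'.DG y h u v + \<rho>' h * G' y u v)) (at y)"
        by (rule has_derivative_mult[OF \<rho>' M'.G_derivative[OF yU]])
      then have "((\<lambda>z. G z u v) has_derivative (\<lambda>h. \<rho> y * M'.DG y h u v + \<rho>' h * G' y u v)) (at y)"
        by (rule has_derivative_transform_within_open[OF _ V(1) y]) (simp add: \<rho>)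
      from has_derivative_unique[OF M.G_derivative[OF yU] this] show ?thesis
        by (metis (no_types, lifting) add.commute)
    qed
    have "\<rho>' v = 0" for v
    proof -
      obtain x where x: "x \<noteq> 0" "G' y v x = 0"
        by (rule linear_form_kernel[OF bilinear_linear_right[OF M'.bilinear_G[OF yU]] dim])
      have x': "G' y x v = 0" using x(2) M'.G_sym[OF yU] by simp
      obtain l where l: "M'.christoffel y x x = M.christoffel y x x + l *\<^sub>R x"
        using same_geodesics[OF yU, of x] by (auto simp: diff_eq_eq add.commute)
      have 1: "G y (M.christoffel y x x) v = M.DG y x x v - M.DG y v x x / 2"
        by (simp add: M.G_christoffel[OF yU])
      have 2: "G' y (M'.christoffel y x x) v = M'.DG y x x v - M'.DG y v x x / 2"
        by (simp add: M'.G_christoffel[OF yU])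
      have "G' y (M'.christoffel y x x) v = G' y (M.christoffel y x x) v"
        unfolding l by (simp add: M'.G_simps[OF yU] x')
      then have "G y (M.christoffel y x x) v = \<rho> y * (M'.DG y x x v - M'.DG y v x x / 2)"
        unfolding \<rho>[OF y] using 2 by simp
      moreover have "M.DG y x x v - M.DG y v x x / 2 = \<rho> y * (M'.DG y x x v - M'.DG y v x x / 2) - \<rho>' v * G' y x x / 2"
        unfolding D x' by (simp add: algebra_simps add_divide_distrib)
      ultimately have "\<rho>' v * G' y x x = 0" using 1 by simp
      then show ?thesis using M'.G_pos[OF yU x(1)] by simp
    qed
    then show ?thesis using \<rho>' by (metis (no_types, lifting) has_derivative_eq_rhs ext)
  qed
  show ?thesis
  proof (cases "V = {}")
    case True
    then show ?thesis using that by blast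
  next
    case False
    then obtain y0 where y0: "y0 \<in> V" by blast
    have "\<rho> y = \<rho> y0" if "y \<in> V" for y
      by (rule has_derivative_zero_unique_connected[OF V(1,2) \<rho>d that y0])
    then show ?thesis using that[of "\<rho> y0"] \<rho> by metis
  qed
qed

definition det_ratio :: "'a \<Rightarrow> real" where
  "det_ratio y = gram_det (G' y) / gram_det (G y)"

lemma det_ratio_nonzero: "y \<in> U \<Longrightarrow> det_ratio y \<noteq> 0"
  using gram_det_nonzero[OF M.scalar_product] gram_det_nonzero[OF M'.scalar_product] by (simp add: det_ratio_def)

lemma det_ratio_derivative:
  assumes y: "y \<in> U"
  shows "(det_ratio has_derivative
    (\<lambda>h. 2 * (\<Sum>j\<in>Basis. (M'.christoffel y h j - M.christoffel y h j) \<bullet> j) * det_ratio y)) (at y)"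
proof -
  define a where "a h = (\<Sum>j\<in>Basis. M.christoffel y h j \<bullet> j)" for h
  define a' where "a' h = (\<Sum>j\<in>Basis. M'.christoffel y h j \<bullet> j)" for h
  have nz: "gram_det (G y) \<noteq> 0" by (rule gram_det_nonzero[OF M.scalar_product[OF y]])
  have e: "(\<Sum>j\<in>Basis. (M'.christoffel y h j - M.christoffel y h j) \<bullet> j) = a' h - a h" for h
    by (simp add: a_def a'_def inner_diff_left sum_subtractf)
  have "((\<lambda>y. gram_det (G' y) / gram_det (G y)) has_derivative
      (\<lambda>h. - gram_det (G' y) * (inverse (gram_det (G y)) * (2 * a h * gram_det (G y)) * inverse (gram_det (G y))) +
        2 * a' h * gram_det (G' y) / gram_det (G y))) (at y)"
    unfolding a_def a'_def
    by (rule has_derivative_divide[OF M'.gram_det_derivative[OF y] M.gram_det_derivative[OF y] nz])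
  moreover have "- gram_det (G' y) * (inverse (gram_det (G y)) * (2 * a h * gram_det (G y)) * inverse (gram_det (G y))) +
        2 * a' h * gram_det (G' y) / gram_det (G y) = 2 * (a' h - a h) * det_ratio y" for h
    using nz by (simp add: det_ratio_def field_simps)
  ultimately show ?thesis unfolding e det_ratio_def[abs_def] by (simp add: det_ratio_def)
qed

text \<open>
  With \<open>l\<close> from \<open>difference_tensor\<close> and \<open>m = l x'\<close>, the function \<open>q = G' x' x'\<close> satisfies \<open>q' = 2 m q\<close>, and the ratio
  \<open>D\<close> of determinants satisfies \<open>D' = (n + 1) m D\<close> by the trace formula, so \<open>q ^ (n + 1) / D\<^sup>2\<close> is constant. This is the
  quadratic integral of Painleve and Levi-Civita, raised to a power that avoids roots.
\<close>

lemma geodesic_integral: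
  assumes T: "0 \<le> T"
    and x: "\<And>t. t \<in> {0..T} \<Longrightarrow> (x has_vector_derivative x' t) (at t within {0..T})"
    and x': "\<And>t. t \<in> {0..T} \<Longrightarrow> (x' has_vector_derivative - M.christoffel (x t) (x' t) (x' t)) (at t within {0..T})"
    and U: "\<And>t. t \<in> {0..T} \<Longrightarrow> x t \<in> U"
  shows "G (x T) (x' T) (x' T) = G (x 0) (x' 0) (x' 0)"
    and "(G' (x T) (x' T) (x' T)) ^ (DIM('a) + 1) * (det_ratio (x 0))\<^sup>2
       = (G' (x 0) (x' 0) (x' 0)) ^ (DIM('a) + 1) * (det_ratio (x T))\<^sup>2"
proof -
  have xU: "x ` {0..T} \<subseteq> U" using U by auto
  have const: "f T = f 0" if "\<And>t. t \<in> {0..T} \<Longrightarrow> (f has_real_derivative 0) (at t within {0..T})" for f :: "real \<Rightarrow> real"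
    using has_field_derivative_zero_constant[of "{0..T}" f] that T by fastforce
  show "G (x T) (x' T) (x' T) = G (x 0) (x' 0) (x' 0)"
  proof (rule const)
    fix t assume t: "t \<in> {0..T}"
    note tU = U[OF t]
    have "((\<lambda>s. G (x s) (x' s) (x' s)) has_real_derivative
      M.DG (x t) (x' t) (x' t) (x' t) + G (x t) (- M.christoffel (x t) (x' t) (x' t)) (x' t)
        + G (x t) (x' t) (- M.christoffel (x t) (x' t) (x' t))) (at t within {0..T})"
      by (rule M.has_vector_derivative_G[OF x[OF t] xU t x'[OF t] x'[OF t]])
    then show "((\<lambda>s. G (x s) (x' s) (x' s)) has_real_derivative 0) (at t within {0..T})"
      by (simp add: M.G_simps[OF tU] M.G_christoffel[OF tU] M.G_sym[OF tU, of "x' t" "M.christoffel (x t) (x' t) (x' t)"])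
  qed
  let ?n = "DIM('a) + 1"
  define q where "q t = G' (x t) (x' t) (x' t)" for t
  define D where "D t = det_ratio (x t)" for t
  have Dnz: "D t \<noteq> 0" if "t \<in> {0..T}" for t unfolding D_def by (rule det_ratio_nonzero[OF U[OF that]])
  have "q T ^ ?n / (D T)\<^sup>2 = q 0 ^ ?n / (D 0)\<^sup>2"
  proof (rule const)
    fix t assume t: "t \<in> {0..T}"
    note tU = U[OF t]
    obtain l where l: "linear l" "\<And>u v. M'.christoffel (x t) u v - M.christoffel (x t) u v = (1/2) *\<^sub>R (l u *\<^sub>R v + l v *\<^sub>R u)"
      using difference_tensor[OF tU] by blast
    define m where "m = l (x' t)"
    have qd: "(q has_real_derivative 2 * m * q t) (at t within {0..T})"
    proof -
      have "(q has_real_derivative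
        M'.DG (x t) (x' t) (x' t) (x' t) + G' (x t) (- M.christoffel (x t) (x' t) (x' t)) (x' t)
          + G' (x t) (x' t) (- M.christoffel (x t) (x' t) (x' t))) (at t within {0..T})"
        unfolding q_def by (rule M'.has_vector_derivative_G[OF x[OF t] xU t x'[OF t] x'[OF t]])
      moreover have "M.christoffel (x t) (x' t) (x' t) = M'.christoffel (x t) (x' t) (x' t) - m *\<^sub>R x' t"
        using l(2)[of "x' t" "x' t"] by (simp add: m_def algebra_simps flip: scaleR_add_left)
      ultimately show ?thesis
        by (simp add: M'.G_simps[OF tU] M'.G_christoffel[OF tU] q_def
            M'.G_sym[OF tU, of "x' t" "M'.christoffel (x t) (x' t) (x' t)"] mult.assoc)
    qed
    have Dd: "(D has_real_derivative ?n * m * D t) (at t within {0..T})"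
    proof -
      from has_derivative_compose[OF x[OF t, unfolded has_vector_derivative_def] det_ratio_derivative[OF tU]]
      have "(D has_derivative (\<lambda>h. 2 * (\<Sum>j\<in>Basis. (M'.christoffel (x t) (h *\<^sub>R x' t) j - M.christoffel (x t) (h *\<^sub>R x' t) j) \<bullet> j) * D t)) (at t within {0..T})"
        unfolding D_def[abs_def] by (simp add: D_def)
      moreover have "2 * (\<Sum>j\<in>Basis. (M'.christoffel (x t) (h *\<^sub>R x' t) j - M.christoffel (x t) (h *\<^sub>R x' t) j) \<bullet> j) = ?n * m * h" for h
        using quadratic_in_span_trace[OF l, of "h *\<^sub>R x' t"]
        unfolding linear_scale[OF l(1)] m_def by (simp add: algebra_simps)
      ultimately show ?thesis
        unfolding has_field_derivative_def by (rule_tac has_derivative_eq_rhs) (auto simp: fun_eq_iff)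
    qed
    have qn: "((\<lambda>s. q s ^ ?n) has_real_derivative ?n * (q t ^ DIM('a) * (2 * m * q t))) (at t within {0..T})"
      using DERIV_power[OF qd, of ?n] by (simp add: algebra_simps)
    have D2: "((\<lambda>s. (D s)\<^sup>2) has_real_derivative 2 * (D t * (?n * m * D t))) (at t within {0..T})"
      using DERIV_power[OF Dd, of 2] by (simp add: algebra_simps)
    have "(D t)\<^sup>2 \<noteq> 0" using Dnz[OF t] by simp
    from DERIV_divide[OF qn D2 this]
    show "((\<lambda>s. q s ^ ?n / (D s)\<^sup>2) has_real_derivative 0) (at t within {0..T})"
      by (rule DERIV_cong) (simp add: power2_eq_square algebra_simps)
  qed
  then show "(G' (x T) (x' T) (x' T)) ^ ?n * (det_ratio (x 0))\<^sup>2 = (G' (x 0) (x' 0) (x' 0)) ^ ?n * (det_ratio (x T))\<^sup>2"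
    using Dnz[of 0] Dnz[of T] T unfolding q_def[symmetric] D_def[symmetric] by (simp add: frac_eq_eq)
qed

definition homothetic_on :: "real \<Rightarrow> 'a set \<Rightarrow> bool" where
  "homothetic_on k S \<longleftrightarrow> S \<subseteq> U \<and> (\<forall>y\<in>S. \<forall>u v. G y u v = k * G' y u v)"

text \<open>
  The geodesic starting at \<open>y\<close> near \<open>p\<close> with velocity \<open>u\<close> near \<open>u0 = q - p\<close> deviates from a straight line by at most \<open>M t\<^sup>2\<close>,
  so at a small time \<open>t1\<close> it is inside the ball. There \<open>G\<close> and \<open>G'\<close> are proportional with known factor and \<open>det_ratio\<close>, and
  the two conserved quantities transport this back to \<open>y\<close>: on an open set of vectors \<open>u\<close>, \<open>(G' y u u) ^ (n + 1)\<close>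
  is a multiple of \<open>(G y u u) ^ (n + 1)\<close>, with a factor independent of \<open>u\<close>.
\<close>

lemma homothetic_touching_ball:
  assumes dim: "DIM('a) \<ge> 2" and ball: "homothetic_on k (ball q d)" and k: "k > 0" and d: "d > 0"
    and p: "p \<in> U" "dist p q = d"
  obtains e where "e > 0" "homothetic_on k (ball p e)"
proof -
  \<comment> \<open>With the zero form the spray is \<open>- \<Gamma>(u, u)\<close>, so its flow consists of the geodesics of \<open>G\<close>.\<close>
  interpret F: chart_randers U G "\<lambda>_ _. 0"
    by (intro chart_randers.intro chart_form.intro M.chart_metric_axioms M.open_U linear_zero Ck_open_const)
  have spray0: "F.spray y u = - M.christoffel y u u" if y: "y \<in> U" for y u
  proof -
    have "F.dext y v u = 0" for v by (simp add: F.dext_def F.Dw_def)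
    then have "F.gyro y u = 0"
      by (intro scalar_product_cancel[OF M.scalar_product[OF y]]) (simp add: F.G_gyro[OF y] M.G_simps[OF y])
    then show ?thesis by (simp add: F.spray_def)
  qed
  define u0 where "u0 = q - p"
  have u0: "norm u0 = d" "u0 \<noteq> 0" using p(2) d by (auto simp: u0_def dist_norm norm_minus_commute)
  obtain r M T where r: "r > 0" "M > 0" "T > 0" and flow: "\<And>y u. dist y p < r \<Longrightarrow> dist u u0 < r \<Longrightarrow> \<exists>x x'. x 0 = y \<and> x' 0 = u \<and>
      (\<forall>t\<in>{0..T}. (x has_vector_derivative x' t) (at t within {0..T}) \<and>
        (x' has_vector_derivative F.spray (x t) (x' t)) (at t within {0..T}) \<and>
        x t \<in> U \<and> x' t \<noteq> 0 \<and> norm (x t - y - t *\<^sub>R u) \<le> M * t\<^sup>2)"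
    using F.spray_flow[OF p(1) u0(2)] by metis
  \<comment> \<open>The straight line from \<open>p\<close> to \<open>q\<close> is at distance \<open>(1 - t1) d\<close> from \<open>q\<close> at time \<open>t1\<close>. The initial position, the initial
    velocity and the curvature may each add at most \<open>t1 d / 4\<close>.\<close>
  define t1 where "t1 = min T (min (d / (4 * M)) 1)"
  have t1: "t1 > 0" "t1 \<le> T" "t1 \<le> 1" "M * t1 \<le> d / 4"
  proof -
    show "t1 > 0" "t1 \<le> T" "t1 \<le> 1" using r d by (auto simp: t1_def)
    have "t1 \<le> d / (4 * M)" by (simp add: t1_def)
    then show "M * t1 \<le> d / 4" using r by (simp add: field_simps)
  qed
  define e1 where "e1 = min r (t1 * d / 4)"
  define e2 where "e2 = min r (d / 4)"
  have e: "e1 > 0" "e2 > 0" using r t1 d by (auto simp: e1_def e2_def)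
  have reach: "y \<in> U \<and> (\<exists>x x'. x 0 = y \<and> x' 0 = u \<and> x t1 \<in> ball q d \<and>
      G (x t1) (x' t1) (x' t1) = G y u u \<and>
      (G' (x t1) (x' t1) (x' t1)) ^ (DIM('a) + 1) * (det_ratio y)\<^sup>2 = (G' y u u) ^ (DIM('a) + 1) * (det_ratio (x t1))\<^sup>2)"
    if y: "dist y p < e1" and u: "dist u u0 < e2" for y u
  proof -
    obtain x x' where x: "x 0 = y" "x' 0 = u"
      and xs: "\<And>t. t \<in> {0..T} \<Longrightarrow> (x has_vector_derivative x' t) (at t within {0..T}) \<and>
        (x' has_vector_derivative F.spray (x t) (x' t)) (at t within {0..T}) \<and>
        x t \<in> U \<and> x' t \<noteq> 0 \<and> norm (x t - y - t *\<^sub>R u) \<le> M * t\<^sup>2"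
      using flow[of y u] y u by (auto simp: e1_def e2_def)
    have sub: "t \<in> {0..T}" if "t \<in> {0..t1}" for t using that t1 by auto
    have xU: "x t \<in> U" if "t \<in> {0..t1}" for t using xs[OF sub[OF that]] by blast
    have xd: "(x has_vector_derivative x' t) (at t within {0..t1})" if "t \<in> {0..t1}" for t
      by (rule has_vector_derivative_within_subset[OF conjunct1[OF xs[OF sub[OF that]]]]) (use t1 in auto)
    have "(x' has_vector_derivative F.spray (x t) (x' t)) (at t within {0..t1})" if "t \<in> {0..t1}" for t
      by (rule has_vector_derivative_within_subset[OF conjunct1[OF conjunct2[OF xs[OF sub[OF that]]]]]) (use t1 in auto)
    then have x'd: "(x' has_vector_derivative - M.christoffel (x t) (x' t) (x' t)) (at t within {0..t1})" if "t \<in> {0..t1}" for t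
      using that unfolding spray0[OF xU[OF that], symmetric] by blast
    have "t1 \<in> {0..T}" using t1 by auto
    then have "norm (x t1 - y - t1 *\<^sub>R u) \<le> M * t1\<^sup>2" using xs by blast
    also have "M * t1\<^sup>2 = t1 * (M * t1)" by (simp add: power2_eq_square)
    also have "\<dots> \<le> t1 * (d / 4)" using t1 by (intro mult_left_mono) auto
    finally have 1: "norm (x t1 - y - t1 *\<^sub>R u) \<le> t1 * d / 4" by simp
    have 2: "norm (y - p) < t1 * d / 4" using y by (simp add: e1_def dist_norm)
    have "norm (t1 *\<^sub>R (u - u0)) \<le> t1 * (d / 4)"
      using u t1 by (simp add: e2_def dist_norm)
    then have 3: "norm (t1 *\<^sub>R (u - u0)) \<le> t1 * d / 4" by simp
    have "x t1 - q = (x t1 - y - t1 *\<^sub>R u) + (y - p) + t1 *\<^sub>R (u - u0) + (- (1 - t1)) *\<^sub>R u0"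
      by (simp add: u0_def algebra_simps)
    then have "norm (x t1 - q) \<le> norm (x t1 - y - t1 *\<^sub>R u) + norm (y - p) + norm (t1 *\<^sub>R (u - u0)) + norm ((- (1 - t1)) *\<^sub>R u0)"
      by (metis norm_triangle_mono norm_triangle_ineq order_refl)
    also have "norm ((- (1 - t1)) *\<^sub>R u0) = (1 - t1) * d" using t1 u0 by simp
    finally have "norm (x t1 - q) < d" using 1 2 3 t1 d by (simp add: algebra_simps) (smt (verit) mult_pos_pos)
    then have "x t1 \<in> ball q d" by (simp add: dist_norm norm_minus_commute)
    moreover have "y \<in> U" using xU[of 0] x t1 by simp
    moreover have "0 \<le> t1" using t1 by simp
    note geodesic_integral[OF this xd x'd xU]
    ultimately show ?thesis using x by auto
  qed
  have e1U: "ball p e1 \<subseteq> U" using reach[of _ u0] e by (auto simp: dist_commute)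
  have conf: "\<exists>m. \<forall>u v. G y u v = m * G' y u v" if "y \<in> ball p e1" for y
  proof -
    have y: "dist y p < e1" "y \<in> U" using that e1U by (auto simp: dist_commute)
    have gpos: "G y u0 u0 > 0" "G' y u0 u0 > 0" using M.G_pos[OF y(2) u0(2)] M'.G_pos[OF y(2) u0(2)] by auto
    have key: "(k * G' y u u) ^ (DIM('a) + 1) * (1 / k ^ DIM('a))\<^sup>2 = (G y u u) ^ (DIM('a) + 1) * (det_ratio y)\<^sup>2" if u: "dist u u0 < e2" for u
    proof -
      obtain x x' where x: "x t1 \<in> ball q d" "G (x t1) (x' t1) (x' t1) = G y u u"
        and I: "(G' (x t1) (x' t1) (x' t1)) ^ (DIM('a) + 1) * (det_ratio y)\<^sup>2 = (G' y u u) ^ (DIM('a) + 1) * (det_ratio (x t1))\<^sup>2"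
        using reach[OF y(1) u] by blast
      have hom: "G (x t1) u v = k * G' (x t1) u v" for u v using ball x(1) by (simp add: homothetic_on_def)
      have xU: "x t1 \<in> U" using ball x(1) by (auto simp: homothetic_on_def)
      have "G (x t1) = (\<lambda>b c. k * G' (x t1) b c)" using hom by blast
      then have "gram_det (G (x t1)) = k ^ DIM('a) * gram_det (G' (x t1))" by (simp add: gram_det_scale)
      then have dr: "det_ratio (x t1) = 1 / k ^ DIM('a)"
        using gram_det_nonzero[OF M'.scalar_product[OF xU]] by (simp add: det_ratio_def)
      have "(G y u u) ^ (DIM('a) + 1) * (det_ratio y)\<^sup>2 = k ^ (DIM('a) + 1) * ((G' (x t1) (x' t1) (x' t1)) ^ (DIM('a) + 1) * (det_ratio y)\<^sup>2)"
        unfolding x(2)[symmetric] hom power_mult_distrib by (simp only: mult.assoc)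
      also have "\<dots> = (k * G' y u u) ^ (DIM('a) + 1) * (1 / k ^ DIM('a))\<^sup>2"
        unfolding I dr power_mult_distrib by (simp only: mult.assoc)
      finally show ?thesis by simp
    qed
    define m where "m = G y u0 u0 / G' y u0 u0"
    have on_ball: "G y u u = m * G' y u u" if u: "u \<in> ball u0 e2" for u
    proof -
      have du: "dist u u0 < e2" "dist u0 u0 < e2" using u e by (auto simp: dist_commute)
      let ?n = "DIM('a) + 1"
      have a: "k ^ ?n * (1 / k ^ DIM('a))\<^sup>2 \<noteq> 0" using k by simp
      have "k ^ ?n * (1 / k ^ DIM('a))\<^sup>2 * (G' y u u * G y u0 u0) ^ ?n = ((k * G' y u u) ^ ?n * (1 / k ^ DIM('a))\<^sup>2) * (G y u0 u0) ^ ?n"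
        by (simp only: power_mult_distrib mult_ac)
      also have "\<dots> = (G y u u) ^ ?n * ((G y u0 u0) ^ ?n * (det_ratio y)\<^sup>2)"
        unfolding key[OF du(1)] by (simp only: mult_ac)
      also have "\<dots> = k ^ ?n * (1 / k ^ DIM('a))\<^sup>2 * (G' y u0 u0 * G y u u) ^ ?n"
        unfolding key[OF du(2), symmetric] by (simp only: power_mult_distrib mult_ac)
      finally have "(G' y u u * G y u0 u0) ^ ?n = (G' y u0 u0 * G y u u) ^ ?n" using a by simp
      then have "G' y u u * G y u0 u0 = G' y u0 u0 * G y u u"
        by (rule power_eq_imp_eq_base) (use M.G_nonneg[OF y(2)] M'.G_nonneg[OF y(2)] in auto)
      then show ?thesis using gpos by (simp add: m_def field_simps)
    qed
    have "G y u v - m * G' y u v = 0" for u v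
    proof (rule quadratic_form_vanishing_on_ball[of "\<lambda>u v. G y u v - m * G' y u v", OF _ _ e(2)])
      show "bilinear (\<lambda>u v. G y u v - m * G' y u v)"
        unfolding bilinear_def
        by (auto intro!: linearI simp: M.G_simps[OF y(2)] M'.G_simps[OF y(2)] algebra_simps)
      show "G y u v - m * G' y u v = G y v u - m * G' y v u" for u v
        using M.G_sym[OF y(2), of u v] M'.G_sym[OF y(2), of u v] by simp
    qed (use on_ball in simp)
    then show ?thesis by (intro exI[of _ m]) simp
  qed
  obtain k' where k': "\<And>y u v. y \<in> ball p e1 \<Longrightarrow> G y u v = k' * G' y u v"
    using conformal_factor_constant[OF dim open_ball connected_ball e1U conf] by blast
  \<comment> \<open>The two balls overlap in \<open>z\<close>, which identifies the constants.\<close>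
  define s where "s = min 1 (e1 / (2 * d))"
  have s: "0 < s" "s \<le> 1" "s * d < e1"
  proof -
    show "0 < s" "s \<le> 1" using e d by (auto simp: s_def)
    have "s * d \<le> e1 / (2 * d) * d" using d by (intro mult_right_mono) (auto simp: s_def)
    also have "\<dots> < e1" using d e by simp
    finally show "s * d < e1" .
  qed
  define z where "z = p + s *\<^sub>R u0"
  have z1: "z \<in> ball p e1" using s u0 by (simp add: z_def dist_norm)
  have "z - q = (- (1 - s)) *\<^sub>R u0" by (simp add: z_def u0_def algebra_simps)
  then have "norm (z - q) = (1 - s) * d" using s u0 by simp
  also have "\<dots> < 1 * d" using s d by (intro mult_strict_right_mono) auto
  finally have z2: "z \<in> ball q d" by (simp add: dist_norm norm_minus_commute)
  have "k' * G' z u0 u0 = G z u0 u0" by (rule k'[OF z1, symmetric])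
  also have "\<dots> = k * G' z u0 u0" using ball z2 unfolding homothetic_on_def by blast
  finally have "k' * G' z u0 u0 = k * G' z u0 u0" .
  moreover have "G' z u0 u0 > 0" by (rule M'.G_pos[OF _ u0(2)]) (use z1 e1U in blast)
  ultimately have "k' = k" by simp
  then show ?thesis using that[OF e(1)] k' e1U by (simp add: homothetic_on_def)
qed

text \<open>
  Taken as an interior, so that openness is automatic and being closed is the statement that carries content.
\<close>

definition homothetic_interior :: "real \<Rightarrow> 'a set" where
  "homothetic_interior k = {y. \<exists>e>0. homothetic_on k (ball y e)}"

lemma homothetic_interior_open: "open (homothetic_interior k)"
  unfolding open_contains_ball
proof
  fix y assume "y \<in> homothetic_interior k"
  then obtain e where e: "e > 0" "homothetic_on k (ball y e)" by (auto simp: homothetic_interior_def)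
  have "z \<in> homothetic_interior k" if z: "z \<in> ball y (e / 2)" for z
  proof -
    have "ball z (e / 2) \<subseteq> ball y e"
      using z by (intro subsetI) (auto simp: dist_commute intro: dist_triangle_half_l)
    then have "homothetic_on k (ball z (e / 2))" using e unfolding homothetic_on_def by blast
    then show ?thesis using e(1) by (auto simp: homothetic_interior_def intro!: exI[of _ "e / 2"])
  qed
  then show "\<exists>e>0. ball y e \<subseteq> homothetic_interior k" using e(1) by (intro exI[of _ "e / 2"]) auto
qed

text \<open>
  If \<open>p\<close> were a limit point outside the set, take \<open>q\<close> in the set close to \<open>p\<close> and the point \<open>p'\<close> outside the set nearest to \<open>q\<close>.
  The ball around \<open>q\<close> up to \<open>p'\<close> lies in the set and touches \<open>p'\<close>, which contradicts \<open>homothetic_touching_ball\<close>.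
\<close>

theorem homothetic_interior_closed:
  assumes dim: "DIM('a) \<ge> 2" and k: "k > 0" and p: "p \<in> U" "p \<in> closure (homothetic_interior k)"
  shows "p \<in> homothetic_interior k"
proof (rule ccontr)
  let ?W = "homothetic_interior k"
  assume np: "p \<notin> ?W"
  obtain R where R: "R > 0" "cball p R \<subseteq> U" using M.open_U p(1) open_contains_cball by blast
  obtain q where q: "q \<in> ?W" "dist q p < R / 2"
    using p(2) R(1) unfolding closure_approachable by (meson half_gt_zero)
  \<comment> \<open>Within this ball, the nearest point to \<open>q\<close> is at distance less than \<open>R / 2\<close>, so the touching ball does not leave \<open>cball p R\<close>.\<close>
  let ?C = "cball p R - ?W"
  have "closed ?C" using homothetic_interior_open by (intro closed_Diff closed_cball)
  moreover have pC: "p \<in> ?C" using np R(1) by simp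
  then have "?C \<noteq> {}" by blast
  ultimately obtain p' where p': "p' \<in> ?C" "\<And>z. z \<in> ?C \<Longrightarrow> dist q p' \<le> dist q z"
    using distance_attains_inf[of ?C q] by blast
  define d where "d = dist p' q"
  have d: "d > 0" using p'(1) q(1) by (auto simp: d_def)
  have "dist q p' \<le> dist q p" by (rule p'(2)[OF pC])
  then have dR: "d < R / 2" using q(2) by (simp add: d_def dist_commute)
  have "ball q d \<subseteq> ?W"
  proof
    fix z assume z: "z \<in> ball q d"
    have "dist p z \<le> dist p q + dist q z" by (rule dist_triangle)
    then have "z \<in> cball p R" using z dR q(2) by (simp add: dist_commute)
    then show "z \<in> ?W" using p'(2)[of z] z by (force simp: d_def dist_commute)
  qed
  moreover have "homothetic_on k ?W"
    unfolding homothetic_on_def homothetic_interior_def by (auto dest!: centre_in_ball[THEN iffD2])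
  ultimately have "homothetic_on k (ball q d)" unfolding homothetic_on_def by blast
  moreover have "p' \<in> U" using p'(1) R(2) by blast
  ultimately obtain e where "e > 0" "homothetic_on k (ball p' e)"
    using homothetic_touching_ball[OF dim _ k d] d_def by metis
  then have "p' \<in> ?W" by (auto simp: homothetic_interior_def)
  then show False using p'(1) by blast
qed

end

locale randers_pair = F: chart_randers U G w + F': chart_randers U G' w'
  for U :: "'a::euclidean_space set" and G w G' w' +
  assumes sprays_parallel: "y \<in> U \<Longrightarrow> u \<noteq> 0 \<Longrightarrow> \<exists>l. F.spray y u - F'.spray y u = l *\<^sub>R u"
begin

text \<open>
  Half the sum and half the difference of the relations for \<open>u\<close> and for \<open>- u\<close>.
\<close>

lemma spray_parity:
  assumes y: "y \<in> U"
  shows "\<exists>l. F'.christoffel y u u - F.christoffel y u u = l *\<^sub>R u"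
    and "\<exists>l. sqrt (G y u u) *\<^sub>R F.gyro y u - sqrt (G' y u u) *\<^sub>R F'.gyro y u = l *\<^sub>R u"
proof -
  define E where "E = F'.christoffel y u u - F.christoffel y u u"
  define J where "J = sqrt (G y u u) *\<^sub>R F.gyro y u - sqrt (G' y u u) *\<^sub>R F'.gyro y u"
  have "\<exists>l l'. J + E = l *\<^sub>R u \<and> J - E = l' *\<^sub>R u"
  proof (cases "u = 0")
    case True
    have "F.christoffel y 0 0 = 0" "F'.christoffel y 0 0 = 0" "F.gyro y 0 = 0" "F'.gyro y 0 = 0"
      using bilinear_lzero[OF F.christoffel_bilinear[OF y]] bilinear_lzero[OF F'.christoffel_bilinear[OF y]]
        linear_0[OF F.gyro_linear[OF y]] linear_0[OF F'.gyro_linear[OF y]] by auto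
    then show ?thesis using True by (simp add: J_def E_def)
  next
    case False
    obtain l where l: "F.spray y u - F'.spray y u = l *\<^sub>R u" using sprays_parallel[OF y False] by blast
    obtain l' where l': "F.spray y (- u) - F'.spray y (- u) = l' *\<^sub>R (- u)" using sprays_parallel[OF y, of "- u"] False by auto
    have "J + E = l *\<^sub>R u"
      unfolding l[symmetric] by (simp add: J_def E_def F.spray_def F'.spray_def)
    moreover have "J - E = l' *\<^sub>R u"
    proof -
      have "F.spray y (- u) - F'.spray y (- u) = - (J - E)"
        by (simp add: J_def E_def F.spray_def F'.spray_def F.G_simps[OF y] F'.G_simps[OF y]
            linear_neg[OF F.gyro_linear[OF y]] linear_neg[OF F'.gyro_linear[OF y]]
            bilinear_simps[OF F.christoffel_bilinear[OF y]] bilinear_simps[OF F'.christoffel_bilinear[OF y]])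
      then have "- (J - E) = - (l' *\<^sub>R u)" using l' by simp
      then show ?thesis by (simp only: neg_equal_iff_equal)
    qed
    ultimately show ?thesis by blast
  qed
  then obtain l l' where l: "J + E = l *\<^sub>R u" "J - E = l' *\<^sub>R u" by blast
  have "E = (1/2) *\<^sub>R ((J + E) - (J - E))" "J = (1/2) *\<^sub>R ((J + E) + (J - E))"
    by (simp_all add: algebra_simps flip: scaleR_2)
  then have "E = ((l - l') / 2) *\<^sub>R u" "J = ((l + l') / 2) *\<^sub>R u"
    unfolding l by (simp_all add: scaleR_add_left scaleR_diff_left algebra_simps diff_divide_distrib add_divide_distrib)
  then show "\<exists>l. F'.christoffel y u u - F.christoffel y u u = l *\<^sub>R u"
    "\<exists>l. sqrt (G y u u) *\<^sub>R F.gyro y u - sqrt (G' y u u) *\<^sub>R F'.gyro y u = l *\<^sub>R u"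
    unfolding E_def J_def by blast+
qed

sublocale projective_pair U G G'
  by unfold_locales (rule spray_parity(1))

text \<open>
  The algebraic lemma requires the first endomorphism to be nonzero, so it is applied in one of two orders; exchanging the metrics inverts
  \<open>c\<close>.
\<close>

lemma conformal_where_not_closed:
  assumes y: "y \<in> U" and nc: "F.dext y a b \<noteq> 0 \<or> F'.dext y a b \<noteq> 0"
  obtains c where "c > 0" "\<And>u v. G y u v = c\<^sup>2 * G' y u v" "\<And>u v. F.dext y u v = c * F'.dext y u v"
proof -
  note sp = F.scalar_product[OF y] F'.scalar_product[OF y]
  note J = F.gyro_linear[OF y] F.G_gyro_self[OF y] and J' = F'.gyro_linear[OF y] F'.G_gyro_self[OF y]
  have dext: "F.dext y v u = G y (F.gyro y u) v" "F'.dext y v u = G' y (F'.gyro y u) v" for u v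
    by (simp_all add: F.G_gyro[OF y] F'.G_gyro[OF y])
  consider "F.gyro y b \<noteq> 0" | "F'.gyro y b \<noteq> 0"
  proof -
    have "F.gyro y b = 0 \<Longrightarrow> F.dext y a b = 0" "F'.gyro y b = 0 \<Longrightarrow> F'.dext y a b = 0"
      by (simp_all add: dext F.G_simps[OF y] F'.G_simps[OF y])
    then show thesis using nc that by blast
  qed
  then show ?thesis
  proof cases
    case 1
    obtain c where c: "c > 0" "\<And>u v. G y u v = c\<^sup>2 * G' y u v" "\<And>u. F'.gyro y u = c *\<^sub>R F.gyro y u"
      using conformal_of_sqrt_multiples[OF sp J J' spray_parity(2)[OF y] 1] by metis
    show ?thesis
    proof (rule that[OF c(1,2)])
      show "F.dext y u v = c * F'.dext y u v" for u v
        unfolding dext c(3) by (simp add: F'.G_simps[OF y] c(2) power2_eq_square)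
    qed
  next
    case 2
    have span: "\<exists>f. sqrt (G' y x x) *\<^sub>R F'.gyro y x - sqrt (G y x x) *\<^sub>R F.gyro y x = f *\<^sub>R x" for x
    proof -
      obtain f where "sqrt (G y x x) *\<^sub>R F.gyro y x - sqrt (G' y x x) *\<^sub>R F'.gyro y x = f *\<^sub>R x"
        using spray_parity(2)[OF y] by blast
      then have "sqrt (G' y x x) *\<^sub>R F'.gyro y x - sqrt (G y x x) *\<^sub>R F.gyro y x = (- f) *\<^sub>R x"
        by (metis minus_diff_eq scaleR_minus_left)
      then show ?thesis by blast
    qed
    obtain c where c: "c > 0" "\<And>u v. G' y u v = c\<^sup>2 * G y u v" "\<And>u. F.gyro y u = c *\<^sub>R F'.gyro y u"
      using conformal_of_sqrt_multiples[OF sp(2,1) J' J span 2] by metis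
    show ?thesis
    proof (rule that[of "1 / c"])
      show "1 / c > 0" using c(1) by simp
      show "G y u v = (1 / c)\<^sup>2 * G' y u v" for u v using c(1,2) by (simp add: power_divide)
      show "F.dext y u v = 1 / c * F'.dext y u v" for u v
        unfolding dext c(3) using c(1) by (simp add: F.G_simps[OF y] c(2) power2_eq_square)
    qed
  qed
qed

end

section \<open>Globalization\<close>

context manifold
begin

lemma randers_pair_chart:
  assumes "\<kappa> \<in> A" "randers_metric A g \<omega>" "randers_metric A g' \<omega>'"
    and "projectively_equivalent X A (randers g \<omega>) (randers g' \<omega>')"
  shows "randers_pair (chart_img \<kappa>) (local_rep2 A \<kappa> g) (local_rep A \<kappa> \<omega>) (local_rep2 A \<kappa> g') (local_rep A \<kappa> \<omega>')"
  using assms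
  by (intro randers_pair.intro randers_pair_axioms.intro randers_chart(1) projectively_equivalent_sprays)

lemma ext_deriv_eq_dext:
  assumes "chart_form (chart_img \<kappa>) (local_rep A \<kappa> \<omega>)"
  shows "ext_deriv A \<kappa> \<omega> y u v = chart_form.dext (local_rep A \<kappa> \<omega>) y u v"
  by (simp add: ext_deriv_def chart_form.dext_def[OF assms] chart_form.Dw_def[OF assms])

text \<open>
  Stated with tangent vectors instead of coordinates, so that the set does not depend on a chart.
\<close>

definition homothetic_near ::
  "('m \<Rightarrow> ('m, 'a) tangent \<Rightarrow> ('m, 'a) tangent \<Rightarrow> real) \<Rightarrow> ('m \<Rightarrow> ('m, 'a) tangent \<Rightarrow> ('m, 'a) tangent \<Rightarrow> real)
    \<Rightarrow> real \<Rightarrow> 'm set" where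
  "homothetic_near g g' k = {p. \<exists>V. openin X V \<and> p \<in> V \<and>
     (\<forall>q\<in>V. \<forall>\<xi>\<in>tangent_space A q. \<forall>\<eta>\<in>tangent_space A q. g q \<xi> \<eta> = k * g' q \<xi> \<eta>)}"

lemma homothetic_near_in_chart:
  assumes \<kappa>: "\<kappa> \<in> A" and p: "p \<in> chart_dom \<kappa>"
  shows "p \<in> homothetic_near g g' k \<longleftrightarrow>
    (\<exists>e>0. ball (chart_map \<kappa> p) e \<subseteq> chart_img \<kappa> \<and>
      (\<forall>y\<in>ball (chart_map \<kappa> p) e. \<forall>u v. local_rep2 A \<kappa> g y u v = k * local_rep2 A \<kappa> g' y u v))"
    (is "_ \<longleftrightarrow> (\<exists>e>0. ?P e)")
proof
  assume "p \<in> homothetic_near g g' k"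
  then obtain V where V: "openin X V" "p \<in> V"
    and eq: "\<And>q \<xi> \<eta>. q \<in> V \<Longrightarrow> \<xi> \<in> tangent_space A q \<Longrightarrow> \<eta> \<in> tangent_space A q \<Longrightarrow> g q \<xi> \<eta> = k * g' q \<xi> \<eta>"
    by (auto simp: homothetic_near_def)
  have "open (chart_map \<kappa> ` (chart_dom \<kappa> \<inter> V))"
    using V open_dom[OF \<kappa>] by (intro open_chart_image[OF \<kappa>] openin_Int) auto
  then obtain e where e: "e > 0" "ball (chart_map \<kappa> p) e \<subseteq> chart_map \<kappa> ` (chart_dom \<kappa> \<inter> V)"
    using p V(2) open_contains_ball by (metis IntI imageI)
  have "?P e"
  proof (intro conjI ballI allI)
    show "ball (chart_map \<kappa> p) e \<subseteq> chart_img \<kappa>" using e(2) by blast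
    fix y u v assume "y \<in> ball (chart_map \<kappa> p) e"
    then obtain q where q: "y = chart_map \<kappa> q" "q \<in> chart_dom \<kappa>" "q \<in> V" using e(2) by blast
    have "chart_inv \<kappa> y = q" unfolding q(1) by (rule chart_inv_map[OF \<kappa> q(2)])
    then show "local_rep2 A \<kappa> g y u v = k * local_rep2 A \<kappa> g' y u v"
      unfolding local_rep2_def by (simp add: eq[OF q(3) coord_vec_tangent[OF \<kappa> q(2)] coord_vec_tangent[OF \<kappa> q(2)]])
  qed
  then show "\<exists>e>0. ?P e" using e(1) by blast
next
  assume "\<exists>e>0. ?P e"
  then obtain e where e: "e > 0" "?P e" by blast
  let ?V = "{q \<in> chart_dom \<kappa>. chart_map \<kappa> q \<in> ball (chart_map \<kappa> p) e}"
  have "g q \<xi> \<eta> = k * g' q \<xi> \<eta>" if q: "q \<in> ?V" and \<xi>: "\<xi> \<in> tangent_space A q" and \<eta>: "\<eta> \<in> tangent_space A q" for q \<xi> \<eta>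
  proof -
    have qd: "q \<in> chart_dom \<kappa>" and y: "chart_map \<kappa> q \<in> ball (chart_map \<kappa> p) e" using q by auto
    have "local_rep2 A \<kappa> g (chart_map \<kappa> q) (\<xi> \<kappa>) (\<eta> \<kappa>) = k * local_rep2 A \<kappa> g' (chart_map \<kappa> q) (\<xi> \<kappa>) (\<eta> \<kappa>)"
      using e(2) y by blast
    then show ?thesis
      unfolding local_rep2_def chart_inv_map[OF \<kappa> qd]
        tangent_coord_vec[OF \<kappa> qd \<xi>, symmetric] tangent_coord_vec[OF \<kappa> qd \<eta>, symmetric] .
  qed
  then show "p \<in> homothetic_near g g' k"
    unfolding homothetic_near_def
    using open_chart_preimage[OF \<kappa> open_ball, of "chart_map \<kappa> p" e] p e(1)
    by (intro CollectI exI[of _ ?V]) auto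
qed

text \<open>
  The set is open by definition; its complement is open since in every chart \<open>homothetic_interior\<close> is relatively closed.
\<close>

theorem homothetic_everywhere:
  assumes con: "connected_space X" and dim: "DIM('a) \<ge> 2"
    and R: "randers_metric A g \<omega>" and R': "randers_metric A g' \<omega>'"
    and proj: "projectively_equivalent X A (randers g \<omega>) (randers g' \<omega>')"
    and k: "k > 0" and p0: "p0 \<in> topspace X" "p0 \<in> homothetic_near g g' k"
    and p: "p \<in> topspace X"
  shows "p \<in> homothetic_near g g' k"
proof -
  let ?W = "homothetic_near g g' k"
  have sub: "?W \<subseteq> topspace X" using openin_subset by (force simp: homothetic_near_def)
  have "openin X ?W"
    by (subst openin_subopen) (auto simp: homothetic_near_def)
  moreover have "closedin X ?W"
  proof -
    have "openin X (topspace X - ?W)"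
    proof (subst openin_subopen, intro ballI)
      fix q assume q: "q \<in> topspace X - ?W"
      obtain \<kappa> where \<kappa>: "\<kappa> \<in> A" "q \<in> chart_dom \<kappa>" using chart_around q by blast
      interpret randers_pair "chart_img \<kappa>" "local_rep2 A \<kappa> g" "local_rep A \<kappa> \<omega>" "local_rep2 A \<kappa> g'" "local_rep A \<kappa> \<omega>'"
        by (rule randers_pair_chart[OF \<kappa>(1) R R' proj])
      have iff: "r \<in> ?W \<longleftrightarrow> chart_map \<kappa> r \<in> homothetic_interior k" if "r \<in> chart_dom \<kappa>" for r
        unfolding homothetic_near_in_chart[OF \<kappa>(1) that] homothetic_interior_def homothetic_on_def by simp
      let ?V = "{r \<in> chart_dom \<kappa>. chart_map \<kappa> r \<in> - closure (homothetic_interior k)}"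
      have "openin X ?V" by (rule open_chart_preimage[OF \<kappa>(1)]) auto
      moreover have "q \<in> ?V"
        using q \<kappa>(2) iff[OF \<kappa>(2)] homothetic_interior_closed[OF dim k, of "chart_map \<kappa> q"] by auto
      moreover have "?V \<subseteq> topspace X - ?W"
      proof
        fix r assume r: "r \<in> ?V"
        then have "chart_map \<kappa> r \<notin> homothetic_interior k" using closure_subset by blast
        then show "r \<in> topspace X - ?W" using r iff[of r] dom_in_topspace[OF \<kappa>(1)] by auto
      qed
      ultimately show "\<exists>T. openin X T \<and> q \<in> T \<and> T \<subseteq> topspace X - ?W" by blast
    qed
    then show ?thesis using sub by (simp add: closedin_def)
  qed
  ultimately have "?W = {} \<or> ?W = topspace X" using con unfolding connected_space_clopen_in by blast
  then show ?thesis using p0 p by blast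
qed

text \<open>
  Where one exterior derivative is nonzero it stays nonzero on a ball, so the metrics are conformal there, hence homothetic.
\<close>

theorem homothetic_somewhere:
  assumes dim: "DIM('a) \<ge> 2"
    and R: "randers_metric A g \<omega>" and R': "randers_metric A g' \<omega>'"
    and proj: "projectively_equivalent X A (randers g \<omega>) (randers g' \<omega>')"
    and nc: "\<not> closed_form A \<omega> \<or> \<not> closed_form A \<omega>'"
  obtains k p where "k > 0" "p \<in> topspace X" "p \<in> homothetic_near g g' k"
proof -
  obtain \<kappa> y a b where \<kappa>: "\<kappa> \<in> A" and y: "y \<in> chart_img \<kappa>"
    and ne: "ext_deriv A \<kappa> \<omega> y a b \<noteq> 0 \<or> ext_deriv A \<kappa> \<omega>' y a b \<noteq> 0"
    using nc unfolding closed_form_def by blast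
  interpret randers_pair "chart_img \<kappa>" "local_rep2 A \<kappa> g" "local_rep A \<kappa> \<omega>" "local_rep2 A \<kappa> g'" "local_rep A \<kappa> \<omega>'"
    by (rule randers_pair_chart[OF \<kappa> R R' proj])
  note ext = ext_deriv_eq_dext[OF F.chart_form_axioms] ext_deriv_eq_dext[OF F'.chart_form_axioms]
  define S where "S = chart_img \<kappa> \<inter> (\<lambda>z. F.dext z a b) -` (- {0}) \<union> chart_img \<kappa> \<inter> (\<lambda>z. F'.dext z a b) -` (- {0})"
  have "open (chart_img \<kappa> \<inter> (\<lambda>z. F.dext z a b) -` (- {0}))" "open (chart_img \<kappa> \<inter> (\<lambda>z. F'.dext z a b) -` (- {0}))"
    by (intro continuous_open_preimage open_img[OF \<kappa>] F.continuous_on_dext F'.continuous_on_dext continuous_intros; auto)+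
  then have "open S" unfolding S_def by (rule open_Un)
  moreover have "y \<in> S" using y ne unfolding S_def ext by blast
  ultimately obtain e where e: "e > 0" "ball y e \<subseteq> S" using open_contains_ball by blast
  have eU: "ball y e \<subseteq> chart_img \<kappa>" using e(2) by (auto simp: S_def)
  have conf: "\<exists>m. \<forall>u v. local_rep2 A \<kappa> g z u v = m * local_rep2 A \<kappa> g' z u v" if z: "z \<in> ball y e" for z
  proof -
    have "z \<in> chart_img \<kappa>" "F.dext z a b \<noteq> 0 \<or> F'.dext z a b \<noteq> 0" using e(2) z by (auto simp: S_def)
    from conformal_where_not_closed[OF this] show ?thesis by metis
  qed
  obtain k where k: "\<And>z u v. z \<in> ball y e \<Longrightarrow> local_rep2 A \<kappa> g z u v = k * local_rep2 A \<kappa> g' z u v"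
    using conformal_factor_constant[OF dim open_ball connected_ball eU conf] by blast
  obtain u :: 'a where "u \<in> Basis" using nonempty_Basis by blast
  then have "u \<noteq> 0" using nonzero_Basis by blast
  then have "local_rep2 A \<kappa> g y u u > 0" "local_rep2 A \<kappa> g' y u u > 0"
    using F.G_pos[OF y] F'.G_pos[OF y] by blast+
  then have kpos: "k > 0" using k[of y u u] e(1) by (simp add: zero_less_mult_iff)
  let ?p = "chart_inv \<kappa> y"
  note p = chart_inv_dom[OF y] chart_map_inv[OF y]
  have "?p \<in> homothetic_near g g' k"
    unfolding homothetic_near_in_chart[OF \<kappa> p(1)] p(2) using e(1) eU k by blast
  then show ?thesis using that kpos dom_in_topspace[OF \<kappa> p(1)] by blast
qed

end

theorem theorem1:
  fixes X :: "'m topology"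
    and A :: "('m, 'a::euclidean_space) chart set"
    and g g' :: "'m \<Rightarrow> ('m, 'a) tangent \<Rightarrow> ('m, 'a) tangent \<Rightarrow> real"
    and \<omega> \<omega>' :: "'m \<Rightarrow> ('m, 'a) tangent \<Rightarrow> real"
  assumes "smooth_manifold X A"
    and "connected_space X"
    and "DIM('a) \<ge> 2"
    and "randers_metric A g \<omega>"
    and "randers_metric A g' \<omega>'"
    and "projectively_equivalent X A (randers g \<omega>) (randers g' \<omega>')"
    and "\<not> closed_form A \<omega> \<or> \<not> closed_form A \<omega>'"
  shows "\<exists>c::real. c > 0 \<and>
    (\<forall>p\<in>topspace X. \<forall>\<xi>\<in>tangent_space A p. \<forall>\<eta>\<in>tangent_space A p. g p \<xi> \<eta> = c\<^sup>2 * g' p \<xi> \<eta>) \<and>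
    closed_form A (\<lambda>p \<xi>. \<omega> p \<xi> - c * \<omega>' p \<xi>)"
proof -
  interpret manifold X A by unfold_locales (rule assms(1))
  obtain k p0 where k: "k > 0" "p0 \<in> topspace X" "p0 \<in> homothetic_near g g' k"
    using homothetic_somewhere[OF assms(3-7)] by blast
  have near: "p \<in> homothetic_near g g' k" if "p \<in> topspace X" for p
    by (rule homothetic_everywhere[OF assms(2-6) k that])
  define c where "c = sqrt k"
  have c: "c > 0" "c\<^sup>2 = k" using k(1) by (simp_all add: c_def)
  have metric: "g p \<xi> \<eta> = c\<^sup>2 * g' p \<xi> \<eta>"
    if "p \<in> topspace X" "\<xi> \<in> tangent_space A p" "\<eta> \<in> tangent_space A p" for p \<xi> \<eta>
    using near[OF that(1)] that unfolding homothetic_near_def c(2) by blast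
  have "ext_deriv A \<kappa> (\<lambda>p \<xi>. \<omega> p \<xi> - c * \<omega>' p \<xi>) y u v = 0"
    if \<kappa>: "\<kappa> \<in> A" and y: "y \<in> chart_img \<kappa>" for \<kappa> y u v
  proof -
    interpret randers_pair "chart_img \<kappa>" "local_rep2 A \<kappa> g" "local_rep A \<kappa> \<omega>" "local_rep2 A \<kappa> g'" "local_rep A \<kappa> \<omega>'"
      by (rule randers_pair_chart[OF \<kappa> assms(4-6)])
    have "((\<lambda>z. local_rep A \<kappa> \<omega> z v - c * local_rep A \<kappa> \<omega>' z v) has_derivative (\<lambda>h. F.Dw y h v - c * F'.Dw y h v)) (at y)" for v
      by (intro has_derivative_diff has_derivative_mult_right F.w_derivative F'.w_derivative y)
    then have D: "frechet_derivative (\<lambda>z. local_rep A \<kappa> (\<lambda>p \<xi>. \<omega> p \<xi> - c * \<omega>' p \<xi>) z v) (at y) = (\<lambda>h. F.Dw y h v - c * F'.Dw y h v)" for v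
      unfolding local_rep_def by (rule frechet_derivative_at[symmetric])
    have "ext_deriv A \<kappa> (\<lambda>p \<xi>. \<omega> p \<xi> - c * \<omega>' p \<xi>) y u v = F.dext y u v - c * F'.dext y u v"
      unfolding ext_deriv_def D F.dext_def F'.dext_def by (simp add: algebra_simps)
    \<comment> \<open>Where one of the exterior derivatives is nonzero, the pointwise factor is \<open>c\<close> because the metrics determine it.\<close>
    also have "\<dots> = 0"
    proof (cases "F.dext y u v \<noteq> 0 \<or> F'.dext y u v \<noteq> 0")
      case True
      obtain c' where c': "c' > 0" "\<And>u v. local_rep2 A \<kappa> g y u v = c'\<^sup>2 * local_rep2 A \<kappa> g' y u v"
          "\<And>u v. F.dext y u v = c' * F'.dext y u v"
        using conformal_where_not_closed[OF y True] by blast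
      have dom: "chart_inv \<kappa> y \<in> chart_dom \<kappa>" by (rule chart_inv_dom[OF y])
      obtain e :: 'a where "e \<in> Basis" using nonempty_Basis by blast
      then have pos: "local_rep2 A \<kappa> g' y e e > 0" by (intro F'.G_pos[OF y] nonzero_Basis)
      have "local_rep2 A \<kappa> g y e e = c\<^sup>2 * local_rep2 A \<kappa> g' y e e"
        unfolding local_rep2_def
        by (rule metric[OF dom_in_topspace[OF \<kappa> dom] coord_vec_tangent[OF \<kappa> dom] coord_vec_tangent[OF \<kappa> dom]])
      then have "c'\<^sup>2 * local_rep2 A \<kappa> g' y e e = c\<^sup>2 * local_rep2 A \<kappa> g' y e e"
        unfolding c'(2)[of e e] .
      then have "c'\<^sup>2 = c\<^sup>2" using pos by (simp only: mult_right_cancel[OF less_imp_neq[OF pos, symmetric]])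
      then have "c' = c" by (rule power2_eq_imp_eq) (use c'(1) c(1) in auto)
      then show ?thesis using c'(3) by simp
    qed simp
    finally show ?thesis .
  qed
  then have "closed_form A (\<lambda>p \<xi>. \<omega> p \<xi> - c * \<omega>' p \<xi>)" by (simp add: closed_form_def)
  then show ?thesis using c(1) metric by blast
qed

end
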